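(* Let $p$ be a prime, let $r_1,r_p\in\mathbb{Q}$, put $n_\infty=(r_1+pr_p)/24$, $n_1=(pr_1+r_p)/24$, $k'=(r_1+r_p)/2$, let $D$ be a positive integer with $Dr_1,Dr_p\in\mathbb{Z}$, and let $k\in k'+2\mathbb{Z}$ be a rational number with $k>2$. Let $T=\begin{pmatrix}1&1\\0&1\end{pmatrix}$ and $\gamma_1=\begin{pmatrix}1&0\\1&1\end{pmatrix}$. Then: (i) $\chi_{r_1,r_p}(\widetilde{T})=1$ if and only if $n_\infty\in\mathbb{Z}$, and in this case the series $E_{k,p}^{i\infty}(\tau;r_1,r_p)$ belongs to $M_k(\widetilde{\Gamma_0(p)}^{2D};\chi_{r_1,r_p})$; (ii) $\chi_{r_1,r_p}(\widetilde{\gamma_1}\widetilde{T}^p\widetilde{\gamma_1}^{-1})=1$ if and only if $n_1\in\mathbb{Z}$, and in this case the series $E_{k,p}^{1}(\tau;r_1,r_p)$ is well defined and belongs to $M_k(\widetilde{\Gamma_0(p)}^{2D};\chi_{r_1,r_p})$.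
   Context: Notation: $e(x)=\exp(2\pi i x)$; $\tau$ ranges over the upper half plane $\mathbb{H}$; $q^n=e(n\tau)$. All fractional powers are principal branches: $z^\alpha=\exp(\alpha\log z)$ with $-\pi<\operatorname{Im}\log z\le\pi$. Dedekind sums: $s(h,c)=\sum_{r\bmod c}((r/c))((hr/c))$ for $h\in\mathbb{Z}$, $c\ge1$, where $((x))=x-\lfloor x\rfloor-1/2$ if $x\notin\mathbb{Z}$ and $((x))=0$ if $x\in\mathbb{Z}$. Covers: for a positive integer $D$, $\widetilde{SL_2(\mathbb{R})}^D$ is the group of pairs $(M,\phi)$ with $M=\begin{pmatrix}a&b\\c&d\end{pmatrix}\in SL_2(\mathbb{R})$ and $\phi(\tau)=\varepsilon(c\tau+d)^{1/D}$, $\varepsilon^D=1$, with product $(M_1,\phi_1)(M_2,\phi_2)=(M_1M_2,\phi_1(M_2\tau)\phi_2(\tau))$. For $G\subseteq SL_2(\mathbb{R})$, $\widetilde{G}^D$ is the preimage of $G$ under $(M,\phi)\mapsto M$, and for $M\in SL_2(\mathbb{R})$, $\widetilde{M}=(M,(c\tau+d)^{1/D})$. For $k\in\frac1D\mathbb{Z}$ the slash operator is $f|_k(M,\varepsilon(c\tau+d)^{1/D})(\tau)=\varepsilon^{-Dk}(c\tau+d)^{-k}f(\frac{a\tau+b}{c\tau+d})$. For a finite-index subgroup $G\le SL_2(\mathbb{Z})$ and a character $\chi$ of $\widetilde{G}^D$ with finite-index kernel, $M_k(\widetilde G^D;\chi)$ is the space of holomorphic $f:\mathbb{H}\to\mathbb{C}$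 with $f|_k\gamma=\chi(\gamma)f$ for all $\gamma\in\widetilde G^D$ and such that $\lim_{\operatorname{Im}\tau\to+\infty}(f|_k\gamma)(\tau)$ exists for all $\gamma\in\widetilde{SL_2(\mathbb{Z})}^D$. $\Gamma_0(p)$ is the group of matrices in $SL_2(\mathbb{Z})$ with lower-left entry divisible by $p$. Eta powers: $\eta(\tau)=q^{1/24}\prod_{n\ge1}(1-q^n)$, $\log\eta(\tau)=\log\eta(i)+\int_i^\tau\eta'(z)/\eta(z)\,dz$ (real logarithm of $\eta(i)>0$), and $\eta^r=\exp(r\log\eta)$ for $r\in\mathbb{Q}$. $\chi_{r_1,r_p}:\widetilde{\Gamma_0(p)}^{2D}\to\mathbb{C}^\times$ is the multiplier system of $f=\eta^{r_1}(\tau)\eta^{r_p}(p\tau)$, i.e. the character with $f|_{k'}\gamma=\chi_{r_1,r_p}(\gamma)f$ for all $\gamma\in\widetilde{\Gamma_0(p)}^{2D}$. Eisenstein series: $E_{k,p}^{i\infty}(\tau;r_1,r_p)=1+\sum_{p\mid c>0,\ d\in\mathbb{Z},\ \gcd(c,d)=1}(c\tau+d)^{-k}e\big(-r_1(\frac{a+d}{24c}+\frac12 s(-d,c)-\frac18)-r_p(\frac{a+d}{24c/p}+\frac12 s(-d,c/p)-\frac18)\big)$, where for each $(c,d)$, $a$ is any integer with $ad\equiv1\pmod c$; $E_{k,p}^{1}(\tau;r_1,r_p)=\sum_{c>0,\ d\in\mathbb{Z},\ \gcd(c,d)=\gcd(p,c)=1}(c\tau+d)^{-k}e\big(-r_1(\frac{a+b+d}{24(a+c)}+\frac12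 s(-b-d,a+c)-\frac18)-r_p(\frac{a+b+d}{24(a+c)/p}+\frac12 s(-b-d,(a+c)/p)-\frac18)\big)$, where for each $(c,d)$, $a,b$ are any integers with $ad-bc=1$, $p\mid a+c$, $a+c>0$. *)

theory Defs
  imports
    "HOL-Complex_Analysis.Complex_Analysis"
    "HOL-Algebra.Coset"
    "HOL-Number_Theory.Cong"
begin

definition uhp :: "complex set" where
  "uhp = {\<tau>. 0 < Im \<tau>}"

definition e :: "complex \<Rightarrow> complex" where
  "e x = exp (2 * of_real pi * \<i> * x)"


section \<open>Dedekind sums\<close>

definition sawtooth :: "real \<Rightarrow> real" where
  "sawtooth x = (if x \<in> \<int> then 0 else x - of_int \<lfloor>x\<rfloor> - 1 / 2)"

definition dedekind_sum :: "int \<Rightarrow> int \<Rightarrow> real" where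
  "dedekind_sum h c =
     (\<Sum>r\<in>{0..<c}. sawtooth (of_int r / of_int c) * sawtooth (of_int (h * r) / of_int c))"


section \<open>Matrices and covers of \<open>SL\<^sub>2(\<real>)\<close>\<close>

definition mat2 :: "real \<Rightarrow> real \<Rightarrow> real \<Rightarrow> real \<Rightarrow> real ^ 2 ^ 2" where
  "mat2 a b c d = vector [vector [a, b], vector [c, d]]"

definition moebius :: "real ^ 2 ^ 2 \<Rightarrow> complex \<Rightarrow> complex" where
  "moebius M \<tau> = (of_real (M $ 1 $ 1) * \<tau> + of_real (M $ 1 $ 2))
               / (of_real (M $ 2 $ 1) * \<tau> + of_real (M $ 2 $ 2))"

definition autom_factor :: "real ^ 2 ^ 2 \<Rightarrow> complex \<Rightarrow> complex" where
  "autom_factor M \<tau> = of_real (M $ 2 $ 1) * \<tau> + of_real (M $ 2 $ 2)"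

definition SL2R :: "(real ^ 2 ^ 2) monoid" where
  "SL2R = \<lparr>carrier = {M. det M = 1}, mult = (**), one = mat 1\<rparr>"

definition SL2Z :: "(real ^ 2 ^ 2) set" where
  "SL2Z = {M \<in> carrier SL2R. \<forall>i j. M $ i $ j \<in> \<int>}"

definition Gamma0 :: "nat \<Rightarrow> (real ^ 2 ^ 2) set" where
  "Gamma0 p = {M \<in> SL2Z. \<exists>m::int. M $ 2 $ 1 = of_int (int p * m)}"

text \<open>The functions \<open>\<phi>\<close> live on the upper half plane only; \<open>restrict\<close> fixes their values
  elsewhere, so that equality of pairs is equality of the functions on the upper half plane.\<close>

type_synonym cover = "(real ^ 2 ^ 2) \<times> (complex \<Rightarrow> complex)"

definition cover_elt :: "nat \<Rightarrow> real ^ 2 ^ 2 \<Rightarrow> complex \<Rightarrow> cover" where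
  "cover_elt D M \<epsilon> =
     (M, restrict (\<lambda>\<tau>. \<epsilon> * autom_factor M \<tau> powr (1 / of_nat D)) uhp)"

definition SL2R_cover :: "nat \<Rightarrow> cover monoid" where
  "SL2R_cover D =
     \<lparr>carrier = {cover_elt D M \<epsilon> |M \<epsilon>. M \<in> carrier SL2R \<and> \<epsilon> ^ D = 1},
      mult = (\<lambda>(M1, \<phi>1) (M2, \<phi>2).
        (M1 ** M2, restrict (\<lambda>\<tau>. \<phi>1 (moebius M2 \<tau>) * \<phi>2 \<tau>) uhp)),
      one = (mat 1, restrict (\<lambda>\<tau>. 1) uhp)\<rparr>"

definition cover_preimage :: "nat \<Rightarrow> (real ^ 2 ^ 2) set \<Rightarrow> cover set" where
  "cover_preimage D G = {g \<in> carrier (SL2R_cover D). fst g \<in> G}"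

definition cover_lift :: "nat \<Rightarrow> real ^ 2 ^ 2 \<Rightarrow> cover" where
  "cover_lift D M = cover_elt D M 1"

text \<open>The root of unity \<open>\<epsilon>\<close> is recovered from the pair \<open>(M, \<phi>)\<close>; it is unique because the
  factor \<open>c\<tau> + d\<close> does not vanish.\<close>

definition cover_root :: "nat \<Rightarrow> cover \<Rightarrow> complex" where
  "cover_root D g = (THE \<epsilon>. g = cover_elt D (fst g) \<epsilon>)"


section \<open>Slash operator and modular forms\<close>

text \<open>The weight is assumed to lie in \<open>(1/D)\<int>\<close>, so the floor is the integer \<open>D k\<close>.\<close>

definition slash :: "nat \<Rightarrow> real \<Rightarrow> (complex \<Rightarrow> complex) \<Rightarrow> cover \<Rightarrow> complex \<Rightarrow> complex" where
  "slash D k f g \<tau> =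
     cover_root D g powi (- \<lfloor>real D * k\<rfloor>) * autom_factor (fst g) \<tau> powr (- of_real k)
       * f (moebius (fst g) \<tau>)"

definition finite_index_subgroup :: "'a set \<Rightarrow> ('a, 'b) monoid_scheme \<Rightarrow> bool" where
  "finite_index_subgroup H K \<longleftrightarrow> subgroup H K \<and> finite (rcosets\<^bsub>K\<^esub> H)"

definition finite_index_character :: "nat \<Rightarrow> (real ^ 2 ^ 2) set \<Rightarrow> (cover \<Rightarrow> complex) \<Rightarrow> bool" where
  "finite_index_character D G chi \<longleftrightarrow>
     (\<forall>g\<in>cover_preimage D G. chi g \<noteq> 0) \<and>
     (\<forall>g\<in>cover_preimage D G. \<forall>h\<in>cover_preimage D G.
        chi (g \<otimes>\<^bsub>SL2R_cover D\<^esub> h) = chi g * chi h) \<and>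
     finite_index_subgroup {g \<in> cover_preimage D G. chi g = 1}
       (SL2R_cover D\<lparr>carrier := cover_preimage D G\<rparr>)"

text \<open>The first three conditions only concern the data for which the space is defined. The limit
  is taken as \<open>Im \<tau>\<close> tends to infinity with no restriction on \<open>Re \<tau>\<close>.\<close>

definition modular_forms ::
  "nat \<Rightarrow> real \<Rightarrow> (real ^ 2 ^ 2) set \<Rightarrow> (cover \<Rightarrow> complex) \<Rightarrow> (complex \<Rightarrow> complex) set" where
  "modular_forms D k G chi =
     {f. real D * k \<in> \<int> \<and>
         finite_index_subgroup G (SL2R\<lparr>carrier := SL2Z\<rparr>) \<and>
         finite_index_character D G chi \<and>
         f holomorphic_on uhp \<and>
         (\<forall>g\<in>cover_preimage D G. \<forall>\<tau>\<in>uhp. slash D k f g \<tau> = chi g * f \<tau>) \<and>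
         (\<forall>g\<in>cover_preimage D SL2Z. \<exists>L. (slash D k f g \<longlongrightarrow> L) (filtercomap Im at_top))}"


section \<open>Powers of the eta function\<close>

definition eta :: "complex \<Rightarrow> complex" where
  "eta \<tau> = e (\<tau> / 24) * (\<Prod>n. 1 - e (of_nat (Suc n) * \<tau>))"

text \<open>The integrand is holomorphic on the upper half plane, so the integral does not depend on the
  path; we take the segment.\<close>

definition log_eta :: "complex \<Rightarrow> complex" where
  "log_eta \<tau> = of_real (ln (Re (eta \<i>)))
     + contour_integral (linepath \<i> \<tau>) (\<lambda>z. deriv eta z / eta z)"

definition eta_pow :: "real \<Rightarrow> complex \<Rightarrow> complex" where
  "eta_pow r \<tau> = exp (of_real r * log_eta \<tau>)"

definition eta_quot :: "nat \<Rightarrow> real \<Rightarrow> real \<Rightarrow> complex \<Rightarrow> complex" where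
  "eta_quot p r1 rp \<tau> = eta_pow r1 \<tau> * eta_pow rp (of_nat p * \<tau>)"

definition eta_mult :: "nat \<Rightarrow> nat \<Rightarrow> real \<Rightarrow> real \<Rightarrow> cover \<Rightarrow> complex" where
  "eta_mult D p r1 rp g = (THE w. \<forall>\<tau>\<in>uhp.
     slash (2 * D) ((r1 + rp) / 2) (eta_quot p r1 rp) g \<tau> = w * eta_quot p r1 rp \<tau>)"


section \<open>Eisenstein series\<close>

definition eta_phase :: "int \<Rightarrow> int \<Rightarrow> int \<Rightarrow> real" where
  "eta_phase t d c = of_int t / (24 * of_int c) + 1 / 2 * dedekind_sum (- d) c - 1 / 8"

text \<open>The arguments \<open>a, c, d\<close> are the entries of a matrix with lower left entry \<open>c > 0\<close> divisible
  by \<open>p\<close>. In the series at the cusp 1 this is the matrix with entries \<open>a, b, a + c, b + d\<close>.\<close>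

definition eis_factor :: "nat \<Rightarrow> real \<Rightarrow> real \<Rightarrow> int \<Rightarrow> int \<Rightarrow> int \<Rightarrow> complex" where
  "eis_factor p r1 rp a c d =
     e (of_real (- r1 * eta_phase (a + d) d c - rp * eta_phase (a + d) d (c div int p)))"

text \<open>The summands are given in terms of auxiliary integers which can be any solutions of certain
  conditions. We collect the values for all choices; the series is well defined if, for every
  \<open>(c, d)\<close>, there is exactly one such value and if the resulting series converges. The latter is
  unordered (hence absolute) convergence.\<close>

definition eis_inf_index :: "nat \<Rightarrow> (int \<times> int) set" where
  "eis_inf_index p = {(c, d). int p dvd c \<and> c > 0 \<and> gcd c d = 1}"

definition eis_inf_values :: "nat \<Rightarrow> real \<Rightarrow> real \<Rightarrow> int \<Rightarrow> int \<Rightarrow> complex set" where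
  "eis_inf_values p r1 rp c d = {eis_factor p r1 rp a c d |a. [a * d = 1] (mod c)}"

definition eis_inf_term ::
  "real \<Rightarrow> nat \<Rightarrow> real \<Rightarrow> real \<Rightarrow> complex \<Rightarrow> int \<times> int \<Rightarrow> complex" where
  "eis_inf_term k p r1 rp \<tau> = (\<lambda>(c, d).
     (of_int c * \<tau> + of_int d) powr (- of_real k) * the_elem (eis_inf_values p r1 rp c d))"

definition eis_inf_well_defined :: "real \<Rightarrow> nat \<Rightarrow> real \<Rightarrow> real \<Rightarrow> bool" where
  "eis_inf_well_defined k p r1 rp \<longleftrightarrow>
     (\<forall>(c, d)\<in>eis_inf_index p. is_singleton (eis_inf_values p r1 rp c d)) \<and>
     (\<forall>\<tau>\<in>uhp. eis_inf_term k p r1 rp \<tau> summable_on eis_inf_index p)"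

definition eis_inf :: "real \<Rightarrow> nat \<Rightarrow> real \<Rightarrow> real \<Rightarrow> complex \<Rightarrow> complex" where
  "eis_inf k p r1 rp \<tau> = 1 + infsum (eis_inf_term k p r1 rp \<tau>) (eis_inf_index p)"

definition eis_one_index :: "nat \<Rightarrow> (int \<times> int) set" where
  "eis_one_index p = {(c, d). c > 0 \<and> gcd c d = 1 \<and> gcd (int p) c = 1}"

definition eis_one_values :: "nat \<Rightarrow> real \<Rightarrow> real \<Rightarrow> int \<Rightarrow> int \<Rightarrow> complex set" where
  "eis_one_values p r1 rp c d =
     {eis_factor p r1 rp a (a + c) (b + d) |a b.
        a * d - b * c = 1 \<and> int p dvd a + c \<and> a + c > 0}"

definition eis_one_term ::
  "real \<Rightarrow> nat \<Rightarrow> real \<Rightarrow> real \<Rightarrow> complex \<Rightarrow> int \<times> int \<Rightarrow> complex" where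
  "eis_one_term k p r1 rp \<tau> = (\<lambda>(c, d).
     (of_int c * \<tau> + of_int d) powr (- of_real k) * the_elem (eis_one_values p r1 rp c d))"

definition eis_one_well_defined :: "real \<Rightarrow> nat \<Rightarrow> real \<Rightarrow> real \<Rightarrow> bool" where
  "eis_one_well_defined k p r1 rp \<longleftrightarrow>
     (\<forall>(c, d)\<in>eis_one_index p. is_singleton (eis_one_values p r1 rp c d)) \<and>
     (\<forall>\<tau>\<in>uhp. eis_one_term k p r1 rp \<tau> summable_on eis_one_index p)"

definition eis_one :: "real \<Rightarrow> nat \<Rightarrow> real \<Rightarrow> real \<Rightarrow> complex \<Rightarrow> complex" where
  "eis_one k p r1 rp \<tau> = infsum (eis_one_term k p r1 rp \<tau>) (eis_one_index p)"

end

(*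
The logarithm of eta is written as an explicit series Leta.  Its derivative is the weight-two
Eisenstein series in the conditionally convergent order of summation; exchanging the order of
summation, by comparison with a telescoping series, gives the law under tau -> -1/tau, and the
Euclidean algorithm together with Dedekind reciprocity extends it to all of SL_2(Z) with the
phases of the statement.

Let f be the eta quotient and k = k' + 2m.  The law of log eta shows that every summand of the two
Eisenstein series equals f(tau) (c tau + d)^(-2m) / h(gamma tau), where h = f for the cusp at
infinity and h = f|gamma_1 for the cusp 1, and gamma is a matrix with lower row (c, d).  The series
is therefore f times an ordinary Poincare series of even integral weight 2m with trivial
multiplier, so its transformation law reduces to that of f and a permutation of the lower rows.
The integrality of n_inf, respectively n_one, is exactly the periodicity that makes h(gamma tau)
depend only on the lower row of gamma.

Every summand has absolute value |c tau + d|^(-k).  This gives convergence, and also the limits at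
the cusps: terms with c = 0 are constant, and the sum of the others is bounded by a function of
period 1 that decays as Im tau grows.
*)

theory Submission
  imports Defs
begin


section \<open>Dedekind sums\<close>

text \<open>The summands contain principal powers with real exponents, so rearranging them directly
  under Gamma_0(p) would mean tracking a branch for every row. Dividing by f leaves only the even
  exponent 2m: rows then matter only up to sign, and the normalisation c > 0 can be restored after
  any permutation. The remaining branches are controlled mainly by two facts: arguments of points of
  the upper half plane stay in (0, pi), and the cocycle of log (c tau + d) is a constant integer
  multiple of 2 pi i by connectedness. The integer 2m may be small or negative, so the usual
  convergence criterion for Poincare series does not apply to it; all estimates are made on the
  product with f, of weight k > 2. Dedekind sums enter because inversion exchanges the entries of
  the lower row: s(d,c) has to be traded for s(c,d), which is reciprocity. At the cusp 1, the
  factorisation diag(p, 1) gamma_1 = (p, -1; 1, 0) (1, 1; 0, p) exhibits f|gamma_1, up to a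
  constant, as a product of eta powers at tau and (tau + 1)/p. This makes the width p
  visible.\<close>

lemma sawtooth_minus: "sawtooth (- x) = - sawtooth x"
proof (cases "x \<in> \<int>")
  case False
  then have "x \<noteq> of_int \<lfloor>x\<rfloor>" by (metis Ints_of_int)
  then have "\<lfloor>- x\<rfloor> = - \<lfloor>x\<rfloor> - 1"
    by linarith
  with False show ?thesis
    by (auto simp: sawtooth_def)
qed (simp add: sawtooth_def)

lemma sawtooth_add_int: "sawtooth (x + of_int n) = sawtooth x"
  by (auto simp: sawtooth_def)

lemma dedekind_sum_minus: "dedekind_sum (- h) c = - dedekind_sum h c"
  by (simp add: dedekind_sum_def sawtooth_minus sum_negf)

lemma dedekind_sum_add_mult:
  assumes "c > 0"
  shows "dedekind_sum (h + n * c) c = dedekind_sum h c"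
proof -
  have "of_int ((h + n * c) * r) / of_int c = of_int (h * r) / of_int c + (of_int (n * r) :: real)"
    for r using assms by (simp add: field_simps)
  then show ?thesis
    by (simp only: dedekind_sum_def sawtooth_add_int)
qed

lemma dedekind_sum_1: "dedekind_sum h 1 = 0"
  by (simp add: dedekind_sum_def sawtooth_def)

lemma sawtooth_divide:
  assumes "c > 0"
  shows "sawtooth (of_int n / of_int c) =
    (if c dvd n then 0 else of_int (n mod c) / of_int c - 1 / 2)"
proof (cases "c dvd n")
  case True
  then show ?thesis using assms by (auto simp: sawtooth_def elim!: dvdE)
next
  case False
  have "of_int n / of_int c \<notin> (\<int> :: real set)"
  proof
    assume "of_int n / of_int c \<in> (\<int> :: real set)"
    then obtain m where "of_int n / of_int c = (of_int m :: real)" by (elim Ints_cases)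
    then have "real_of_int n = real_of_int (m * c)" using assms by (simp add: field_simps)
    then have "n = m * c" by linarith
    with False show False by simp
  qed
  moreover have "\<lfloor>of_int n / (of_int c :: real)\<rfloor> = n div c"
    by (rule floor_divide_of_int_eq)
  moreover have "real_of_int n = of_int (n div c) * of_int c + of_int (n mod c)"
    by (metis div_mult_mod_eq of_int_add of_int_mult)
  ultimately show ?thesis using assms False
    by (simp add: sawtooth_def field_simps)
qed

lemma bij_betw_mult_mod:
  fixes h c :: int
  assumes "c > 0" "coprime h c"
  shows "bij_betw (\<lambda>r. h * r mod c) {1..<c} {1..<c}"
proof -
  have inj: "inj_on (\<lambda>r. h * r mod c) {1..<c}"
  proof
    fix x y assume xy: "x \<in> {1..<c}" "y \<in> {1..<c}" "h * x mod c = h * y mod c"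
    then have "c dvd h * (x - y)" by (simp add: mod_eq_dvd_iff algebra_simps)
    then have "c dvd x - y" using assms(2) by (metis coprime_commute coprime_dvd_mult_right_iff)
    then have "x mod c = y mod c" by (simp add: mod_eq_dvd_iff)
    then show "x = y" using xy by simp
  qed
  have "(\<lambda>r. h * r mod c) ` {1..<c} \<subseteq> {1..<c}"
  proof safe
    fix r assume r: "r \<in> {1..<c}"
    have "\<not> c dvd h * r"
      using r assms by (metis atLeastLessThan_iff coprime_commute coprime_dvd_mult_right_iff
          less_le_trans not_le zdvd_imp_le zero_less_one)
    then have "h * r mod c \<noteq> 0" by (simp add: dvd_eq_mod_eq_0)
    moreover have "0 \<le> h * r mod c" "h * r mod c < c" using assms by simp_all
    ultimately show "h * r mod c \<in> {1..<c}" by simp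
  qed
  then show ?thesis
    using inj by (simp add: bij_betw_def endo_inj_surj)
qed

lemma sum_atLeast1_int: "n \<ge> 1 \<Longrightarrow> (\<Sum>r\<in>{1..<n::int}. real_of_int r) = n * (n - 1) / 2"
proof (induction n rule: int_ge_induct)
  case (step i)
  have "{1..<i + 1} = insert i {1..<i}" using step by auto
  with step show ?case by (simp add: field_simps)
qed simp

lemma sum_squares_atLeast1_int:
  "n \<ge> 1 \<Longrightarrow> (\<Sum>r\<in>{1..<n::int}. (real_of_int r)\<^sup>2) = (n - 1) * n * (2 * n - 1) / 6"
proof (induction n rule: int_ge_induct)
  case (step i)
  have "{1..<i + 1} = insert i {1..<i}" using step by auto
  with step show ?case by (simp add: field_simps power2_eq_square)
qed simp

text \<open>Multiplication by \<open>h\<close> permutes the nonzero residues modulo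
  \<open>c\<close>, so the linear terms created by the two shifts by 1/2 have sums independent of
  \<open>h\<close>; only the mixed sum carries information.\<close>

lemma dedekind_sum_coprime:
  assumes "c > 0" "coprime h c"
  shows "dedekind_sum h c =
    (\<Sum>r\<in>{1..<c}. of_int r * of_int (h * r mod c)) / (of_int c)\<^sup>2 - (of_int c - 1) / 4"
    (is "_ = ?X / _ - _")
proof -
  note bij = bij_betw_mult_mod[OF assms]
  have S: "(\<Sum>r\<in>{1..<c}. real_of_int (h * r mod c)) = of_int c * (of_int c - 1) / 2"
    using sum.reindex_bij_betw[OF bij, of real_of_int] sum_atLeast1_int[of c] assms by simp
  have "dedekind_sum h c = (\<Sum>r\<in>{1..<c}. (of_int r / of_int c - 1 / 2) *
      (of_int (h * r mod c) / of_int c - 1 / 2))"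
    unfolding dedekind_sum_def
  proof (rule sum.mono_neutral_cong_right)
    fix r assume r: "r \<in> {1..<c}"
    have "\<not> c dvd r" using r zdvd_imp_le[of c r] by auto
    moreover have "\<not> c dvd h * r"
      using calculation assms coprime_dvd_mult_right_iff coprime_commute by blast
    moreover have "r mod c = r" using r by simp
    ultimately show "sawtooth (of_int r / of_int c) * sawtooth (of_int (h * r) / of_int c) =
        (of_int r / of_int c - 1 / 2) * (of_int (h * r mod c) / of_int c - 1 / 2)"
      using assms(1) by (simp only: sawtooth_divide if_False)
  next
    have "r = 0" if "r \<in> {0..<c} - {1..<c}" for r using that by auto
    then show "\<forall>r\<in>{0..<c} - {1..<c}.
        sawtooth (of_int r / of_int c) * sawtooth (of_int (h * r) / of_int c) = 0"
      by (metis Ints_0 div_0 mult_zero_left of_int_0 sawtooth_def)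
  qed auto
  also have "\<dots> = (\<Sum>r\<in>{1..<c}. of_int r * of_int (h * r mod c) / (of_int c)\<^sup>2
      - of_int r / (2 * of_int c) - of_int (h * r mod c) / (2 * of_int c) + 1 / 4)"
    using assms by (intro sum.cong refl) (simp add: field_simps power2_eq_square)
  also have "\<dots> = ?X / (of_int c)\<^sup>2 - (\<Sum>r\<in>{1..<c}. real_of_int r) / (2 * of_int c)
      - (\<Sum>r\<in>{1..<c}. real_of_int (h * r mod c)) / (2 * of_int c) + (of_int c - 1) / 4"
    using assms by (simp add: sum.distrib sum_subtractf sum_divide_distrib)
  also have "\<dots> = ?X / (of_int c)\<^sup>2 - (of_int c - 1) / 4"
  proof -
    have S': "(\<Sum>r\<in>{1..<c}. real_of_int r) = of_int c * (of_int c - 1) / 2"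
      using assms sum_atLeast1_int[of c] by simp
    show ?thesis unfolding S S' using assms by (simp add: field_simps)
  qed
  finally show ?thesis .
qed

lemma le_div_iff_mult_le_int:
  fixes c :: int
  assumes "c > 0"
  shows "j \<le> n div c \<longleftrightarrow> j * c \<le> n"
proof
  assume "j \<le> n div c"
  then have "j * c \<le> n div c * c" using assms by (simp add: mult_right_mono)
  also have "\<dots> \<le> n" using assms by (metis add_le_same_cancel1 div_mult_mod_eq
        add.commute le_add_same_cancel1 pos_mod_sign)
  finally show "j * c \<le> n" .
next
  assume "j * c \<le> n"
  then have "j * c div c \<le> n div c" using assms by (rule zdiv_mono1)
  then show "j \<le> n div c" using assms by simp
qed

text \<open>A lattice point count. Since n(n+1) is twice 1 + ... + n, the left side is twice the sum
  of the heights of the lattice points below the diagonal of the c by h rectangle. Counting by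
  height instead of by column brings in the quotients with \<open>c\<close> and \<open>h\<close>
  exchanged.\<close>

lemma sum_div_mult_Suc:
  fixes h c :: int
  assumes "c > 0" "h > 0" "coprime h c"
  shows "(\<Sum>r\<in>{1..<c}. (h * r div c) * (h * r div c + 1)) =
    (c - 1) * h * (h - 1) - 2 * (\<Sum>j\<in>{1..<h}. j * (c * j div h))"
proof -
  have gauss: "n * (n + 1) = 2 * (\<Sum>j\<in>{1..n}. j)" if "n \<ge> 0" for n :: int
    using that
  proof (induction n rule: int_ge_induct)
    case (step i)
    have "{1..i + 1} = insert (i + 1) {1..i}" using step by auto
    with step show ?case by (simp add: algebra_simps)
  qed simp
  have row: "{1..h * r div c} = {j \<in> {1..<h}. c * j < h * r}" if r: "r \<in> {1..<c}" for r
  proof -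
    have 1: "j \<le> h * r div c \<longleftrightarrow> j * c \<le> h * r" for j
      using le_div_iff_mult_le_int assms(1) by blast
    \<comment> \<open>Coprimality keeps lattice points off the diagonal, so weak and strict
      inequality agree.\<close>
    have 2: "j * c \<noteq> h * r" for j
    proof
      assume "j * c = h * r"
      then have "c dvd h * r" by (metis dvd_triv_right)
      then have "c dvd r" using assms by (metis coprime_commute coprime_dvd_mult_right_iff)
      then show False using r zdvd_imp_le by fastforce
    qed
    have 3: "j < h" if "j * c \<le> h * r" for j
    proof -
      have "j * c < h * c" using that r assms
        by (smt (verit) atLeastLessThan_iff mult_strict_left_mono)
      then show ?thesis using assms by simp
    qed
    show ?thesis
    proof (rule Set.set_eqI)
      fix j show "j \<in> {1..h * r div c} \<longleftrightarrow> j \<in> {j \<in> {1..<h}. c * j < h * r}"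
      unfolding mem_Collect_eq atLeastAtMost_iff atLeastLessThan_iff mult.commute[of c j]
      using 1[of j] 2[of j] 3[of j] order.strict_iff_order[of "j * c" "h * r"] by blast
    qed
  qed
  have col: "card {r \<in> {1..<c}. c * j < h * r} = nat (c - 1 - c * j div h)"
    if j: "j \<in> {1..<h}" for j
  proof -
    define J where "J = c * j div h"
    have 1: "c * j < h * r \<longleftrightarrow> J < r" for r
      unfolding J_def
      using le_div_iff_mult_le_int[OF assms(2), of r "c * j"] by (metis mult.commute not_le)
    have 2: "0 \<le> J" using assms j by (simp add: J_def pos_imp_zdiv_nonneg_iff)
    have "{r \<in> {1..<c}. c * j < h * r} = {J + 1..<c}"
    proof (rule Set.set_eqI)
      fix r show "r \<in> {r \<in> {1..<c}. c * j < h * r} \<longleftrightarrow> r \<in> {J + 1..<c}"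
        unfolding mem_Collect_eq atLeastLessThan_iff 1 using 2 by linarith
    qed
    then show ?thesis by (simp add: J_def algebra_simps)
  qed
  have le: "c * j div h \<le> c - 1" if "j \<in> {1..<h}" for j
  proof -
    have "c * j < c * h" using that assms by simp
    then have "c * j div h < c"
      using le_div_iff_mult_le_int[OF assms(2), of c "c * j"] by linarith
    then show ?thesis by simp
  qed
  have "(\<Sum>r\<in>{1..<c}. (h * r div c) * (h * r div c + 1)) =
      (\<Sum>r\<in>{1..<c}. 2 * (\<Sum>j\<in>{1..<h}. if c * j < h * r then j else 0))"
  proof (intro sum.cong refl)
    fix r assume r: "r \<in> {1..<c}"
    then have "h * r div c \<ge> 0" using assms by (simp add: pos_imp_zdiv_nonneg_iff)
    then show "(h * r div c) * (h * r div c + 1) =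
        2 * (\<Sum>j\<in>{1..<h}. if c * j < h * r then j else 0)"
      unfolding gauss[OF \<open>h * r div c \<ge> 0\<close>] row[OF r] by (subst sum.inter_filter) simp_all
  qed
  also have "\<dots> = 2 * (\<Sum>j\<in>{1..<h}. \<Sum>r\<in>{1..<c}. if c * j < h * r then j else 0)"
    by (subst sum.swap) (simp add: sum_distrib_left)
  also have "(\<Sum>j\<in>{1..<h}. \<Sum>r\<in>{1..<c}. if c * j < h * r then j else 0) =
      (\<Sum>j\<in>{1..<h}. j * (c - 1 - c * j div h))"
  proof (intro sum.cong refl)
    fix j assume j: "j \<in> {1..<h}"
    have "(\<Sum>r\<in>{1..<c}. if c * j < h * r then j else 0) = (\<Sum>r\<in>{r \<in> {1..<c}. c * j < h * r}. j)"
      by (rule sum.inter_filter[symmetric]) simp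
    also have "\<dots> = j * (c - 1 - c * j div h)"
      unfolding sum_constant col[OF j] using le[OF j] by simp
    finally show "(\<Sum>r\<in>{1..<c}. if c * j < h * r then j else 0) = j * (c - 1 - c * j div h)" .
  qed
  also have "\<dots> = (c - 1) * (\<Sum>j\<in>{1..<h}. j) - (\<Sum>j\<in>{1..<h}. j * (c * j div h))"
    by (simp add: algebra_simps sum_subtractf sum_distrib_left sum.distrib)
  also have "2 * ((c - 1) * (\<Sum>j\<in>{1..<h}. j) - (\<Sum>j\<in>{1..<h}. j * (c * j div h))) =
      (c - 1) * h * (h - 1) - 2 * (\<Sum>j\<in>{1..<h}. j * (c * j div h))"
  proof -
    have g: "2 * (\<Sum>j\<in>{1..<h}. j) = (h - 1) * h"
    proof -
      have "{1..<h} = {1..h - 1}" by auto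
      then show ?thesis using gauss[of "h - 1"] assms by simp
    qed
    have "2 * ((c - 1) * (\<Sum>j\<in>{1..<h}. j)) = (c - 1) * (2 * (\<Sum>j\<in>{1..<h}. j))"
      by (simp only: mult.left_commute)
    then show ?thesis unfolding right_diff_distrib[of 2] g by (simp only: mult_ac)
  qed
  finally show ?thesis .
qed

text \<open>The residues \<open>m r\<close> are a permutation of 1, ..., c-1, hence have the same
  sum of squares. Expanding (h r - c q)^2 turns this into a relation between the mixed sum
  \<open>X\<close> and the sum \<open>Q\<close> of the squared quotients, and the lattice point
  count expresses \<open>Q\<close> through the mixed sum \<open>X'\<close> of the exchanged
  pair.\<close>

theorem dedekind_reciprocity:
  assumes "c > 0" "h > 0" "coprime h c"
  shows "dedekind_sum h c + dedekind_sum c h =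
    (of_int h / of_int c + of_int c / of_int h + 1 / (of_int h * of_int c)) / 12 - 1 / 4"
proof -
  define q m where "q r = real_of_int (h * r div c)" and "m r = real_of_int (h * r mod c)" for r
  define hr cr where "hr = real_of_int h" and "cr = real_of_int c"
  define R where "R = (cr - 1) * cr * (2 * cr - 1) / 6"
  define R' where "R' = (hr - 1) * hr * (2 * hr - 1) / 6"
  define X where "X = (\<Sum>r\<in>{1..<c}. real_of_int r * q r)"
  define X' where "X' = (\<Sum>j\<in>{1..<h}. real_of_int j * real_of_int (c * j div h))"
  define Q where "Q = (\<Sum>r\<in>{1..<c}. (q r)\<^sup>2)"
  have pos: "hr > 0" "cr > 0" using assms by (auto simp: hr_def cr_def)
  have m: "m r = hr * real_of_int r - cr * q r" for r
    unfolding m_def q_def hr_def cr_def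
    by (metis minus_div_mult_eq_mod mult.commute of_int_diff of_int_mult)
  have m': "real_of_int (c * j mod h) = cr * real_of_int j - hr * real_of_int (c * j div h)" for j
    unfolding hr_def cr_def
    by (metis minus_div_mult_eq_mod mult.commute of_int_diff of_int_mult)
  have sr: "(\<Sum>r\<in>{1..<c}. real_of_int r) = cr * (cr - 1) / 2"
    and sr2: "(\<Sum>r\<in>{1..<c}. (real_of_int r)\<^sup>2) = R"
    and sr2': "(\<Sum>r\<in>{1..<h}. (real_of_int r)\<^sup>2) = R'"
    using sum_atLeast1_int[of c] sum_squares_atLeast1_int[of c] sum_squares_atLeast1_int[of h] assms
    by (simp_all add: R_def R'_def cr_def hr_def)
  note bij = bij_betw_mult_mod[OF assms(1,3)]
  have sm: "(\<Sum>r\<in>{1..<c}. m r) = cr * (cr - 1) / 2"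
    unfolding m_def using sum.reindex_bij_betw[OF bij, of real_of_int] sr by simp
  have sm2: "(\<Sum>r\<in>{1..<c}. (m r)\<^sup>2) = R"
    unfolding m_def using sum.reindex_bij_betw[OF bij, of "\<lambda>x. (real_of_int x)\<^sup>2"] sr2 by simp
  have m_sum: "(\<Sum>r\<in>{1..<c}. m r) = hr * (\<Sum>r\<in>{1..<c}. real_of_int r) - cr * (\<Sum>r\<in>{1..<c}. q r)"
    by (simp add: m sum_subtractf sum_distrib_left)
  then have sq: "(\<Sum>r\<in>{1..<c}. q r) = (hr - 1) * (cr - 1) / 2"
  proof -
    have "cr * (\<Sum>r\<in>{1..<c}. q r) = cr * ((hr - 1) * (cr - 1) / 2)"
      using m_sum unfolding sm sr by (simp add: field_simps)
    then show ?thesis using pos by simp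
  qed
  have "(\<Sum>r\<in>{1..<c}. (m r)\<^sup>2) =
      (\<Sum>r\<in>{1..<c}. hr\<^sup>2 * (real_of_int r)\<^sup>2 - 2 * hr * cr * (real_of_int r * q r) + cr\<^sup>2 * (q r)\<^sup>2)"
    by (intro sum.cong refl) (simp add: m power2_eq_square algebra_simps)
  also have "\<dots> = hr\<^sup>2 * R - 2 * hr * cr * X + cr\<^sup>2 * Q"
    by (simp add: sum.distrib sum_subtractf sum_distrib_left X_def Q_def flip: sr2)
  finally have eq1: "R = hr\<^sup>2 * R - 2 * hr * cr * X + cr\<^sup>2 * Q" by (simp add: sm2)
  have "real_of_int (\<Sum>r\<in>{1..<c}. (h * r div c) * (h * r div c + 1)) =
      real_of_int ((c - 1) * h * (h - 1) - 2 * (\<Sum>j\<in>{1..<h}. j * (c * j div h)))"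
    by (simp only: sum_div_mult_Suc[OF assms])
  then have "(\<Sum>r\<in>{1..<c}. q r * (q r + 1)) = (cr - 1) * hr * (hr - 1) - 2 * X'"
    by (simp add: q_def hr_def cr_def X'_def)
  moreover have "(\<Sum>r\<in>{1..<c}. q r * (q r + 1)) = Q + (\<Sum>r\<in>{1..<c}. q r)"
    by (simp add: Q_def sum.distrib algebra_simps power2_eq_square)
  ultimately have Q: "Q = (cr - 1) * hr * (hr - 1) - 2 * X' - (hr - 1) * (cr - 1) / 2"
    by (simp add: sq)
  have s1: "dedekind_sum h c = (hr * R - cr * X) / cr\<^sup>2 - (cr - 1) / 4"
  proof -
    have "(\<Sum>r\<in>{1..<c}. of_int r * of_int (h * r mod c)) =
        (\<Sum>r\<in>{1..<c}. hr * (real_of_int r)\<^sup>2 - cr * (real_of_int r * q r))"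
      by (intro sum.cong refl, fold m_def, unfold m) (simp add: power2_eq_square algebra_simps)
    also have "\<dots> = hr * R - cr * X"
      by (simp add: sum_subtractf sum_distrib_left X_def flip: sr2)
    finally show ?thesis using dedekind_sum_coprime[OF assms(1,3)] by (simp add: cr_def)
  qed
  have s2: "dedekind_sum c h = (cr * R' - hr * X') / hr\<^sup>2 - (hr - 1) / 4"
  proof -
    have "(\<Sum>r\<in>{1..<h}. of_int r * of_int (c * r mod h)) =
        (\<Sum>r\<in>{1..<h}. cr * (real_of_int r)\<^sup>2 - hr * (real_of_int r * real_of_int (c * r div h)))"
      by (intro sum.cong refl, unfold m') (simp add: power2_eq_square algebra_simps)
    also have "\<dots> = cr * R' - hr * X'"
      by (simp add: sum_subtractf sum_distrib_left X'_def flip: sr2')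
    finally show ?thesis
      using dedekind_sum_coprime[OF assms(2), of c] assms(3) by (simp add: hr_def coprime_commute)
  qed
  \<comment> \<open>With \<open>Q\<close> in terms of \<open>X'\<close>, this value of
    \<open>X\<close> makes the unknown \<open>X'\<close> cancel between \<open>s1\<close> and
    \<open>s2\<close>; what remains is a rational identity in h and c.\<close>
  have X: "X = ((hr\<^sup>2 - 1) * R + cr\<^sup>2 * Q) / (2 * hr * cr)"
    using eq1 pos by (simp add: field_simps)
  have "dedekind_sum h c + dedekind_sum c h = (hr / cr + cr / hr + 1 / (hr * cr)) / 12 - 1 / 4"
    unfolding s1 s2 X Q R_def R'_def using pos
    by (simp add: divide_simps power2_eq_square) (simp add: algebra_simps)
  then show ?thesis by (simp add: hr_def cr_def)
qed


section \<open>The logarithm of eta as a series\<close>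

lemma open_uhp: "open uhp"
  unfolding uhp_def by (rule open_halfspace_Im_gt)

lemma convex_uhp: "convex uhp"
  unfolding uhp_def by (rule convex_halfspace_Im_gt)

lemma connected_uhp: "connected uhp"
  using convex_uhp by (rule convex_connected)

lemma ii_in_uhp [simp]: "\<i> \<in> uhp"
  by (simp add: uhp_def)

lemma neg_inverse_in_uhp: "\<tau> \<in> uhp \<Longrightarrow> - 1 / \<tau> \<in> uhp"
  by (simp add: uhp_def Im_divide add_nonneg_pos)

lemma e_add: "e (x + y) = e x * e y"
  by (simp add: e_def ring_distribs exp_add)

lemma e_of_int: "e (of_int n) = 1"
  by (simp add: e_def exp_eq_1 mult.commute)

lemma e_of_real_eq_1_iff: "e (of_real x) = 1 \<longleftrightarrow> x \<in> \<int>"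
  by (auto simp: e_def exp_eq_1 Ints_def)

lemma norm_e: "norm (e x) = exp (- 2 * pi * Im x)"
  by (simp add: e_def)

lemma e_of_nat_mult: "e (of_nat n * x) = e x ^ n"
  by (simp add: e_def exp_of_nat_mult[symmetric] mult_ac)

lemma norm_e_less_1: "\<tau> \<in> uhp \<Longrightarrow> norm (e \<tau>) < 1"
  by (simp add: norm_e uhp_def)

lemma has_field_derivative_e [derivative_intros]:
  "(f has_field_derivative f') (at x within A) \<Longrightarrow>
    ((\<lambda>x. e (f x)) has_field_derivative (2 * of_real pi * \<i> * f' * e (f x))) (at x within A)"
  unfolding e_def by (auto intro!: derivative_eq_intros)

lemma norm_Ln_one_minus_le:
  assumes "norm z < 1 / 2"
  shows "norm (Ln (1 - z)) \<le> 2 * norm z"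
  using norm_Ln_le[of "- z"] assms by simp

definition Leta :: "complex \<Rightarrow> complex" where
  "Leta \<tau> = of_real pi * \<i> * \<tau> / 12 + (\<Sum>n. Ln (1 - e \<tau> ^ Suc n))"

text \<open>This is pi i / 12 times the Eisenstein series E_2, in Lambert form.\<close>

definition dLeta :: "complex \<Rightarrow> complex" where
  "dLeta \<tau> = of_real pi * \<i> / 12 + (\<Sum>n. - 2 * of_real pi * \<i> * of_nat (Suc n) * e \<tau> ^ Suc n / (1 - e \<tau> ^ Suc n))"

lemma power_Suc_norm_less_1: "norm (z :: complex) < 1 \<Longrightarrow> norm (z ^ Suc n) < 1"
  unfolding norm_power using power_strict_mono[of "norm z" 1 "Suc n"] by simp

lemma one_minus_notin_nonpos: "norm (z :: complex) < 1 \<Longrightarrow> 1 - z \<notin> \<real>\<^sub>\<le>\<^sub>0"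
  using complex_Re_le_cmod[of z] by (auto simp: complex_nonpos_Reals_iff)

text \<open>Termwise differentiation on the half plane Im z > Im tau / 2. It is an open
  neighbourhood of tau on which |e z| is bounded by some r < 1, so the logarithms are dominated by a
  geometric series.\<close>

lemma Leta_convergence:
  assumes "\<tau> \<in> uhp"
  shows "summable (\<lambda>n. Ln (1 - e \<tau> ^ Suc n))"
    and "summable (\<lambda>n. - 2 * of_real pi * \<i> * of_nat (Suc n) * e \<tau> ^ Suc n / (1 - e \<tau> ^ Suc n))"
    and "(Leta has_field_derivative dLeta \<tau>) (at \<tau>)"
proof -
  define y where "y = Im \<tau> / 2"
  define S where "S = {z. Im z > y}"
  define r where "r = exp (- 2 * pi * y)"
  have y: "y > 0" "\<tau> \<in> S" using assms by (auto simp: y_def S_def uhp_def)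
  have r: "0 < r" "r < 1" using y by (auto simp: r_def)
  have qr: "norm (e z) \<le> r" if "z \<in> S" for z
    using that by (simp add: norm_e r_def S_def)
  have q1: "norm (e z) < 1" if "z \<in> S" for z using qr[OF that] r by simp
  have der: "((\<lambda>z. Ln (1 - e z ^ Suc n)) has_field_derivative
      (- 2 * of_real pi * \<i> * of_nat (Suc n) * e z ^ Suc n / (1 - e z ^ Suc n))) (at z)"
    if z: "z \<in> S" for n z
    using one_minus_notin_nonpos[OF power_Suc_norm_less_1[OF q1[OF z], of n]]
    by (auto intro!: derivative_eq_intros simp del: power_Suc) (simp add: divide_simps mult_ac)
  have "(\<lambda>n. r ^ Suc n) \<longlonglongrightarrow> 0" using r by (intro LIMSEQ_Suc LIMSEQ_power_zero) auto
  then have "eventually (\<lambda>n. r ^ Suc n < 1 / 2) sequentially"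
    by (rule order_tendstoD) simp
  then have ev: "eventually (\<lambda>n. \<forall>z\<in>S. norm (Ln (1 - e z ^ Suc n)) \<le> 2 * r ^ Suc n) sequentially"
  proof eventually_elim
    case (elim n)
    show ?case
    proof
      fix z assume "z \<in> S"
      then have "norm (e z ^ Suc n) \<le> r ^ Suc n"
        unfolding norm_power by (intro power_mono qr) auto
      with elim show "norm (Ln (1 - e z ^ Suc n)) \<le> 2 * r ^ Suc n"
        by (intro order_trans[OF norm_Ln_one_minus_le]) auto
    qed
  qed
  have sum_r: "summable (\<lambda>n. 2 * r ^ Suc n)"
    using r by (intro summable_mult summable_Suc_iff[THEN iffD2] summable_geometric) auto
  obtain g g' where g: "\<forall>z\<in>S. (\<lambda>n. Ln (1 - e z ^ Suc n)) sums g z \<and>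
      (\<lambda>n. - 2 * of_real pi * \<i> * of_nat (Suc n) * e z ^ Suc n / (1 - e z ^ Suc n)) sums g' z \<and>
      (g has_field_derivative g' z) (at z)"
    by (rule series_and_derivative_comparison[OF _ sum_r der ev])
      (auto simp: S_def open_halfspace_Im_gt)
  show "summable (\<lambda>n. Ln (1 - e \<tau> ^ Suc n))"
    "summable (\<lambda>n. - 2 * of_real pi * \<i> * of_nat (Suc n) * e \<tau> ^ Suc n / (1 - e \<tau> ^ Suc n))"
    using g y by (auto dest: sums_summable)
  have L: "Leta z = of_real pi * \<i> * z / 12 + g z" if "z \<in> S" for z
    using g that by (auto simp: Leta_def sums_iff)
  have "((\<lambda>z. of_real pi * \<i> * z / 12 + g z) has_field_derivative of_real pi * \<i> / 12 + g' \<tau>) (at \<tau>)"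
    using g y by (auto intro!: derivative_eq_intros)
  moreover have "eventually (\<lambda>z. z \<in> S) (nhds \<tau>)"
    using y by (intro eventually_nhds_in_open) (auto simp: S_def open_halfspace_Im_gt)
  ultimately have "(Leta has_field_derivative of_real pi * \<i> / 12 + g' \<tau>) (at \<tau>)"
    by (subst DERIV_cong_ev[OF refl _ refl]) (auto elim!: eventually_mono simp: L)
  moreover have "dLeta \<tau> = of_real pi * \<i> / 12 + g' \<tau>"
    using g y by (auto simp: dLeta_def sums_iff)
  ultimately show "(Leta has_field_derivative dLeta \<tau>) (at \<tau>)" by (simp only:)
qed

lemma exp_Leta:
  assumes "\<tau> \<in> uhp"
  shows "exp (Leta \<tau>) = eta \<tau>"
proof -
  have q: "norm (e \<tau> ^ Suc n) < 1" for n
    using power_Suc_norm_less_1[OF norm_e_less_1[OF assms]] .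
  have "exp (\<Sum>n. Ln (1 - e \<tau> ^ Suc n)) = (\<Prod>n. exp (Ln (1 - e \<tau> ^ Suc n)))"
    using prodinf_exp[OF Leta_convergence(1)[OF assms]] by simp
  also have "\<dots> = (\<Prod>n. 1 - e (of_nat (Suc n) * \<tau>))"
  proof (intro arg_cong[where f = prodinf] ext)
    fix n
    have "1 - e \<tau> ^ Suc n \<noteq> 0" using q[of n] by auto
    then show "exp (Ln (1 - e \<tau> ^ Suc n)) = 1 - e (of_nat (Suc n) * \<tau>)"
      unfolding e_of_nat_mult by (rule exp_Ln)
  qed
  finally show ?thesis
    by (simp add: Leta_def eta_def exp_add e_def mult_ac)
qed

lemma eta_nonzero: "\<tau> \<in> uhp \<Longrightarrow> eta \<tau> \<noteq> 0"
  by (metis exp_Leta exp_not_eq_zero)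

lemma deriv_eta:
  assumes "\<tau> \<in> uhp"
  shows "deriv eta \<tau> = dLeta \<tau> * eta \<tau>"
proof (rule DERIV_imp_deriv)
  have "((\<lambda>z. exp (Leta z)) has_field_derivative dLeta \<tau> * exp (Leta \<tau>)) (at \<tau>)"
    by (rule derivative_eq_intros Leta_convergence(3)[OF assms] refl)+ simp
  moreover have "eventually (\<lambda>z. z \<in> uhp) (nhds \<tau>)"
    using assms open_uhp by (intro eventually_nhds_in_open) auto
  ultimately show "(eta has_field_derivative dLeta \<tau> * eta \<tau>) (at \<tau>)"
    unfolding exp_Leta[OF assms]
    by (subst DERIV_cong_ev[OF refl _ refl, of _ "\<lambda>z. exp (Leta z)"])
      (auto elim!: eventually_mono simp: exp_Leta)
qed

text \<open>Matches the normalisation of \<open>log_eta\<close> at i: there e(tau) is a real number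
  in (0, 1), so every principal logarithm in the series is real and no multiple of 2 pi i can
  appear.\<close>

lemma Leta_ii: "Leta \<i> = of_real (ln (Re (eta \<i>)))"
proof -
  have ei: "e \<i> = of_real (exp (- 2 * pi))"
    by (simp add: e_def exp_of_real[symmetric] mult_ac)
  have pos: "1 - exp (- 2 * pi) ^ Suc n > (0 :: real)" for n
    using power_Suc_less_one[of "exp (- 2 * pi)" n] by simp
  have Ln_eq: "Ln (1 - e \<i> ^ Suc n) = of_real (ln (1 - exp (- 2 * pi) ^ Suc n))" for n
  proof -
    have "1 - e \<i> ^ Suc n = of_real (1 - exp (- 2 * pi) ^ Suc n)"
      by (simp add: ei del: power_Suc)
    then show ?thesis by (simp only: Ln_of_real[OF pos])
  qed
  have "of_real pi * \<i> * \<i> / 12 = complex_of_real (- pi / 12)"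
    by (simp add: mult.assoc)
  then have Leta': "Leta \<i> = of_real (- pi / 12) + (\<Sum>n. complex_of_real (ln (1 - exp (- 2 * pi) ^ Suc n)))"
    by (simp only: Leta_def Ln_eq)
  have summable: "summable (\<lambda>n. complex_of_real (ln (1 - exp (- 2 * pi) ^ Suc n)))"
    using Leta_convergence(1)[of \<i>] by (simp only: Ln_eq ii_in_uhp)
  have "(\<Sum>n. complex_of_real (ln (1 - exp (- 2 * pi) ^ Suc n))) =
      of_real (\<Sum>n. ln (1 - exp (- 2 * pi) ^ Suc n))"
    using summable by (simp only: suminf_of_real summable_of_real_iff)
  then obtain x where x: "Leta \<i> = of_real x"
    by (metis of_real_add Leta')
  have "eta \<i> = of_real (exp x)"
    using exp_Leta[of \<i>] x by (simp add: exp_of_real)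
  then show ?thesis using x by simp
qed

theorem log_eta_eq_Leta:
  assumes "\<tau> \<in> uhp"
  shows "log_eta \<tau> = Leta \<tau>"
proof -
  have seg: "closed_segment \<i> \<tau> \<subseteq> uhp"
    using assms convex_uhp by (simp add: closed_segment_subset)
  have "(dLeta has_contour_integral Leta (pathfinish (linepath \<i> \<tau>)) - Leta (pathstart (linepath \<i> \<tau>)))
      (linepath \<i> \<tau>)"
    using seg by (intro contour_integral_primitive[where S = uhp])
      (auto intro: has_field_derivative_at_within Leta_convergence(3))
  then have "contour_integral (linepath \<i> \<tau>) dLeta = Leta \<tau> - Leta \<i>"
    by (simp add: contour_integral_unique)
  moreover have "contour_integral (linepath \<i> \<tau>) (\<lambda>z. deriv eta z / eta z) =
      contour_integral (linepath \<i> \<tau>) dLeta"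
    using seg by (intro contour_integral_eq) (auto simp: deriv_eta eta_nonzero subset_iff)
  ultimately show ?thesis
    by (simp add: log_eta_def Leta_ii)
qed


section \<open>The inversion law\<close>

text \<open>If |d| is at most 2R|c|, the imaginary part already dominates both |c| and |d|.
  Otherwise c Re tau is at most half of |d| in size, and the real part is at least |d|/2. These two
  cases are the origin of the two constants in the minimum.\<close>

lemma norm_linear_ge:
  fixes c d :: real
  assumes "y0 > 0" "R \<ge> 1" "Im \<tau> \<ge> y0" "\<bar>Re \<tau>\<bar> \<le> R"
  shows "norm (of_real c * \<tau> + of_real d) \<ge> min (1 / 2) (y0 / (2 * R)) * max \<bar>c\<bar> \<bar>d\<bar>"
proof -
  define \<delta> where "\<delta> = min (1 / 2) (y0 / (2 * R))"
  have \<delta>: "0 < \<delta>" "\<delta> \<le> 1 / 2" "\<delta> * (2 * R) \<le> y0"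
    using assms by (auto simp: \<delta>_def min_def field_simps)
  have im: "norm (of_real c * \<tau> + of_real d) \<ge> \<bar>c\<bar> * y0"
  proof -
    have "\<bar>c\<bar> * y0 \<le> \<bar>c\<bar> * \<bar>Im \<tau>\<bar>" using assms by (intro mult_left_mono) auto
    also have "\<dots> = \<bar>Im (of_real c * \<tau> + of_real d)\<bar>" by (simp add: abs_mult)
    finally show ?thesis using abs_Im_le_cmod order_trans by blast
  qed
  have c: "\<delta> * \<bar>c\<bar> \<le> \<bar>c\<bar> * y0"
  proof -
    have "\<delta> * 1 \<le> \<delta> * (2 * R)" using assms \<delta> by (intro mult_left_mono) auto
    then have "\<delta> \<le> y0" using \<delta>(3) by linarith
    then show ?thesis using mult_left_mono[of \<delta> y0 "\<bar>c\<bar>"] by (simp add: mult.commute)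
  qed
  have d: "\<delta> * \<bar>d\<bar> \<le> norm (of_real c * \<tau> + of_real d)"
  proof (cases "\<bar>d\<bar> \<le> 2 * R * \<bar>c\<bar>")
    case True
    then have "\<delta> * \<bar>d\<bar> \<le> \<delta> * (2 * R * \<bar>c\<bar>)" using \<delta> by (intro mult_left_mono) auto
    also have "\<dots> \<le> y0 * \<bar>c\<bar>" using mult_right_mono[OF \<delta>(3), of "\<bar>c\<bar>"] by (simp add: mult_ac)
    finally show ?thesis using im by (simp add: mult.commute)
  next
    case False
    have "\<bar>c * Re \<tau>\<bar> \<le> \<bar>c\<bar> * R" using assms by (simp add: abs_mult mult_left_mono)
    moreover have "2 * (\<bar>c\<bar> * R) < \<bar>d\<bar>" using False by (simp add: mult_ac)
    ultimately have "\<bar>d\<bar> / 2 \<le> \<bar>c * Re \<tau> + d\<bar>" by linarith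
    also have "\<dots> \<le> norm (of_real c * \<tau> + of_real d)"
      using abs_Re_le_cmod[of "of_real c * \<tau> + of_real d"] by simp
    finally show ?thesis
      using mult_right_mono[OF \<delta>(2), of "\<bar>d\<bar>"] by simp
  qed
  show ?thesis using im c d by (auto simp: \<delta>_def[symmetric] max_def)
qed

lemma uhp_norm_linear_ge:
  assumes "\<tau> \<in> uhp"
  obtains \<delta> where "\<delta> > 0"
    "\<And>c d :: real. norm (of_real c * \<tau> + of_real d) \<ge> \<delta> * max \<bar>c\<bar> \<bar>d\<bar>"
proof
  define R where "R = max 1 \<bar>Re \<tau>\<bar>"
  have R: "R \<ge> 1" "\<bar>Re \<tau>\<bar> \<le> R" by (auto simp: R_def)
  show "min (1 / 2) (Im \<tau> / (2 * R)) > 0" using assms R by (auto simp: uhp_def)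
  show "norm (of_real c * \<tau> + of_real d) \<ge> min (1 / 2) (Im \<tau> / (2 * R)) * max \<bar>c\<bar> \<bar>d\<bar>"
    for c d :: real
    using assms R by (intro norm_linear_ge) (auto simp: uhp_def)
qed

section \<open>Partial fractions of the cotangent and of the inverse squared sine\<close>

lemma Im_nonzero_notin_nonpos_Ints: "Im z \<noteq> 0 \<Longrightarrow> z \<notin> \<int>\<^sub>\<le>\<^sub>0"
  by (auto elim!: nonpos_Ints_cases)

text \<open>The logarithmic derivative of Euler's reflection formula, taken for the entire function
  1/Gamma so that poles do not arise.\<close>

lemma Digamma_reflection_complex:
  fixes z :: complex
  assumes "Im z \<noteq> 0"
  shows "Digamma (1 - z) - Digamma z = of_real pi * cot (of_real pi * z)"
proof -
  have nz: "z \<notin> \<int>\<^sub>\<le>\<^sub>0" "1 - z \<notin> \<int>\<^sub>\<le>\<^sub>0"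
    using assms by (auto intro!: Im_nonzero_notin_nonpos_Ints)
  have "((\<lambda>z. rGamma z * rGamma (1 - z)) has_field_derivative
      (rGamma z * rGamma (1 - z) * (Digamma (1 - z) - Digamma z))) (at z)"
    using nz by (auto intro!: derivative_eq_intros simp: algebra_simps)
  moreover have "((\<lambda>z. rGamma z * rGamma (1 - z)) has_field_derivative cos (of_real pi * z)) (at z)"
    unfolding rGamma_reflection_complex
    by (auto intro!: derivative_eq_intros)
  ultimately have "rGamma z * rGamma (1 - z) * (Digamma (1 - z) - Digamma z) = cos (of_real pi * z)"
    by (rule DERIV_unique)
  then show ?thesis
  proof -
    assume *: "rGamma z * rGamma (1 - z) * (Digamma (1 - z) - Digamma z) = cos (of_real pi * z)"
    have "rGamma z * rGamma (1 - z) \<noteq> 0" using nz by (simp add: rGamma_eq_zero_iff)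
    then have "sin (of_real pi * z) \<noteq> 0" by (auto simp: rGamma_reflection_complex)
    with * show ?thesis
      unfolding rGamma_reflection_complex by (simp add: cot_def field_simps)
  qed
qed

lemma sin_pi_nonzero: "Im z \<noteq> 0 \<Longrightarrow> sin (of_real pi * z) \<noteq> 0"
  using rGamma_reflection_complex[of z] Im_nonzero_notin_nonpos_Ints[of z]
    Im_nonzero_notin_nonpos_Ints[of "1 - z"]
  by (auto simp: rGamma_eq_zero_iff)

lemma Polygamma_1_reflection_complex:
  fixes z :: complex
  assumes "Im z \<noteq> 0"
  shows "Polygamma 1 z + Polygamma 1 (1 - z) = (of_real pi / sin (of_real pi * z))\<^sup>2"
proof -
  have nz: "z \<notin> \<int>\<^sub>\<le>\<^sub>0" "1 - z \<notin> \<int>\<^sub>\<le>\<^sub>0"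
    using assms by (auto intro!: Im_nonzero_notin_nonpos_Ints)
  have "((\<lambda>z. Digamma (1 - z) - Digamma z) has_field_derivative
      (- Polygamma 1 (1 - z) - Polygamma 1 z)) (at z)"
    using nz by (auto intro!: derivative_eq_intros)
  moreover have "((\<lambda>z. Digamma (1 - z) - Digamma z) has_field_derivative
      (- (of_real pi / sin (of_real pi * z))\<^sup>2)) (at z)"
  proof (subst DERIV_cong_ev[OF refl _ refl])
    show "((\<lambda>z. of_real pi * cot (of_real pi * z)) has_field_derivative
      (- (of_real pi / sin (of_real pi * z))\<^sup>2)) (at z)"
      using sin_pi_nonzero[OF assms]
      by (auto intro!: derivative_eq_intros DERIV_chain2[OF DERIV_cot]
          simp: power2_eq_square field_simps)
    have "eventually (\<lambda>z. z \<in> {z. Im z > 0} \<union> {z. Im z < 0}) (nhds z)"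
      using assms
      by (intro eventually_nhds_in_open open_Un open_halfspace_Im_gt open_halfspace_Im_lt) auto
    then show "eventually (\<lambda>z. Digamma (1 - z) - Digamma z = of_real pi * cot (of_real pi * z)) (nhds z)"
      by eventually_elim (auto intro: Digamma_reflection_complex)
  qed
  ultimately have "- Polygamma 1 (1 - z) - Polygamma 1 z = - (of_real pi / sin (of_real pi * z))\<^sup>2"
    by (rule DERIV_unique)
  then show ?thesis by (simp add: algebra_simps)
qed

text \<open>The series of \<open>Polygamma 1\<close> at z and at 1 - z are the two halves of the sum
  of (z + n)^(-2) over all integers n; the term n = 0 is split off and n is paired with -n.\<close>

lemma inverse_sin_squared_sums:
  fixes z :: complex
  assumes "Im z \<noteq> 0"
  shows "(\<lambda>n. 1 / (z + of_nat (Suc n))\<^sup>2 + 1 / (z - of_nat (Suc n))\<^sup>2) sums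
    ((of_real pi / sin (of_real pi * z))\<^sup>2 - 1 / z\<^sup>2)"
proof -
  have nz: "z \<noteq> 0" "1 - z \<noteq> 0" using assms by auto
  have P: "Polygamma 1 w = (\<Sum>k. inverse ((w + of_nat k)\<^sup>2))" for w :: complex
    by (simp add: Polygamma_def numeral_2_eq_2)
  have "(\<lambda>k. inverse ((z + of_nat k)\<^sup>2)) sums Polygamma 1 z"
    unfolding P by (intro summable_sums Polygamma_converges') (use nz in auto)
  then have 1: "(\<lambda>k. inverse ((z + of_nat (Suc k))\<^sup>2)) sums (Polygamma 1 z - 1 / z\<^sup>2)"
    by (subst sums_Suc_iff) (simp add: inverse_eq_divide)
  have "(\<lambda>k. inverse ((1 - z + of_nat k)\<^sup>2)) sums Polygamma 1 (1 - z)"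
    unfolding P by (intro summable_sums Polygamma_converges') (use nz in auto)
  moreover have "(1 - z + of_nat k)\<^sup>2 = (z - of_nat (Suc k))\<^sup>2" for k
    by (simp add: power2_eq_square algebra_simps)
  ultimately have "(\<lambda>k. inverse ((z - of_nat (Suc k))\<^sup>2)) sums Polygamma 1 (1 - z)" by simp
  from sums_add[OF 1 this] Polygamma_1_reflection_complex[OF assms] show ?thesis
    by (simp add: inverse_eq_divide algebra_simps)
qed

text \<open>The convergence-producing terms of the two Digamma series cancel in the difference.
  Using 1 + z instead of z removes the term n = 0 through the recurrence of Digamma.\<close>

lemma cot_sums:
  fixes z :: complex
  assumes "Im z \<noteq> 0"
  shows "(\<lambda>n. 1 / (z + of_nat (Suc n)) + 1 / (z - of_nat (Suc n))) sums
    (of_real pi * cot (of_real pi * z) - 1 / z)"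
proof -
  have nz: "z \<noteq> 0" "1 - z \<noteq> 0" "1 + z \<noteq> 0" using assms by (auto simp: complex_eq_iff)
  have "Digamma (1 - z) - Digamma (1 + z) = of_real pi * cot (of_real pi * z) - 1 / z"
    using Digamma_reflection_complex[OF assms] Digamma_plus1[OF nz(1)]
    by (simp add: algebra_simps)
  moreover have D: "(\<lambda>k. inverse (of_nat (Suc k)) - inverse (w + of_nat k)) sums (Digamma w + euler_mascheroni)"
    if "w \<noteq> 0" for w :: complex
    using summable_sums[OF summable_Digamma[OF that]] by (simp add: Digamma_def)
  from sums_diff[OF D[OF nz(2)] D[OF nz(3)]]
  have "(\<lambda>k. inverse (1 + z + of_nat k) - inverse (1 - z + of_nat k)) sums
      (Digamma (1 - z) - Digamma (1 + z))" by simp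
  moreover have "inverse (1 + z + of_nat k) - inverse (1 - z + of_nat k) =
      1 / (z + of_nat (Suc k)) + 1 / (z - of_nat (Suc k))" for k
  proof -
    have "1 - z + of_nat k = - (z - of_nat (Suc k))" by simp
    then show ?thesis by (simp only: inverse_minus_eq) (simp add: inverse_eq_divide add_ac)
  qed
  ultimately show ?thesis by simp
qed

section \<open>From Lambert series to the weight-two Eisenstein series\<close>

lemma e_div_one_minus_e_squared:
  assumes "Im z \<noteq> 0"
  shows "e z / (1 - e z)\<^sup>2 = - 1 / (4 * (sin (of_real pi * z))\<^sup>2)"
proof -
  define x where "x = exp (\<i> * (of_real pi * z))"
  have x: "x \<noteq> 0" "e z = x\<^sup>2" "exp (- (\<i> * (of_real pi * z))) = 1 / x"
    by (auto simp: x_def e_def exp_double[symmetric] exp_minus inverse_eq_divide mult_ac)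
  have "sin (of_real pi * z) = (x - 1 / x) / (2 * \<i>)"
    unfolding sin_exp_eq x_def[symmetric] x ..
  then have "4 * (sin (of_real pi * z))\<^sup>2 = - (x - 1 / x)\<^sup>2"
    by (simp add: power_divide power_mult_distrib)
  also have "(x - 1 / x)\<^sup>2 = (1 - e z)\<^sup>2 / e z"
    using x by (simp add: power2_eq_square field_simps)
  finally show ?thesis by simp
qed

text \<open>Unordered summability of the double family forces the two iterated ordered series to
  have the same sum. It is applied to the Lambert series and to the regularised difference
  \<open>Uterm\<close> - \<open>Vterm\<close>.\<close>

lemma double_sums_swap:
  fixes f :: "nat \<Rightarrow> nat \<Rightarrow> complex"
  assumes "(\<lambda>(m, n). f m n) summable_on UNIV"
    and "\<And>m. f m sums g m" and "\<And>n. (\<lambda>m. f m n) sums h n"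
  obtains s where "g sums s" "h sums s"
proof -
  from assms(1) obtain s where s: "((\<lambda>(m, n). f m n) has_sum s) (UNIV \<times> UNIV)"
    by (auto simp: summable_on_def)
  then have s': "((\<lambda>(n, m). f m n) has_sum s) (UNIV \<times> UNIV)"
    by (subst has_sum_swap) (simp add: case_prod_unfold)
  have 1: "(f m has_sum g m) UNIV" for m
  proof -
    have "f m summable_on UNIV"
      using summable_on_SigmaD1[of f UNIV "\<lambda>_. UNIV" m] s has_sum_imp_summable by auto
    then show ?thesis
      using assms(2) has_sum_imp_sums sums_unique2 by (metis has_sum_infsum)
  qed
  have 2: "((\<lambda>m. f m n) has_sum h n) UNIV" for n
  proof -
    have "(\<lambda>m. f m n) summable_on UNIV"
      using summable_on_SigmaD1[of "\<lambda>n m. f m n" UNIV "\<lambda>_. UNIV" n] s' has_sum_imp_summable by auto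
    then show ?thesis
      using assms(3) has_sum_imp_sums sums_unique2 by (metis has_sum_infsum)
  qed
  have "(g has_sum s) UNIV" by (rule has_sum_SigmaD[OF s]) (use 1 in auto)
  moreover have "(h has_sum s) UNIV" by (rule has_sum_SigmaD[OF s']) (use 2 in auto)
  ultimately show ?thesis using that has_sum_imp_sums by blast
qed

lemma geometric_Suc_sums: "norm (q :: complex) < 1 \<Longrightarrow> (\<lambda>n. q ^ Suc n) sums (q / (1 - q))"
  using sums_mult[OF geometric_sums[of q], of q] by simp

lemma sums_Suc_mult_power:
  fixes q :: complex
  assumes "norm q < 1"
  shows "(\<lambda>n. of_nat (Suc n) * q ^ Suc n) sums (q / (1 - q)\<^sup>2)"
  using sums_mult[OF geometric_deriv_sums[OF assms], of q] by (simp add: mult_ac)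

lemma summable_on_Times_nonneg:
  fixes f :: "'a \<Rightarrow> real" and g :: "'b \<Rightarrow> real"
  assumes "f summable_on A" "g summable_on B" "\<And>x. f x \<ge> 0" "\<And>y. g y \<ge> 0"
  shows "(\<lambda>(x, y). f x * g y) summable_on (A \<times> B)"
proof (rule summable_on_SigmaI)
  show "((\<lambda>y. case (x, y) of (x, y) \<Rightarrow> f x * g y) has_sum f x * infsum g B) B" for x
    using assms(2) by (auto intro: has_sum_cmult_right)
  show "(\<lambda>x. f x * infsum g B) summable_on A"
    using assms(1) by (rule summable_on_cmult_left)
qed (use assms in auto)

text \<open>Absolute convergence permits reading the sum of m q^(mn) either as the Lambert series in
  m or as the sum of q^n / (1 - q^n)^2.\<close>

lemma double_sum_Lambert:
  fixes q :: complex
  assumes "norm q < 1"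
  shows "(\<lambda>(m, n). of_nat (Suc m) * q ^ (Suc m * Suc n)) summable_on UNIV"
proof -
  define r where "r = norm q"
  have r: "0 \<le> r" "r < 1" using assms by (auto simp: r_def)
  have rm: "r ^ Suc m \<le> r" "r ^ Suc m < 1" for m
    using power_decreasing[of 1 "Suc m" r] r by auto
  have inner: "((\<lambda>n. real (Suc m) * r ^ (Suc m * Suc n)) has_sum
      (real (Suc m) * (r ^ Suc m / (1 - r ^ Suc m)))) UNIV" for m
  proof (rule sums_nonneg_imp_has_sum)
    have "(\<lambda>n. (r ^ Suc m) ^ Suc n) sums (r ^ Suc m / (1 - r ^ Suc m))"
      using sums_mult[OF geometric_sums[of "r ^ Suc m"], of "r ^ Suc m"] rm[of m] r by simp
    from sums_mult[OF this, of "real (Suc m)"]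
    show "(\<lambda>n. real (Suc m) * r ^ (Suc m * Suc n)) sums
        (real (Suc m) * (r ^ Suc m / (1 - r ^ Suc m)))"
      by (simp only: power_mult)
  qed (use r in auto)
  have "summable (\<lambda>m. real (Suc m) * r ^ m)"
    using geometric_deriv_sums[of r] r by (auto simp: sums_iff)
  then have "summable (\<lambda>m. real (Suc m) * r ^ m * (r / (1 - r)))"
    by (rule summable_mult2)
  then have "summable (\<lambda>m. real (Suc m) * (r ^ Suc m / (1 - r ^ Suc m)))"
  proof (rule summable_comparison_test'[where N = 0])
    fix m :: nat
    have "r ^ Suc m / (1 - r ^ Suc m) \<le> r ^ Suc m / (1 - r)"
      using r rm by (intro divide_left_mono mult_pos_pos) auto
    then have "real (Suc m) * (r ^ Suc m / (1 - r ^ Suc m)) \<le> real (Suc m) * (r ^ Suc m / (1 - r))"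
      by (intro mult_left_mono) auto
    moreover have "real (Suc m) * (r ^ Suc m / (1 - r ^ Suc m)) \<ge> 0"
      using r rm[of m] by (intro mult_nonneg_nonneg divide_nonneg_nonneg) auto
    then have "norm (real (Suc m) * (r ^ Suc m / (1 - r ^ Suc m))) =
        real (Suc m) * (r ^ Suc m / (1 - r ^ Suc m))"
      by (simp only: real_norm_def abs_of_nonneg)
    ultimately show "norm (real (Suc m) * (r ^ Suc m / (1 - r ^ Suc m))) \<le>
        real (Suc m) * r ^ m * (r / (1 - r))"
      by (simp add: mult_ac)
  qed
  moreover have "real (Suc m) * (r ^ Suc m / (1 - r ^ Suc m)) \<ge> 0" for m
    using r rm[of m] by (intro mult_nonneg_nonneg divide_nonneg_nonneg) auto
  ultimately have "(\<lambda>m. real (Suc m) * (r ^ Suc m / (1 - r ^ Suc m))) summable_on UNIV"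
    by (rule summable_nonneg_imp_summable_on)
  then have "(\<lambda>(m, n). real (Suc m) * r ^ (Suc m * Suc n)) summable_on (UNIV \<times> UNIV)"
    by (rule summable_on_SigmaI[rotated]) (use inner r in auto)
  then have "(\<lambda>x. norm (case x of (m, n) \<Rightarrow> of_nat (Suc m) * q ^ (Suc m * Suc n))) summable_on UNIV"
    unfolding UNIV_Times_UNIV by (rule Infinite_Sum.abs_summable_on_comparison_test')
      (auto simp: r_def norm_mult norm_power simp del: of_nat_Suc power_Suc)
  then show ?thesis by (rule abs_summable_summable)
qed

text \<open>The terms n and -n, for a positive first index m, of the weight-two Eisenstein series.
  The terms with n = 0 are kept apart; they sum to pi^2 / (6 tau^2).\<close>

definition Uterm :: "complex \<Rightarrow> nat \<Rightarrow> nat \<Rightarrow> complex" where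
  "Uterm \<tau> m n = 1 / (of_nat (Suc m) * \<tau> + of_nat (Suc n))\<^sup>2 + 1 / (of_nat (Suc m) * \<tau> - of_nat (Suc n))\<^sup>2"

text \<open>The shift by \<open>1 / 4\<close> makes \<open>Vterm\<close> telescope in \<open>n\<close> while \<open>Uterm - Vterm\<close> is absolutely
  summable. Summed over \<open>m\<close> first, the telescoping leaves a boundary term, and this is the
  anomaly \<open>1 / (2 \<tau>)\<close> of the weight-two Eisenstein series.\<close>

definition Vterm :: "complex \<Rightarrow> nat \<Rightarrow> nat \<Rightarrow> complex" where
  "Vterm \<tau> m n = 1 / ((of_nat (Suc m) * \<tau> + of_nat (Suc n))\<^sup>2 - 1 / 4)
    + 1 / ((of_nat (Suc m) * \<tau> - of_nat (Suc n))\<^sup>2 - 1 / 4)"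

lemma inverse_squares_sums_complex: "(\<lambda>n. 1 / (of_nat (Suc n))\<^sup>2) sums (of_real pi ^ 2 / 6 :: complex)"
proof -
  have "(\<lambda>n. complex_of_real (1 / (real n + 1)\<^sup>2)) sums complex_of_real (pi\<^sup>2 / 6)"
    using inverse_squares_sums by (subst sums_of_real_iff) (simp add: add.commute)
  then show ?thesis by (simp add: add.commute)
qed

lemma Im_Suc_mult_nonzero: "\<tau> \<in> uhp \<Longrightarrow> Im (of_nat (Suc m) * \<tau>) \<noteq> 0"
  by (simp add: uhp_def del: of_nat_Suc)

text \<open>The Lambert series of \<open>dLeta\<close> turned into the weight-two Eisenstein series, with the
  summation order \<open>\<Sum>\<^sub>m \<Sum>\<^sub>n\<close> that is forced by conditional convergence.\<close>

lemma dLeta_eq_Eisenstein: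
  assumes "\<tau> \<in> uhp"
  obtains A where "(\<lambda>m. \<Sum>n. Uterm \<tau> m n) sums A"
    "dLeta \<tau> = of_real pi * \<i> / 12 + \<i> / (2 * of_real pi) * (of_real pi ^ 2 / (6 * \<tau>\<^sup>2) + A)"
    "\<And>m. Uterm \<tau> m sums (\<Sum>n. Uterm \<tau> m n)"
proof -
  define q where "q = e \<tau>"
  have q: "norm q < 1" using norm_e_less_1[OF assms] by (simp add: q_def)
  have qS: "norm (q ^ Suc m) < 1" for m by (rule power_Suc_norm_less_1[OF q])
  have \<tau>0: "\<tau> \<noteq> 0" using assms by (auto simp: uhp_def)
  have 1: "(\<lambda>n. of_nat (Suc m) * q ^ (Suc m * Suc n)) sums (of_nat (Suc m) * (q ^ Suc m / (1 - q ^ Suc m)))" for m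
    using sums_mult[OF geometric_Suc_sums[OF qS[of m]], of "of_nat (Suc m)"]
    by (simp only: power_mult)
  have 2: "(\<lambda>m. of_nat (Suc m) * q ^ (Suc m * Suc n)) sums (q ^ Suc n / (1 - q ^ Suc n)\<^sup>2)" for n
    using sums_Suc_mult_power[OF qS[of n]]
    by (simp only: power_mult[symmetric] mult.commute[of "Suc n"])
  obtain s where s: "(\<lambda>m. of_nat (Suc m) * (q ^ Suc m / (1 - q ^ Suc m))) sums s"
    "(\<lambda>n. q ^ Suc n / (1 - q ^ Suc n)\<^sup>2) sums s"
    by (rule double_sums_swap[OF double_sum_Lambert[OF q] 1 2])
  have U: "Uterm \<tau> m sums ((of_real pi / sin (of_real pi * (of_nat (Suc m) * \<tau>)))\<^sup>2 - 1 / (of_nat (Suc m) * \<tau>)\<^sup>2)" for m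
    using inverse_sin_squared_sums[OF Im_Suc_mult_nonzero[OF assms, of m]]
    by (simp only: Uterm_def[abs_def])
  \<comment> \<open>The Lambert term is the full row sum over all integers, hence the subtraction of
    the term n = 0.\<close>
  have U': "(\<Sum>n. Uterm \<tau> m n) = - 4 * of_real pi ^ 2 * (q ^ Suc m / (1 - q ^ Suc m)\<^sup>2) - 1 / \<tau>\<^sup>2 * (1 / (of_nat (Suc m))\<^sup>2)" for m
  proof -
    have "q ^ Suc m / (1 - q ^ Suc m)\<^sup>2 = - 1 / (4 * (sin (of_real pi * (of_nat (Suc m) * \<tau>)))\<^sup>2)"
      using e_div_one_minus_e_squared[OF Im_Suc_mult_nonzero[OF assms, of m]]
      by (simp only: e_of_nat_mult q_def)
    then show ?thesis
      unfolding sums_unique[OF U[of m], symmetric]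
      by (simp add: power_divide power_mult_distrib del: of_nat_Suc power_Suc)
  qed
  define A where "A = - 4 * of_real pi ^ 2 * s - 1 / \<tau>\<^sup>2 * (of_real pi ^ 2 / 6)"
  have "(\<lambda>m. \<Sum>n. Uterm \<tau> m n) sums A"
    unfolding U' A_def
    by (intro sums_diff sums_mult s(2) inverse_squares_sums_complex)
  moreover have "dLeta \<tau> = of_real pi * \<i> / 12 + \<i> / (2 * of_real pi) * (of_real pi ^ 2 / (6 * \<tau>\<^sup>2) + A)"
  proof -
    have "(\<lambda>n. - 2 * of_real pi * \<i> * (of_nat (Suc n) * (q ^ Suc n / (1 - q ^ Suc n)))) sums (- 2 * of_real pi * \<i> * s)"
      by (intro sums_mult s(1))
    then have "dLeta \<tau> = of_real pi * \<i> / 12 - 2 * of_real pi * \<i> * s"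
      unfolding dLeta_def q_def[symmetric] by (simp add: sums_iff mult_ac)
    then show ?thesis using \<tau>0
      by (simp add: A_def field_simps power2_eq_square)
  qed
  moreover have "Uterm \<tau> m sums (\<Sum>n. Uterm \<tau> m n)" for m
    using U[of m] by (simp add: sums_iff)
  ultimately show ?thesis using that by blast
qed

text \<open>Inversion exchanges the two indices, and the sign it produces in one of the two terms
  disappears in the square. The inverted Eisenstein series is thus the original one summed in the
  other order.\<close>

lemma Uterm_neg_inverse:
  assumes "\<tau> \<in> uhp"
  shows "Uterm (- 1 / \<tau>) m n = \<tau>\<^sup>2 * Uterm \<tau> n m"
proof -
  have \<tau>0: "\<tau> \<noteq> 0" using assms by (auto simp: uhp_def)
  define M N :: complex where "M = of_nat (Suc m)" and "N = of_nat (Suc n)"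
  have "M * (- 1 / \<tau>) + N = (N * \<tau> - M) / \<tau>" "M * (- 1 / \<tau>) - N = - ((N * \<tau> + M) / \<tau>)"
    using \<tau>0 by (simp_all add: field_simps)
  then show ?thesis
    unfolding Uterm_def M_def[symmetric] N_def[symmetric]
    by (simp only: power_divide power2_minus) (simp add: distrib_left add.commute)
qed

text \<open>The difference of the two terms at z is -1/4 divided by z^2 (z - 1/2) (z + 1/2), hence
  of fourth order. Bounding each squared modulus below by a multiple of the product M N, rather than
  of the maximum, gives a majorant that factors into two one-dimensional series.\<close>

lemma Uterm_minus_Vterm_summable:
  assumes "\<tau> \<in> uhp"
  shows "(\<lambda>(m, n). Uterm \<tau> m n - Vterm \<tau> m n) summable_on UNIV"
proof -
  obtain \<delta> where \<delta>: "\<delta> > 0"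
    "\<And>c d :: real. norm (of_real c * \<tau> + of_real d) \<ge> \<delta> * max \<bar>c\<bar> \<bar>d\<bar>"
    using uhp_norm_linear_ge[OF assms] by blast
  \<comment> \<open>Each of the two signs contributes 1 / (4 (delta^2 / 2)^2) = 1 / delta^4, and
    \<open>C\<close> is twice that.\<close>
  define C where "C = 8 / (4 * \<delta> ^ 4)"
  have bound: "norm (1 / z\<^sup>2 - 1 / (z\<^sup>2 - 1 / 4)) \<le> C / 2 * (1 / (M\<^sup>2 * N\<^sup>2))"
    if z: "z = of_real M * \<tau> + of_real d" "\<bar>d\<bar> = N" "M \<ge> 1" "N \<ge> 1" for M N d z
  proof -
    \<comment> \<open>Asking only for N/2 leaves room for the shifts by 1/2 on either side, because
      N is at least 1.\<close>
    have half: "norm (of_real M * \<tau> + of_real x) ^ 2 \<ge> \<delta>\<^sup>2 / 2 * (M * N)" if x: "\<bar>x\<bar> \<ge> N / 2" for x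
    proof -
      have *: "max \<bar>M\<bar> \<bar>x\<bar> \<ge> M" "max \<bar>M\<bar> \<bar>x\<bar> \<ge> N / 2" using x z by auto
      have "M * (N / 2) \<le> max \<bar>M\<bar> \<bar>x\<bar> * max \<bar>M\<bar> \<bar>x\<bar>"
        using * z by (intro mult_mono) auto
      then have "\<delta>\<^sup>2 * (M * (N / 2)) \<le> \<delta>\<^sup>2 * (max \<bar>M\<bar> \<bar>x\<bar> * max \<bar>M\<bar> \<bar>x\<bar>)"
        by (intro mult_left_mono) auto
      also have "\<dots> = (\<delta> * max \<bar>M\<bar> \<bar>x\<bar>)\<^sup>2" by (simp add: power2_eq_square)
      also have "\<dots> \<le> norm (of_real M * \<tau> + of_real x) ^ 2"
        using \<delta> by (intro power_mono) auto
      finally show ?thesis by simp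
    qed
    have z1: "norm z ^ 2 \<ge> \<delta>\<^sup>2 / 2 * (M * N)" unfolding z(1) by (rule half) (use z in auto)
    have zp: "norm (z + 1 / 2) ^ 2 \<ge> \<delta>\<^sup>2 / 2 * (M * N)"
    proof -
      have "\<bar>d + 1 / 2\<bar> \<ge> N / 2" using z by linarith
      then show ?thesis using half[of "d + 1 / 2"] z(1) by (simp add: add.assoc)
    qed
    have zm: "norm (z - 1 / 2) ^ 2 \<ge> \<delta>\<^sup>2 / 2 * (M * N)"
    proof -
      have "\<bar>d - 1 / 2\<bar> \<ge> N / 2" using z by linarith
      then show ?thesis using half[of "d - 1 / 2"] z(1) by (simp add: add_diff_eq)
    qed
    have pos: "\<delta>\<^sup>2 / 2 * (M * N) > 0" using \<delta> z by simp
    have "w \<noteq> 0" if "norm w ^ 2 \<ge> \<delta>\<^sup>2 / 2 * (M * N)" for w :: complex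
      using that pos by auto
    from this[OF z1] this[OF zp] this[OF zm]
    have nz: "z \<noteq> 0" "z + 1 / 2 \<noteq> 0" "z - 1 / 2 \<noteq> 0" .
    have fac: "z\<^sup>2 - 1 / 4 = (z + 1 / 2) * (z - 1 / 2)"
      by (simp add: power2_eq_square algebra_simps)
    have "1 / z\<^sup>2 - 1 / (z\<^sup>2 - 1 / 4) = - 1 / (4 * (z\<^sup>2 * ((z + 1 / 2) * (z - 1 / 2))))"
    proof -
      define P where "P = (z + 1 / 2) * (z - 1 / 2)"
      have "P \<noteq> 0" using nz by (simp only: P_def mult_eq_0_iff simp_thms)
      moreover have "P - z\<^sup>2 = - 1 / 4" unfolding P_def fac[symmetric] by simp
      ultimately show ?thesis
        using nz(1) unfolding fac P_def[symmetric] by (simp add: diff_frac_eq)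
    qed
    then have eq: "norm (1 / z\<^sup>2 - 1 / (z\<^sup>2 - 1 / 4)) =
        1 / (4 * (norm z ^ 2 * (norm (z + 1 / 2) * norm (z - 1 / 2))))"
      by (simp add: norm_divide norm_mult norm_power)
    have "(\<delta>\<^sup>2 / 2 * (M * N))\<^sup>2 \<le> norm (z + 1 / 2) ^ 2 * norm (z - 1 / 2) ^ 2"
      unfolding power2_eq_square[of "\<delta>\<^sup>2 / 2 * (M * N)"]
      by (rule mult_mono[OF zp zm]) (use pos in auto)
    then have "(\<delta>\<^sup>2 / 2 * (M * N))\<^sup>2 \<le> (norm (z + 1 / 2) * norm (z - 1 / 2))\<^sup>2"
      by (simp only: power_mult_distrib)
    then have zpm: "\<delta>\<^sup>2 / 2 * (M * N) \<le> norm (z + 1 / 2) * norm (z - 1 / 2)"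
      by (rule power2_le_imp_le) auto
    have "(\<delta>\<^sup>2 / 2 * (M * N)) * (\<delta>\<^sup>2 / 2 * (M * N)) \<le> norm z ^ 2 * (norm (z + 1 / 2) * norm (z - 1 / 2))"
      by (rule mult_mono[OF z1 zpm]) (use pos in auto)
    moreover have "1 / (4 * X) \<le> 1 / (4 * K)" if "K \<le> X" "0 < K" for X K :: real
      using that by (simp add: frac_le)
    ultimately have "1 / (4 * (norm z ^ 2 * (norm (z + 1 / 2) * norm (z - 1 / 2)))) \<le>
        1 / (4 * ((\<delta>\<^sup>2 / 2 * (M * N)) * (\<delta>\<^sup>2 / 2 * (M * N))))"
      using mult_pos_pos[OF pos pos] by blast
    also have "\<dots> = C / 2 * (1 / (M\<^sup>2 * N\<^sup>2))"
      using \<delta> z by (simp add: C_def field_simps power2_eq_square power4_eq_xxxx)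
    finally show ?thesis unfolding eq .
  qed
  have "(\<lambda>n. 1 / (real (Suc n))\<^sup>2) summable_on UNIV"
    using inverse_squares_sums
    by (intro summable_nonneg_imp_summable_on) (auto simp: sums_iff add.commute)
  from summable_on_Times_nonneg[OF this this]
  have "(\<lambda>(m, n). 1 / (real (Suc m))\<^sup>2 * (1 / (real (Suc n))\<^sup>2)) summable_on UNIV"
    by simp
  then have "(\<lambda>x. C * (case x of (m, n) \<Rightarrow> 1 / (real (Suc m))\<^sup>2 * (1 / (real (Suc n))\<^sup>2))) summable_on UNIV"
    by (rule summable_on_cmult_right)
  then have "(\<lambda>x. norm (case x of (m, n) \<Rightarrow> Uterm \<tau> m n - Vterm \<tau> m n)) summable_on UNIV"
  proof (rule Infinite_Sum.abs_summable_on_comparison_test')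
    fix x :: "nat \<times> nat"
    obtain m n where x: "x = (m, n)" by (cases x)
    define M N where "M = real (Suc m)" and "N = real (Suc n)"
    have MN: "M \<ge> 1" "N \<ge> 1" by (auto simp: M_def N_def)
    define z z' where "z = of_nat (Suc m) * \<tau> + of_nat (Suc n)" and "z' = of_nat (Suc m) * \<tau> - of_nat (Suc n)"
    have z: "norm (1 / z\<^sup>2 - 1 / (z\<^sup>2 - 1 / 4)) \<le> C / 2 * (1 / (M\<^sup>2 * N\<^sup>2))"
      by (rule bound[of _ _ N]) (use MN in \<open>auto simp: M_def N_def z_def\<close>)
    have z': "norm (1 / z'\<^sup>2 - 1 / (z'\<^sup>2 - 1 / 4)) \<le> C / 2 * (1 / (M\<^sup>2 * N\<^sup>2))"
      by (rule bound[of _ _ "- N"]) (use MN in \<open>auto simp: M_def N_def z'_def\<close>)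
    have "Uterm \<tau> m n - Vterm \<tau> m n = (1 / z\<^sup>2 - 1 / (z\<^sup>2 - 1 / 4)) + (1 / z'\<^sup>2 - 1 / (z'\<^sup>2 - 1 / 4))"
      unfolding Uterm_def Vterm_def z_def z'_def by (simp only: algebra_simps)
    then have "norm (Uterm \<tau> m n - Vterm \<tau> m n) \<le> C / 2 * (1 / (M\<^sup>2 * N\<^sup>2)) + C / 2 * (1 / (M\<^sup>2 * N\<^sup>2))"
      using norm_triangle_mono[OF z z'] by simp
    then show "norm (case x of (m, n) \<Rightarrow> Uterm \<tau> m n - Vterm \<tau> m n) \<le>
        C * (case x of (m, n) \<Rightarrow> 1 / (real (Suc m))\<^sup>2 * (1 / (real (Suc n))\<^sup>2))"
      by (simp add: x M_def N_def)
  qed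
  then show ?thesis by (rule abs_summable_summable)
qed

text \<open>Up to the factor 1/tau this is the m-th paired term in the partial fractions of the
  cotangent at s/tau, so its sum over m has a closed form; at half-integral s it is what
  \<open>Vterm\<close> telescopes through.\<close>

definition Dterm :: "complex \<Rightarrow> real \<Rightarrow> nat \<Rightarrow> complex" where
  "Dterm \<tau> s m = 1 / (of_nat (Suc m) * \<tau> + of_real s) - 1 / (of_nat (Suc m) * \<tau> - of_real s)"

lemma Suc_mult_add_real_nonzero:
  assumes "\<tau> \<in> uhp"
  shows "of_nat (Suc m) * \<tau> + of_real x \<noteq> 0" "of_nat (Suc m) * \<tau> - of_real x \<noteq> 0"
  using Im_Suc_mult_nonzero[OF assms, of m] by (auto simp: complex_eq_iff simp del: of_nat_Suc)

lemma Vterm_telescope: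
  assumes "\<tau> \<in> uhp"
  shows "Vterm \<tau> m n = Dterm \<tau> (real n + 1 / 2) m - Dterm \<tau> (real (Suc n) + 1 / 2) m"
proof -
  define x where "x = of_nat (Suc m) * \<tau>"
  have nz: "x + of_real t \<noteq> 0" "x - of_real t \<noteq> 0" for t
    using Suc_mult_add_real_nonzero[OF assms] by (auto simp: x_def)
  have *: "1 / (y\<^sup>2 - 1 / 4) = 1 / (y - 1 / 2) - 1 / (y + 1 / 2)"
    if "y - 1 / 2 \<noteq> 0" "y + 1 / 2 \<noteq> 0" for y :: complex
  proof -
    have "y\<^sup>2 - 1 / 4 = (y - 1 / 2) * (y + 1 / 2)" by (simp add: power2_eq_square algebra_simps)
    then show ?thesis using that by (simp add: diff_frac_eq)
  qed
  have a: "x + of_nat (Suc n) - 1 / 2 = x + of_real (real n + 1 / 2)"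
    "x + of_nat (Suc n) + 1 / 2 = x + of_real (real (Suc n) + 1 / 2)"
    "x - of_nat (Suc n) - 1 / 2 = x - of_real (real (Suc n) + 1 / 2)"
    "x - of_nat (Suc n) + 1 / 2 = x - of_real (real n + 1 / 2)"
    by (simp_all add: field_simps)
  have "1 / ((x + of_nat (Suc n))\<^sup>2 - 1 / 4) = 1 / (x + of_real (real n + 1 / 2)) - 1 / (x + of_real (real (Suc n) + 1 / 2))"
    by (subst *; (simp only: a nz not_False_eq_True)?)
  moreover have "1 / ((x - of_nat (Suc n))\<^sup>2 - 1 / 4) = 1 / (x - of_real (real (Suc n) + 1 / 2)) - 1 / (x - of_real (real n + 1 / 2))"
    by (subst *; (simp only: a nz not_False_eq_True)?)
  ultimately show ?thesis
    unfolding Vterm_def Dterm_def x_def[symmetric] by (simp only:) simp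
qed

lemma Dterm_sums:
  assumes "\<tau> \<in> uhp" "s > 0"
  shows "Dterm \<tau> s sums ((of_real pi * cot (of_real pi * (of_real s / \<tau>)) - \<tau> / of_real s) / \<tau>)"
proof -
  define w where "w = of_real s / \<tau>"
  have \<tau>0: "\<tau> \<noteq> 0" using assms by (auto simp: uhp_def)
  have "Im (1 / \<tau>) \<noteq> 0" using neg_inverse_in_uhp[OF assms(1)] by (auto simp: uhp_def)
  moreover have "w = of_real s * (1 / \<tau>)" by (simp add: w_def)
  then have "Im w = s * Im (1 / \<tau>)"
    by (simp only: times_complex.sel Im_complex_of_real Re_complex_of_real)
  ultimately have w: "Im w \<noteq> 0" using assms(2) by simp
  have "Dterm \<tau> s m = (1 / (w + of_nat (Suc m)) + 1 / (w - of_nat (Suc m))) / \<tau>" for m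
  proof -
    have eqs: "w + of_nat (Suc m) = (of_nat (Suc m) * \<tau> + of_real s) / \<tau>"
      "w - of_nat (Suc m) = - ((of_nat (Suc m) * \<tau> - of_real s) / \<tau>)"
      using \<tau>0 by (simp_all add: w_def field_simps)
    have "1 / x - 1 / y = (1 / (x / \<tau>) + 1 / (- (y / \<tau>))) / \<tau>" for x y
      using \<tau>0 by (simp add: diff_divide_distrib)
    then show ?thesis unfolding Dterm_def eqs .
  qed
  moreover have "\<tau> / of_real s = 1 / w" by (simp add: w_def)
  ultimately show ?thesis
    using sums_divide[OF cot_sums[OF w], of \<tau>] unfolding w_def[symmetric] by presburger
qed

text \<open>The limit is i, and not -i, because the imaginary part tends to minus infinity. In the
  application the argument is pi s / tau with s growing and 1/tau in the lower half plane; this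
  fixes the sign of the anomaly.\<close>

lemma cot_tendsto_ii:
  assumes "filterlim (\<lambda>n. Im (z n)) at_bot F"
  shows "((\<lambda>n. cot (z n)) \<longlongrightarrow> \<i>) F"
proof -
  have eq: "cot w = \<i> * (1 + exp (- (2 * \<i> * w))) / (1 - exp (- (2 * \<i> * w)))" for w
  proof -
    have "exp (- (2 * \<i> * w)) = exp (- (\<i> * w)) / exp (\<i> * w)"
      by (simp add: exp_diff[symmetric] mult.assoc)
    then have "\<i> * (1 + exp (- (2 * \<i> * w))) / (1 - exp (- (2 * \<i> * w))) =
        \<i> * ((exp (\<i> * w) + exp (- (\<i> * w))) / exp (\<i> * w)) / ((exp (\<i> * w) - exp (- (\<i> * w))) / exp (\<i> * w))"
      by (simp add: add_divide_distrib diff_divide_distrib)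
    also have "\<dots> = \<i> * (exp (\<i> * w) + exp (- (\<i> * w))) / (exp (\<i> * w) - exp (- (\<i> * w)))"
      by simp
    also have "\<dots> = cot w"
    proof -
      have "\<i> * (a + b) / (a - b) = (a + b) / 2 / ((a - b) / (2 * \<i>))" for a b :: complex
      proof -
        have "(a + b) / 2 / ((a - b) / (2 * \<i>)) = (a + b) / 2 * (2 * \<i>) / (a - b)"
          by (rule divide_divide_eq_right)
        also have "(a + b) / 2 * (2 * \<i>) = \<i> * (a + b)" by simp
        finally show ?thesis ..
      qed
      then show ?thesis unfolding cot_def sin_exp_eq cos_exp_eq .
    qed
    finally show ?thesis ..
  qed
  have "((\<lambda>n. exp (2 * Im (z n))) \<longlongrightarrow> 0) F"
    by (rule filterlim_compose[OF exp_at_bot filterlim_tendsto_pos_mult_at_bot[OF tendsto_const _ assms]]) simp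
  then have "((\<lambda>n. norm (exp (- (2 * \<i> * z n)))) \<longlongrightarrow> 0) F"
    by simp
  then have "((\<lambda>n. exp (- (2 * \<i> * z n))) \<longlongrightarrow> 0) F"
    by (rule tendsto_norm_zero_cancel)
  then have "((\<lambda>n. \<i> * (1 + exp (- (2 * \<i> * z n))) / (1 - exp (- (2 * \<i> * z n)))) \<longlongrightarrow> \<i> * (1 + 0) / (1 - 0)) F"
    by (intro tendsto_intros) auto
  then show ?thesis by (simp add: eq)
qed

text \<open>The two sides are the same double series in its two orders. \<open>Uterm\<close> -
  \<open>Vterm\<close> has the same sum in both, so the discrepancy is that of \<open>Vterm\<close>,
  for which both iterated sums are explicit.\<close>

lemma dLeta_neg_inverse:
  assumes "\<tau> \<in> uhp"
  shows "dLeta (- 1 / \<tau>) / \<tau>\<^sup>2 = dLeta \<tau> + 1 / (2 * \<tau>)"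
proof -
  have \<tau>0: "\<tau> \<noteq> 0" using assms by (auto simp: uhp_def)
  define \<sigma> where "\<sigma> = - 1 / \<tau>"
  have \<sigma>: "\<sigma> \<in> uhp" using neg_inverse_in_uhp[OF assms] by (simp add: \<sigma>_def)
  obtain A where A: "(\<lambda>m. \<Sum>n. Uterm \<tau> m n) sums A"
    "dLeta \<tau> = of_real pi * \<i> / 12 + \<i> / (2 * of_real pi) * (of_real pi ^ 2 / (6 * \<tau>\<^sup>2) + A)"
    "\<And>m. Uterm \<tau> m sums (\<Sum>n. Uterm \<tau> m n)"
    using dLeta_eq_Eisenstein[OF assms] by blast
  obtain A' where A': "(\<lambda>m. \<Sum>n. Uterm \<sigma> m n) sums A'"
    "dLeta \<sigma> = of_real pi * \<i> / 12 + \<i> / (2 * of_real pi) * (of_real pi ^ 2 / (6 * \<sigma>\<^sup>2) + A')"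
    "\<And>m. Uterm \<sigma> m sums (\<Sum>n. Uterm \<sigma> m n)"
    using dLeta_eq_Eisenstein[OF \<sigma>] by blast
  define B where "B = A' / \<tau>\<^sup>2"
  \<comment> \<open>A column for tau is a row for -1/tau divided by tau^2, which is where the second
    order of summation comes from.\<close>
  have col: "(\<lambda>m. Uterm \<tau> m n) sums ((\<Sum>k. Uterm \<sigma> n k) / \<tau>\<^sup>2)" for n
  proof -
    have "Uterm \<sigma> n m / \<tau>\<^sup>2 = Uterm \<tau> m n" for m
      unfolding \<sigma>_def Uterm_neg_inverse[OF assms] using \<tau>0 by simp
    then show ?thesis using sums_divide[OF A'(3)[of n], of "\<tau>\<^sup>2"] by simp
  qed
  have B: "(\<lambda>n. (\<Sum>k. Uterm \<sigma> n k) / \<tau>\<^sup>2) sums B"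
    unfolding B_def by (intro sums_divide A'(1))
  define \<phi> where "\<phi> s = (of_real pi * cot (of_real pi * (of_real s / \<tau>)) - \<tau> / of_real s) / \<tau>" for s
  have \<phi>: "Dterm \<tau> s sums \<phi> s" if "s > 0" for s
    unfolding \<phi>_def by (rule Dterm_sums[OF assms that])
  \<comment> \<open>Along a row the telescoped end tends to 0, so this order has no boundary
    term.\<close>
  have rowV: "Vterm \<tau> m sums Dterm \<tau> (1 / 2) m" for m
  proof -
    have at_inf: "filterlim (\<lambda>n. a + of_real (real n + 1 / 2)) at_infinity sequentially"
      "filterlim (\<lambda>n. a - of_real (real n + 1 / 2)) at_infinity sequentially" for a :: complex
    proof -
      have "filterlim (\<lambda>n. complex_of_real (real n + 1 / 2)) at_infinity sequentially"
        unfolding filterlim_at_infinity_conv_norm_at_top norm_of_real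
        by (rule filterlim_at_top_mono[OF filterlim_real_sequentially]) auto
      moreover have "filterlim (\<lambda>n. - complex_of_real (real n + 1 / 2)) at_infinity sequentially"
        unfolding filterlim_at_infinity_conv_norm_at_top norm_minus_cancel norm_of_real
        by (rule filterlim_at_top_mono[OF filterlim_real_sequentially]) auto
      ultimately show "filterlim (\<lambda>n. a + of_real (real n + 1 / 2)) at_infinity sequentially"
        "filterlim (\<lambda>n. a - of_real (real n + 1 / 2)) at_infinity sequentially"
        unfolding diff_conv_add_uminus
        by - (rule tendsto_add_filterlim_at_infinity[OF tendsto_const]; assumption)+
    qed
    have "(\<lambda>n. Dterm \<tau> (real n + 1 / 2) m) \<longlonglongrightarrow> 0 - 0"
      unfolding Dterm_def
      by (intro tendsto_diff tendsto_divide_0[OF tendsto_const] at_inf)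
    then have "(\<lambda>n. Dterm \<tau> (real n + 1 / 2) m - Dterm \<tau> (real (Suc n) + 1 / 2) m) sums
        (Dterm \<tau> (real 0 + 1 / 2) m - 0)"
      by (intro telescope_sums') simp
    then show ?thesis
      by (simp add: Vterm_telescope[OF assms, abs_def])
  qed
  have colV: "(\<lambda>m. Vterm \<tau> m n) sums (\<phi> (real n + 1 / 2) - \<phi> (real (Suc n) + 1 / 2))" for n
    unfolding Vterm_telescope[OF assms] by (intro sums_diff \<phi>) auto
  \<comment> \<open>Across the columns the telescoped end does not vanish: its limit pi i / tau is
    the whole difference between the two orders.\<close>
  have "(\<lambda>n. \<phi> (real n + 1 / 2)) \<longlonglongrightarrow> (of_real pi * \<i> - \<tau> * 0) / \<tau>"
  proof -
    have top: "filterlim (\<lambda>n. real n + 1 / 2) at_top sequentially"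
      by (rule filterlim_at_top_mono[OF filterlim_real_sequentially]) auto
    have "Im (1 / \<tau>) < 0" using \<sigma> by (simp add: \<sigma>_def uhp_def)
    then have neg: "pi * Im (1 / \<tau>) < 0" by (simp add: mult_pos_neg)
    have "filterlim (\<lambda>n. Im (of_real pi * (of_real (real n + 1 / 2) / \<tau>))) at_bot sequentially"
    proof -
      have Im_eq: "Im (of_real pi * (of_real x / \<tau>)) = pi * Im (1 / \<tau>) * x" for x
      proof -
        have "of_real pi * (of_real x / \<tau>) = of_real (pi * x) * (1 / \<tau>)" by simp
        then show ?thesis
          by (simp only: times_complex.sel Im_complex_of_real Re_complex_of_real) simp
      qed
      show ?thesis
        unfolding Im_eq by (rule filterlim_tendsto_neg_mult_at_bot[OF tendsto_const neg top])
    qed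
    then have "(\<lambda>n. cot (of_real pi * (of_real (real n + 1 / 2) / \<tau>))) \<longlonglongrightarrow> \<i>"
      by (rule cot_tendsto_ii)
    note 1 = this
    have 2: "(\<lambda>n. complex_of_real (inverse (real n + 1 / 2))) \<longlonglongrightarrow> of_real 0"
      by (intro tendsto_of_real filterlim_compose[OF tendsto_inverse_0_at_top[OF filterlim_ident] top])
    have \<phi>_eq: "\<phi> x = (of_real pi * cot (of_real pi * (of_real x / \<tau>)) - \<tau> * of_real (inverse x)) / \<tau>" for x
      by (simp add: \<phi>_def divide_inverse)
    have "(\<lambda>n. \<phi> (real n + 1 / 2)) \<longlonglongrightarrow> (of_real pi * \<i> - \<tau> * of_real 0) / \<tau>"
      unfolding \<phi>_eq
      by (rule tendsto_divide[OF tendsto_diff[OF tendsto_mult[OF tendsto_const 1]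
            tendsto_mult[OF tendsto_const 2]] tendsto_const \<tau>0])
    then show ?thesis by simp
  qed
  then have BV: "(\<lambda>n. \<phi> (real n + 1 / 2) - \<phi> (real (Suc n) + 1 / 2)) sums (\<phi> (1 / 2) - of_real pi * \<i> / \<tau>)"
    using telescope_sums'[of "\<lambda>n. \<phi> (real n + 1 / 2)"] by simp
  obtain s where s: "(\<lambda>m. (\<Sum>n. Uterm \<tau> m n) - Dterm \<tau> (1 / 2) m) sums s"
    "(\<lambda>n. (\<Sum>k. Uterm \<sigma> n k) / \<tau>\<^sup>2 - (\<phi> (real n + 1 / 2) - \<phi> (real (Suc n) + 1 / 2))) sums s"
    by (rule double_sums_swap[OF Uterm_minus_Vterm_summable[OF assms]
      sums_diff[OF A(3) rowV] sums_diff[OF col colV]])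
  have "s = A - \<phi> (1 / 2)"
    using sums_unique2[OF s(1) sums_diff[OF A(1) \<phi>[of "1 / 2"]]] by simp
  moreover have "s = B - (\<phi> (1 / 2) - of_real pi * \<i> / \<tau>)"
    using sums_unique2[OF s(2) sums_diff[OF B BV]] .
  \<comment> \<open>Multiplied by i / (2 pi), the term -pi i / tau becomes the anomaly 1 / (2
    tau).\<close>
  ultimately have BA: "A' / \<tau>\<^sup>2 = A - of_real pi * \<i> / \<tau>"
    by (simp add: B_def algebra_simps)
  have \<sigma>2: "\<sigma>\<^sup>2 = 1 / \<tau>\<^sup>2" by (simp add: \<sigma>_def power_divide)
  have "dLeta \<sigma> / \<tau>\<^sup>2 = of_real pi * \<i> / (12 * \<tau>\<^sup>2) + \<i> / (2 * of_real pi) * (of_real pi ^ 2 / 6 + A' / \<tau>\<^sup>2)"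
    unfolding A'(2) \<sigma>2 using \<tau>0 by (simp add: field_simps)
  also have "\<dots> = dLeta \<tau> + 1 / (2 * \<tau>)"
    unfolding A(2) BA using \<tau>0 by (simp add: field_simps power2_eq_square)
  finally show ?thesis by (simp add: \<sigma>_def)
qed

text \<open>By the law of \<open>dLeta\<close> the difference of the two sides has derivative 0, so
  it is constant. At the fixed point i the factor -i tau equals 1 and the constant is 0.\<close>

theorem Leta_neg_inverse:
  assumes "\<tau> \<in> uhp"
  shows "Leta (- 1 / \<tau>) = Leta \<tau> + Ln (- \<i> * \<tau>) / 2"
proof -
  define F where "F z = Leta (- 1 / z) - Leta z - Ln (- \<i> * z) / 2" for z
  have "(F has_field_derivative 0) (at z within uhp)" if z: "z \<in> uhp" for z
  proof -
    have z0: "z \<noteq> 0" using z by (auto simp: uhp_def)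
    have "- \<i> * z \<notin> \<real>\<^sub>\<le>\<^sub>0" using z by (auto simp: uhp_def complex_nonpos_Reals_iff)
    then have "((\<lambda>z. Ln (- \<i> * z) / 2) has_field_derivative - \<i> / (- \<i> * z) / 2) (at z)"
      using z0 by (auto intro!: derivative_eq_intros simp: inverse_eq_divide)
    moreover have "((\<lambda>z. - 1 / z) has_field_derivative 1 / z\<^sup>2) (at z)"
      using z0 by (auto intro!: derivative_eq_intros simp: power2_eq_square)
    note DERIV_chain2[OF Leta_convergence(3)[OF neg_inverse_in_uhp[OF z]] this]
    ultimately have "(F has_field_derivative
        (dLeta (- 1 / z) * (1 / z\<^sup>2) - dLeta z - (- \<i>) / (- \<i> * z) / 2)) (at z)"
      unfolding F_def by (intro DERIV_diff Leta_convergence(3)[OF z])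
    then have "(F has_field_derivative (dLeta (- 1 / z) / z\<^sup>2 - dLeta z - (- \<i>) / (- \<i> * z) / 2)) (at z)"
      by simp
    then have "(F has_field_derivative 0) (at z)"
      unfolding dLeta_neg_inverse[OF z] using z0 by simp
    then show ?thesis by (rule has_field_derivative_at_within)
  qed
  then obtain c where c: "\<And>z. z \<in> uhp \<Longrightarrow> F z = c"
    using has_field_derivative_zero_constant[OF convex_uhp] by blast
  have "F \<i> = 0" by (simp add: F_def)
  then have "F \<tau> = 0" using c[of \<i>] c[OF assms] by simp
  then show ?thesis by (simp add: F_def algebra_simps)
qed


section \<open>The transformation law with Dedekind sums\<close>

abbreviation (input) aff :: "int \<Rightarrow> int \<Rightarrow> complex \<Rightarrow> complex" where
  "aff c d \<tau> \<equiv> of_int c * \<tau> + of_int d"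

abbreviation (input) tpi :: complex where
  "tpi \<equiv> 2 * of_real pi * \<i>"

lemma uhp_nonzero: "z \<in> uhp \<Longrightarrow> z \<noteq> 0"
  by (auto simp: uhp_def)

lemma Im_Ln_uhp: "z \<in> uhp \<Longrightarrow> 0 < Im (Ln z) \<and> Im (Ln z) < pi"
  using Im_Ln_pos_lt[OF uhp_nonzero] by (simp add: uhp_def)

lemma Ln_minus_uhp: "z \<in> uhp \<Longrightarrow> Ln (- z) = Ln z - of_real pi * \<i>"
  using uhp_nonzero[of z] by (subst Ln_minus) (auto simp: uhp_def mult.commute)

text \<open>The arguments add up to a number in (0, 2 pi). If it exceeded pi, the principal argument
  of the product would be negative, contrary to the product lying in the upper half plane.\<close>

lemma Ln_mult_uhp:
  assumes "z \<in> uhp" "w \<in> uhp" "z * w \<in> uhp"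
  shows "Ln (z * w) = Ln z + Ln w"
proof -
  have "0 < Im (Ln z)" "Im (Ln z) < pi" "0 < Im (Ln w)" "Im (Ln w) < pi"
    "0 < Im (Ln (z * w))" "Im (Ln (z * w)) < pi"
    using assms Im_Ln_uhp by auto
  moreover have nz: "z \<noteq> 0" "w \<noteq> 0" using assms by (auto simp: uhp_def)
  moreover have "Ln (z * w) = (if Im (Ln z + Ln w) \<le> - pi then Ln z + Ln w + \<i> * of_real (2 * pi)
      else if Im (Ln z + Ln w) > pi then Ln z + Ln w - \<i> * of_real (2 * pi) else Ln z + Ln w)"
    using Ln_times[OF nz] by simp
  ultimately show ?thesis by (auto split: if_splits)
qed

definition moeb :: "int \<Rightarrow> int \<Rightarrow> int \<Rightarrow> int \<Rightarrow> complex \<Rightarrow> complex" where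
  "moeb a b c d \<tau> = (aff a b \<tau>) / (aff c d \<tau>)"

lemma linear_nonzero:
  assumes "\<tau> \<in> uhp" "c \<noteq> 0 \<or> d \<noteq> 0"
  shows "aff c d \<tau> \<noteq> (0 :: complex)"
  using assms by (auto simp: uhp_def complex_eq_iff)

lemma Im_moeb:
  assumes "\<tau> \<in> uhp" "a * d - b * c = 1"
  shows "Im (moeb a b c d \<tau>) = Im \<tau> / (norm (aff c d \<tau>))\<^sup>2"
proof -
  have "real_of_int a * of_int d - of_int b * of_int c = of_int (a * d - b * c)" by simp
  then have det: "real_of_int a * of_int d - of_int b * of_int c = 1" using assms by simp
  have "Im (moeb a b c d \<tau>) =
      (of_int a * Im \<tau> * (of_int c * Re \<tau> + of_int d) - (of_int a * Re \<tau> + of_int b) * (of_int c * Im \<tau>)) /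
      (norm (aff c d \<tau>))\<^sup>2"
    by (simp add: moeb_def Im_divide cmod_power2)
  also have "of_int a * Im \<tau> * (of_int c * Re \<tau> + of_int d) - (of_int a * Re \<tau> + of_int b) * (of_int c * Im \<tau>)
      = (real_of_int a * of_int d - of_int b * of_int c) * Im \<tau>"
    by (simp add: algebra_simps)
  finally show ?thesis by (simp add: det)
qed

lemma det_1_nonzero: "a * d - b * c = (1 :: int) \<Longrightarrow> c \<noteq> 0 \<or> d \<noteq> 0"
  by auto

lemma moeb_in_uhp:
  assumes "\<tau> \<in> uhp" "a * d - b * c = 1"
  shows "moeb a b c d \<tau> \<in> uhp"
  using Im_moeb[OF assms] linear_nonzero[OF assms(1) det_1_nonzero[OF assms(2)]] assms
  by (simp add: uhp_def)

lemma linear_in_uhp: "\<tau> \<in> uhp \<Longrightarrow> c > 0 \<Longrightarrow> aff c d \<tau> \<in> uhp"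
  by (simp add: uhp_def)

lemma Leta_plus_of_int: "Leta (\<tau> + of_int n) = Leta \<tau> + of_real pi * \<i> * of_int n / 12"
  by (simp add: Leta_def e_add e_of_int add_divide_distrib distrib_left)

text \<open>The integrality of 24 times the phase is carried along in the same induction; it is what
  later makes the multipliers roots of unity.\<close>

definition eta_law :: "int \<Rightarrow> int \<Rightarrow> int \<Rightarrow> int \<Rightarrow> bool" where
  "eta_law a b c d \<longleftrightarrow> 24 * eta_phase (a + d) d c \<in> \<int> \<and>
    (\<forall>\<tau>\<in>uhp. Leta (moeb a b c d \<tau>) =
      Leta \<tau> + Ln (aff c d \<tau>) / 2 + tpi * of_real (eta_phase (a + d) d c))"

lemma eta_phase_shift:
  assumes "c > 0"
  shows "eta_phase (a + (d + n * c)) (d + n * c) c = eta_phase (a + d) d c + of_int n / 24"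
proof -
  have "dedekind_sum (- (d + n * c)) c = dedekind_sum (- d) c"
    using dedekind_sum_add_mult[OF assms, of "- d" "- n"] by simp
  then show ?thesis using assms by (simp add: eta_phase_def field_simps)
qed

lemma eta_law_shift:
  assumes "c > 0" "eta_law a b c d"
  shows "eta_law a (b + n * a) c (d + n * c)"
  unfolding eta_law_def eta_phase_shift[OF assms(1)]
proof (intro conjI ballI)
  show "24 * (eta_phase (a + d) d c + of_int n / 24) \<in> \<int>"
    using assms(2) by (simp add: eta_law_def distrib_left)
  fix \<tau> assume "\<tau> \<in> uhp"
  then have \<tau>': "\<tau> + of_int n \<in> uhp" by (simp add: uhp_def)
  have "moeb a (b + n * a) c (d + n * c) \<tau> = moeb a b c d (\<tau> + of_int n)"
    by (simp add: moeb_def algebra_simps)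
  then have "Leta (moeb a (b + n * a) c (d + n * c) \<tau>) = Leta (\<tau> + of_int n)
      + Ln (of_int c * (\<tau> + of_int n) + of_int d) / 2 + tpi * of_real (eta_phase (a + d) d c)"
    using assms(2) \<tau>' by (simp only: eta_law_def)
  also have "\<dots> = Leta \<tau> + Ln (aff c (d + n * c) \<tau>) / 2
      + tpi * of_real (eta_phase (a + d) d c + of_int n / 24)"
    by (simp add: Leta_plus_of_int algebra_simps)
  finally show "Leta (moeb a (b + n * a) c (d + n * c) \<tau>) = Leta \<tau>
      + Ln (aff c (d + n * c) \<tau>) / 2
      + tpi * of_real (eta_phase (a + d) d c + of_int n / 24)" .
qed

lemma Ln_minus_ii_mult:
  assumes "\<tau> \<in> uhp"
  shows "Ln (- \<i> * \<tau>) = Ln \<tau> - of_real pi * \<i> / 2"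
proof -
  have pos: "Im \<tau> > 0" "\<tau> \<noteq> 0" using assms by (auto simp: uhp_def)
  have "0 < Im (Ln \<tau>)" "Im (Ln \<tau>) < pi" using Im_Ln_pos_lt[of \<tau>] pos by auto
  then have "Ln (- \<i> * \<tau>) = Ln (- \<i>) + Ln \<tau>"
    using pos by (intro Ln_times_simple) auto
  then show ?thesis by simp
qed

text \<open>The hypothesis is the law for gamma S, with S the inversion, and it is applied at
  -1/tau. Reciprocity exchanges \<open>c\<close> and \<open>d\<close> in the Dedekind sum, and its
  constant has to match the branch correction of the logarithms.\<close>

lemma eta_law_inverse:
  assumes "c > 0" "d > 0" "a * d - b * c = 1" "eta_law b (- a) d (- c)"
  shows "eta_law a b c d"
proof -
  have cop: "coprime c d"
  proof (rule coprimeI)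
    fix x assume "x dvd c" "x dvd d"
    then have "x dvd a * d - b * c" by simp
    then show "is_unit x" using assms(3) by simp
  qed
  have det: "real_of_int a * of_int d - of_int b * of_int c = 1"
  proof -
    have "real_of_int a * of_int d - of_int b * of_int c = of_int (a * d - b * c)" by simp
    then show ?thesis using assms by simp
  qed
  \<comment> \<open>The term 1/8 is half of the 1/4 in the reciprocity law.\<close>
  have phase: "eta_phase (a + d) d c = eta_phase (b + - c) (- c) d + 1 / 8"
  proof -
    have r: "dedekind_sum d c = (of_int c / of_int d + of_int d / of_int c + 1 / (of_int c * of_int d)) / 12
        - 1 / 4 - dedekind_sum c d"
      using dedekind_reciprocity[OF assms(2,1) cop] by simp
    have cd: "real_of_int c \<noteq> 0" "real_of_int d \<noteq> 0" using assms by auto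
    have "real_of_int a = (1 + of_int b * of_int c) / of_int d"
      using det cd by (simp add: eq_divide_eq)
    then have e1: "real_of_int a / of_int c = of_int b / of_int d + 1 / (of_int c * of_int d)"
      using cd by (simp add: add_divide_distrib)
    have e2: "real_of_int (a + d) / (24 * of_int c) = (of_int a / of_int c + of_int d / of_int c) / 24"
      "real_of_int (b + - c) / (24 * of_int d) = (of_int b / of_int d - of_int c / of_int d) / 24"
      by (simp_all add: add_divide_distrib diff_divide_distrib)
    have "(x + y + z) / 24 + 1 / 2 * - ((u + z + y) / 12 - 1 / 4 - s) - 1 / 8 =
        (x - u) / 24 + 1 / 2 * s - 1 / 8 + 1 / 8" for x y z u s :: real
      by (simp add: field_simps)
    then show ?thesis
      unfolding eta_phase_def minus_minus dedekind_sum_minus[of d] r e2 e1 .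
  qed
  show ?thesis unfolding eta_law_def
  proof (intro conjI ballI)
    have "24 * eta_phase (a + d) d c = 24 * eta_phase (b + - c) (- c) d + of_int 3"
      unfolding phase by simp
    then show "24 * eta_phase (a + d) d c \<in> \<int>"
      using assms(4) by (simp only: eta_law_def Ints_add Ints_of_int)
    fix \<tau> assume \<tau>: "\<tau> \<in> uhp"
    define \<sigma> where "\<sigma> = - 1 / \<tau>"
    have \<tau>0: "\<tau> \<noteq> 0" using \<tau> by (auto simp: uhp_def)
    have \<sigma>: "\<sigma> \<in> uhp" using neg_inverse_in_uhp[OF \<tau>] by (simp add: \<sigma>_def)
    define w where "w = aff d (- c) \<sigma>"
    have w: "w \<in> uhp" unfolding w_def by (rule linear_in_uhp[OF \<sigma> assms(2)])
    have j: "aff c d \<tau> \<in> uhp" by (rule linear_in_uhp[OF \<tau> assms(1)])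
    have \<tau>w: "\<tau> * w = - (aff c d \<tau>)"
      using \<tau>0 by (simp add: w_def \<sigma>_def field_simps)
    have "moeb b (- a) d (- c) \<sigma> = (of_int b * \<sigma> - of_int a) * \<tau> / (w * \<tau>)"
      using \<tau>0 by (simp add: moeb_def w_def)
    also have "(of_int b * \<sigma> - of_int a) * \<tau> = - (aff a b \<tau>)"
      using \<tau>0 by (simp add: \<sigma>_def field_simps)
    also have "w * \<tau> = - (aff c d \<tau>)" using \<tau>w by (simp only: mult.commute)
    finally have "moeb a b c d \<tau> = moeb b (- a) d (- c) \<sigma>"
      by (simp only: moeb_def minus_divide_divide)
    then have eq: "Leta (moeb a b c d \<tau>) = Leta \<sigma> + Ln w / 2
        + tpi * of_real (eta_phase (b + - c) (- c) d)"
      using assms(4) \<sigma> by (simp only: eta_law_def w_def)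
    \<comment> \<open>The product is -(c tau + d), in the lower half plane, so the arguments of tau
      and w add up to more than pi and one turn is removed. Of the resulting pi i / 2, the factor -i
      in the law of inversion takes back pi i / 4; the rest is 2 pi i / 8, as in
      \<open>phase\<close>.\<close>
    have Ln_w: "Ln \<tau> + Ln w = Ln (aff c d \<tau>) + of_real pi * \<i>"
    proof -
      have nz: "\<tau> \<noteq> 0" "w \<noteq> 0" "aff c d \<tau> \<noteq> 0"
        using \<tau>0 uhp_nonzero[OF w] uhp_nonzero[OF j] by auto
      have b: "0 < Im (Ln \<tau>)" "Im (Ln \<tau>) < pi" "0 < Im (Ln w)" "Im (Ln w) < pi"
        "0 < Im (Ln (aff c d \<tau>))" "Im (Ln (aff c d \<tau>)) < pi"
        using Im_Ln_uhp[OF \<tau>] Im_Ln_uhp[OF w] Im_Ln_uhp[OF j] by auto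
      have m: "Ln (- (aff c d \<tau>)) = Ln (aff c d \<tau>) - of_real pi * \<i>"
        by (rule Ln_minus_uhp[OF j])
      have "Ln (\<tau> * w) = (if Im (Ln \<tau> + Ln w) \<le> - pi then Ln \<tau> + Ln w + \<i> * of_real (2 * pi)
          else if Im (Ln \<tau> + Ln w) > pi then Ln \<tau> + Ln w - \<i> * of_real (2 * pi) else Ln \<tau> + Ln w)"
        using Ln_times[OF nz(1,2)] by simp
      moreover have "Im (Ln (\<tau> * w)) < 0" using b unfolding \<tau>w m by simp
      ultimately have "Ln (\<tau> * w) = Ln \<tau> + Ln w - \<i> * of_real (2 * pi)"
        using b by (auto split: if_splits)
      then show ?thesis unfolding \<tau>w m by (simp add: algebra_simps)
    qed
    have L\<sigma>: "Leta \<sigma> = Leta \<tau> + (Ln \<tau> - of_real pi * \<i> / 2) / 2"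
      unfolding \<sigma>_def Leta_neg_inverse[OF \<tau>] Ln_minus_ii_mult[OF \<tau>] ..
    have L: "Leta (moeb a b c d \<tau>) = Leta \<tau> + (Ln \<tau> + Ln w) / 2 - of_real pi * \<i> / 4
        + tpi * of_real (eta_phase (b + - c) (- c) d)"
      unfolding eq L\<sigma> by (simp add: field_simps)
    show "Leta (moeb a b c d \<tau>) = Leta \<tau> + Ln (aff c d \<tau>) / 2
        + tpi * of_real (eta_phase (a + d) d c)"
      unfolding L Ln_w phase by (simp add: field_simps)
  qed
qed

text \<open>The Euclidean algorithm on the lower row; the steps are \<open>\<tau> \<mapsto> \<tau> + n\<close> and \<open>\<tau> \<mapsto> - 1 / \<tau>\<close>.\<close>

theorem eta_law_holds:
  assumes "c > 0" "a * d - b * c = 1"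
  shows "eta_law a b c d"
  using assms
proof (induction "nat c" arbitrary: a b c d rule: less_induct)
  case less
  define n d' b' where "n = d div c" and "d' = d mod c" and "b' = b - n * a"
  have d': "d = d' + n * c" "0 \<le> d'" "d' < c" using less.prems by (auto simp: n_def d'_def)
  have det': "a * d' - b' * c = 1"
    using less.prems(2) by (simp add: b'_def d'(1) algebra_simps)
  have "eta_law a b' c d'"
  proof (cases "d' = 0")
    \<comment> \<open>With lower right entry 0 the determinant forces c = 1: the matrix is an
      inversion followed by a translation by a.\<close>
    case True
    then have bc: "b' * c = - 1" using det' by simp
    then have "c dvd 1" by (metis dvd_minus_iff dvd_triv_right)
    then have c: "c = 1" "b' = - 1" using less.prems(1) bc by auto
    show ?thesis unfolding eta_law_def c True
    proof (intro conjI ballI)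
      have "24 * eta_phase (a + 0) 0 1 = of_int (a - 3)"
        by (simp add: eta_phase_def dedekind_sum_1)
      then show "24 * eta_phase (a + 0) 0 1 \<in> \<int>" by (simp only: Ints_of_int)
      fix \<tau> assume \<tau>: "\<tau> \<in> uhp"
      have "\<tau> \<noteq> 0" using \<tau> by (auto simp: uhp_def)
      then have m: "moeb a (- 1) 1 0 \<tau> = - 1 / \<tau> + of_int a" by (simp add: moeb_def field_simps)
      show "Leta (moeb a (- 1) 1 0 \<tau>) = Leta \<tau> + Ln (aff 1 0 \<tau>) / 2
          + tpi * of_real (eta_phase (a + 0) 0 1)"
        unfolding m Leta_plus_of_int Leta_neg_inverse[OF \<tau>] Ln_minus_ii_mult[OF \<tau>]
          eta_phase_def dedekind_sum_1
        by (simp add: field_simps)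
    qed
  next
    case False
    then have pos: "d' > 0" using d' by simp
    have "nat d' < nat c" using d'(3) less.prems(1) by simp
    moreover have "b' * - c - - a * d' = 1" using det' by simp
    ultimately have "eta_law b' (- a) d' (- c)"
      using pos by (intro less.hyps)
    then show ?thesis by (rule eta_law_inverse[OF less.prems(1) pos det'])
  qed
  from eta_law_shift[OF less.prems(1) this, of n] show ?case
    by (simp add: d'(1)[symmetric] b'_def)
qed

lemma log_eta_moeb:
  assumes "c > 0" "a * d - b * c = 1" "\<tau> \<in> uhp"
  shows "log_eta (moeb a b c d \<tau>) = log_eta \<tau> + Ln (aff c d \<tau>) / 2
    + tpi * of_real (eta_phase (a + d) d c)"
  using eta_law_holds[OF assms(1,2)] assms moeb_in_uhp[OF assms(3,2)]
  by (simp add: eta_law_def log_eta_eq_Leta)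

lemma eta_phase_24:
  assumes "c > 0" "a * d - b * c = 1"
  shows "24 * eta_phase (a + d) d c \<in> \<int>"
  using eta_law_holds[OF assms] by (simp add: eta_law_def)


section \<open>Covers and the slash action\<close>

unbundle no fps_syntax

lemma mat2_nth [simp]:
  "mat2 a b c d $ 1 $ 1 = a" "mat2 a b c d $ 1 $ 2 = b"
  "mat2 a b c d $ 2 $ 1 = c" "mat2 a b c d $ 2 $ 2 = d"
  by (simp_all add: mat2_def)

lemma mat2_eqI:
  fixes A B :: "real ^ 2 ^ 2"
  assumes "A $ 1 $ 1 = B $ 1 $ 1" "A $ 1 $ 2 = B $ 1 $ 2" "A $ 2 $ 1 = B $ 2 $ 1" "A $ 2 $ 2 = B $ 2 $ 2"
  shows "A = B"
  using assms by (simp add: vec_eq_iff forall_2)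

lemma matrix_mult_nth_2:
  fixes A B :: "real ^ 2 ^ 2"
  shows "(A ** B) $ i $ j = A $ i $ 1 * B $ 1 $ j + A $ i $ 2 * B $ 2 $ j"
  by (simp add: matrix_matrix_mult_def sum_2)

lemma mat_1_nth_2 [simp]:
  "(mat 1 :: real ^ 2 ^ 2) $ 1 $ 1 = 1" "(mat 1 :: real ^ 2 ^ 2) $ 1 $ 2 = 0"
  "(mat 1 :: real ^ 2 ^ 2) $ 2 $ 1 = 0" "(mat 1 :: real ^ 2 ^ 2) $ 2 $ 2 = 1"
  by (simp_all add: mat_def)

lemma SL2R_iff: "M \<in> carrier SL2R \<longleftrightarrow> M $ 1 $ 1 * M $ 2 $ 2 - M $ 1 $ 2 * M $ 2 $ 1 = 1"
  by (simp add: SL2R_def det_2)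

definition adj2 :: "real ^ 2 ^ 2 \<Rightarrow> real ^ 2 ^ 2" where
  "adj2 M = mat2 (M $ 2 $ 2) (- (M $ 1 $ 2)) (- (M $ 2 $ 1)) (M $ 1 $ 1)"

lemma adj2_SL2R:
  assumes "M \<in> carrier SL2R"
  shows "adj2 M \<in> carrier SL2R" "adj2 M ** M = mat 1"
  using assms by (auto simp: SL2R_iff adj2_def matrix_mult_nth_2 algebra_simps intro!: mat2_eqI)

lemma group_SL2R: "group SL2R"
proof (rule groupI)
  show "x \<otimes>\<^bsub>SL2R\<^esub> y \<in> carrier SL2R" if "x \<in> carrier SL2R" "y \<in> carrier SL2R" for x y
    using that by (simp add: SL2R_def det_mul)
  show "\<exists>y\<in>carrier SL2R. y \<otimes>\<^bsub>SL2R\<^esub> x = \<one>\<^bsub>SL2R\<^esub>" if "x \<in> carrier SL2R" for x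
    using adj2_SL2R[OF that] by (auto simp: SL2R_def)
qed (auto simp: SL2R_def matrix_mul_assoc)

lemma inv_SL2R: "M \<in> carrier SL2R \<Longrightarrow> inv\<^bsub>SL2R\<^esub> M = adj2 M"
  using group.inv_equality[OF group_SL2R, of "adj2 M" M] adj2_SL2R[of M]
  by (simp add: SL2R_def)

lemma mult_SL2R: "x \<otimes>\<^bsub>SL2R\<^esub> y = x ** y"
  by (simp add: SL2R_def)

lemma SL2R_mult: "A \<in> carrier SL2R \<Longrightarrow> B \<in> carrier SL2R \<Longrightarrow> A ** B \<in> carrier SL2R"
  by (simp add: SL2R_def det_mul)

lemma mat_1_SL2R: "mat 1 \<in> carrier SL2R"
  by (simp add: SL2R_def)

abbreviation imat :: "int \<Rightarrow> int \<Rightarrow> int \<Rightarrow> int \<Rightarrow> real ^ 2 ^ 2" where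
  "imat a b c d \<equiv> mat2 (of_int a) (of_int b) (of_int c) (of_int d)"

lemma imat_SL2R:
  assumes "a * d - b * c = 1"
  shows "imat a b c d \<in> carrier SL2R"
proof -
  have "real_of_int a * of_int d - of_int b * of_int c = of_int (a * d - b * c)" by simp
  then show ?thesis using assms by (simp add: SL2R_iff)
qed

lemma imat_SL2Z: "a * d - b * c = 1 \<Longrightarrow> imat a b c d \<in> SL2Z"
  using imat_SL2R by (auto simp: SL2Z_def forall_2)

lemma SL2Z_cases:
  assumes "M \<in> SL2Z"
  obtains a b c d where "M = imat a b c d" "a * d - b * c = 1"
proof -
  have "\<forall>i j. M $ i $ j \<in> \<int>" using assms by (simp add: SL2Z_def)
  then obtain a b c d :: int where e: "M $ 1 $ 1 = of_int a" "M $ 1 $ 2 = of_int b"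
    "M $ 2 $ 1 = of_int c" "M $ 2 $ 2 = of_int d"
    by (metis Ints_cases)
  have "real_of_int (a * d - b * c) = 1"
    using assms e by (simp add: SL2Z_def SL2R_iff)
  then have "a * d - b * c = 1" by linarith
  moreover have "M = imat a b c d" by (rule mat2_eqI) (simp_all add: e)
  ultimately show ?thesis using that by blast
qed

lemma imat_mult: "imat a b c d ** imat a' b' c' d' =
    imat (a * a' + b * c') (a * b' + b * d') (c * a' + d * c') (c * b' + d * d')"
  by (rule mat2_eqI) (simp_all add: matrix_mult_nth_2)

lemma adj2_imat: "adj2 (imat a b c d) = imat d (- b) (- c) a"
  by (simp add: adj2_def)

lemma imat_Gamma0_iff:
  "imat a b c d \<in> Gamma0 p \<longleftrightarrow> imat a b c d \<in> SL2Z \<and> int p dvd c"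
proof -
  have "(\<exists>m::int. real_of_int c = of_int (int p * m)) \<longleftrightarrow> int p dvd c"
    unfolding of_int_eq_iff by (auto simp: dvd_def)
  then show ?thesis by (simp add: Gamma0_def)
qed

lemma subgroup_SL2Z: "subgroup SL2Z SL2R"
proof (rule group.subgroupI[OF group_SL2R])
  show "SL2Z \<subseteq> carrier SL2R" by (auto simp: SL2Z_def)
  have "imat 1 0 0 1 \<in> SL2Z" by (rule imat_SL2Z) simp
  then show "SL2Z \<noteq> {}" by blast
  fix x assume x: "x \<in> SL2Z"
  then obtain a b c d where abcd: "x = imat a b c d" "a * d - b * c = 1" by (rule SL2Z_cases)
  have "imat d (- b) (- c) a \<in> SL2Z" by (rule imat_SL2Z) (use abcd in \<open>simp add: mult.commute\<close>)
  then show "inv\<^bsub>SL2R\<^esub> x \<in> SL2Z"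
    using inv_SL2R[of x] x abcd(1) adj2_imat by (simp add: SL2Z_def)
  fix y assume y: "y \<in> SL2Z"
  show "x \<otimes>\<^bsub>SL2R\<^esub> y \<in> SL2Z"
    using x y unfolding mult_SL2R by (auto simp: SL2Z_def SL2R_mult matrix_mult_nth_2)
qed

lemma Gamma0_subset: "Gamma0 p \<subseteq> SL2Z"
  by (auto simp: Gamma0_def)

lemma Gamma0_cases:
  assumes "M \<in> Gamma0 p"
  obtains a b c d where "M = imat a b c d" "a * d - b * c = 1" "int p dvd c"
  using assms SL2Z_cases[of M] Gamma0_subset[of p] by (metis imat_Gamma0_iff subsetD)

lemma imat_Gamma0: "a * d - b * c = 1 \<Longrightarrow> int p dvd c \<Longrightarrow> imat a b c d \<in> Gamma0 p"
  using imat_SL2Z imat_Gamma0_iff by blast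

lemma subgroup_Gamma0: "subgroup (Gamma0 p) SL2R"
proof (rule group.subgroupI[OF group_SL2R])
  show "Gamma0 p \<subseteq> carrier SL2R" by (auto simp: SL2Z_def Gamma0_def)
  have "imat 1 0 0 1 \<in> Gamma0 p" by (rule imat_Gamma0) simp_all
  then show "Gamma0 p \<noteq> {}" by blast
  fix x assume x: "x \<in> Gamma0 p"
  then obtain a b c d where abcd: "x = imat a b c d" "a * d - b * c = 1" "int p dvd c"
    by (rule Gamma0_cases)
  have "imat d (- b) (- c) a \<in> Gamma0 p"
    by (rule imat_Gamma0) (use abcd in \<open>simp_all add: mult.commute\<close>)
  then show "inv\<^bsub>SL2R\<^esub> x \<in> Gamma0 p"
    using inv_SL2R[of x] imat_SL2R[OF abcd(2)] abcd(1) adj2_imat by simp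
  fix y assume y: "y \<in> Gamma0 p"
  then obtain a' b' c' d' where abcd': "y = imat a' b' c' d'" "a' * d' - b' * c' = 1" "int p dvd c'"
    by (rule Gamma0_cases)
  have "x \<otimes>\<^bsub>SL2R\<^esub> y \<in> SL2Z"
    using subgroup.m_closed[OF subgroup_SL2Z] x y Gamma0_subset by blast
  then show "x \<otimes>\<^bsub>SL2R\<^esub> y \<in> Gamma0 p"
    unfolding mult_SL2R abcd abcd' imat_mult imat_Gamma0_iff using abcd(3) abcd'(3) by simp
qed

text \<open>The map only labels elements: equal labels imply equal right cosets, so there are no
  more cosets than labels. The labels used are the lower row modulo p and the value of a
  character.\<close>

lemma finite_index_subgroupI:
  fixes \<phi> :: "'a \<Rightarrow> 'c"
  assumes "group K" "subgroup H K" "finite F" "\<phi> ` carrier K \<subseteq> F"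
    and "\<And>x y. x \<in> carrier K \<Longrightarrow> y \<in> carrier K \<Longrightarrow> \<phi> x = \<phi> y \<Longrightarrow> x \<otimes>\<^bsub>K\<^esub> inv\<^bsub>K\<^esub> y \<in> H"
  shows "finite_index_subgroup H K"
proof -
  interpret group K by fact
  interpret H: subgroup H K by fact
  define rep where "rep v = (SOME x. x \<in> carrier K \<and> \<phi> x = v)" for v
  have "rcosets\<^bsub>K\<^esub> H \<subseteq> (\<lambda>v. H #>\<^bsub>K\<^esub> rep v) ` F"
  proof
    fix C assume "C \<in> rcosets\<^bsub>K\<^esub> H"
    then obtain x where x: "x \<in> carrier K" "C = H #>\<^bsub>K\<^esub> x" by (auto simp: RCOSETS_def)
    have "rep (\<phi> x) \<in> carrier K \<and> \<phi> (rep (\<phi> x)) = \<phi> x"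
      unfolding rep_def by (rule someI[of _ x]) (use x in simp)
    then have r: "rep (\<phi> x) \<in> carrier K" "x \<otimes>\<^bsub>K\<^esub> inv\<^bsub>K\<^esub> rep (\<phi> x) \<in> H"
      using assms(5) x by auto
    then have "x \<otimes>\<^bsub>K\<^esub> inv\<^bsub>K\<^esub> rep (\<phi> x) \<otimes>\<^bsub>K\<^esub> rep (\<phi> x) \<in> H #>\<^bsub>K\<^esub> rep (\<phi> x)"
      using H.subset by (intro rcosI) auto
    then have "x \<in> H #>\<^bsub>K\<^esub> rep (\<phi> x)"
      using r x by (simp add: m_assoc)
    then have "H #>\<^bsub>K\<^esub> rep (\<phi> x) = C"
      using repr_independence[OF _ r(1) assms(2)] x by simp
    then show "C \<in> (\<lambda>v. H #>\<^bsub>K\<^esub> rep v) ` F" using x assms(4) by auto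
  qed
  then show ?thesis
    using assms(2) finite_subset[OF _ finite_imageI[OF assms(3)]]
    by (simp add: finite_index_subgroup_def)
qed

text \<open>The lower left entry of x y^(-1) is c d' - d c', which vanishes modulo p when the lower
  rows of x and y agree modulo p.\<close>

lemma finite_index_Gamma0:
  assumes "p > 0"
  shows "finite_index_subgroup (Gamma0 p) (SL2R\<lparr>carrier := SL2Z\<rparr>)"
proof (rule finite_index_subgroupI)
  interpret group SL2R by (rule group_SL2R)
  show "group (SL2R\<lparr>carrier := SL2Z\<rparr>)"
    by (rule subgroup.subgroup_is_group[OF subgroup_SL2Z group_SL2R])
  show "subgroup (Gamma0 p) (SL2R\<lparr>carrier := SL2Z\<rparr>)"
    by (rule subgroup_incl[OF subgroup_Gamma0 subgroup_SL2Z Gamma0_subset])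
  let ?\<phi> = "\<lambda>M :: real ^ 2 ^ 2. (\<lfloor>M $ 2 $ 1\<rfloor> mod int p, \<lfloor>M $ 2 $ 2\<rfloor> mod int p)"
  show "finite ({0..<int p} \<times> {0..<int p})" by simp
  show "?\<phi> ` carrier (SL2R\<lparr>carrier := SL2Z\<rparr>) \<subseteq> {0..<int p} \<times> {0..<int p}"
    using assms by auto
  fix x y
  assume xy: "x \<in> carrier (SL2R\<lparr>carrier := SL2Z\<rparr>)" "y \<in> carrier (SL2R\<lparr>carrier := SL2Z\<rparr>)" "?\<phi> x = ?\<phi> y"
  obtain a b c d where x: "x = imat a b c d" "a * d - b * c = 1"
    using xy(1) by (auto elim: SL2Z_cases)
  obtain a' b' c' d' where y: "y = imat a' b' c' d'" "a' * d' - b' * c' = 1"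
    using xy(2) by (auto elim: SL2Z_cases)
  have "inv\<^bsub>SL2R\<lparr>carrier := SL2Z\<rparr>\<^esub> y = adj2 y"
    using m_inv_consistent[OF subgroup_SL2Z] xy(2) inv_SL2R[of y] imat_SL2R[OF y(2)] y(1) by simp
  then have eq: "x \<otimes>\<^bsub>SL2R\<lparr>carrier := SL2Z\<rparr>\<^esub> inv\<^bsub>SL2R\<lparr>carrier := SL2Z\<rparr>\<^esub> y =
      imat (a * d' + b * - c') (a * - b' + b * a') (c * d' + d * - c') (c * - b' + d * a')"
    by (simp only: SL2R_def monoid.simps partial_object.simps x(1) y(1) adj2_imat imat_mult)
  have "[c = c'] (mod int p)" "[d = d'] (mod int p)"
    using xy(3) by (simp_all add: x y cong_def)
  then have "[c * d' + d * - c' = c' * d + d * - c'] (mod int p)"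
    by (intro cong_add cong_mult) (auto simp: cong_sym)
  then have "int p dvd c * d' + d * - c'"
    by (simp add: cong_0_iff mult.commute)
  moreover have "(a * d' + b * - c') * (c * - b' + d * a') - (a * - b' + b * a') * (c * d' + d * - c')
      = (a * d - b * c) * (a' * d' - b' * c')" by algebra
  ultimately show "x \<otimes>\<^bsub>SL2R\<lparr>carrier := SL2Z\<rparr>\<^esub> inv\<^bsub>SL2R\<lparr>carrier := SL2Z\<rparr>\<^esub> y \<in> Gamma0 p"
    unfolding eq using x y by (intro imat_Gamma0) auto
qed

section \<open>The automorphy factor, its logarithm and the group law of the cover\<close>

lemma autom_factor_nonzero:
  assumes "M \<in> carrier SL2R" "\<tau> \<in> uhp"
  shows "autom_factor M \<tau> \<noteq> 0"
  using assms by (auto simp: autom_factor_def SL2R_iff uhp_def complex_eq_iff)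

lemma moebius_in_uhp:
  assumes "M \<in> carrier SL2R" "\<tau> \<in> uhp"
  shows "moebius M \<tau> \<in> uhp"
proof -
  define a b c d where "a = M $ 1 $ 1" and "b = M $ 1 $ 2" and "c = M $ 2 $ 1" and "d = M $ 2 $ 2"
  have det: "a * d - b * c = 1" using assms(1) by (simp add: SL2R_iff a_def b_def c_def d_def)
  have nz: "of_real c * \<tau> + of_real d \<noteq> 0"
    using autom_factor_nonzero[OF assms] by (simp add: autom_factor_def c_def d_def)
  have "Im (moebius M \<tau>) =
      (a * Im \<tau> * (c * Re \<tau> + d) - (a * Re \<tau> + b) * (c * Im \<tau>)) / (norm (of_real c * \<tau> + of_real d))\<^sup>2"
    by (simp add: moebius_def Im_divide cmod_power2 a_def b_def c_def d_def)
  also have "a * Im \<tau> * (c * Re \<tau> + d) - (a * Re \<tau> + b) * (c * Im \<tau>) = (a * d - b * c) * Im \<tau>"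
    by (simp add: algebra_simps)
  finally show ?thesis using det nz assms(2) by (simp add: uhp_def)
qed

lemma autom_factor_mult:
  assumes "B \<in> carrier SL2R" "\<tau> \<in> uhp"
  shows "autom_factor (A ** B) \<tau> = autom_factor A (moebius B \<tau>) * autom_factor B \<tau>"
    and "moebius (A ** B) \<tau> = moebius A (moebius B \<tau>)"
proof -
  define j where "j = of_real (B $ 2 $ 1) * \<tau> + of_real (B $ 2 $ 2)"
  have nz: "j \<noteq> 0"
    using autom_factor_nonzero[OF assms] by (simp add: autom_factor_def j_def)
  have m: "moebius B \<tau> = (of_real (B $ 1 $ 1) * \<tau> + of_real (B $ 1 $ 2)) / j"
    by (simp add: moebius_def j_def)
  have l: "of_real x * moebius B \<tau> + of_real y =
      (of_real (x * B $ 1 $ 1 + y * B $ 2 $ 1) * \<tau> + of_real (x * B $ 1 $ 2 + y * B $ 2 $ 2)) / j"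
    for x y
    unfolding m using nz by (simp add: field_simps) (simp add: j_def algebra_simps)
  show "autom_factor (A ** B) \<tau> = autom_factor A (moebius B \<tau>) * autom_factor B \<tau>"
    unfolding autom_factor_def l matrix_mult_nth_2 j_def[symmetric] using nz by simp
  show "moebius (A ** B) \<tau> = moebius A (moebius B \<tau>)"
    unfolding moebius_def[of A] l moebius_def[of "A ** B"] matrix_mult_nth_2 using nz by simp
qed

lemma moebius_mat_1 [simp]: "moebius (mat 1) \<tau> = \<tau>" "autom_factor (mat 1) \<tau> = 1"
  by (simp_all add: moebius_def autom_factor_def)

lemma continuous_autom_factor: "continuous_on A (autom_factor M)"
  unfolding autom_factor_def by (intro continuous_intros)

text \<open>For c = 0 the factor may be negative and lie on the cut, but it is constant; for c
  different from 0 it is never real.\<close>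

lemma continuous_Ln_autom_factor:
  assumes "M \<in> carrier SL2R"
  shows "continuous_on uhp (\<lambda>\<tau>. Ln (autom_factor M \<tau>))"
proof (cases "M $ 2 $ 1 = 0")
  case True
  then show ?thesis by (simp add: autom_factor_def)
next
  case False
  then have "autom_factor M \<tau> \<notin> \<real>\<^sub>\<le>\<^sub>0" if "\<tau> \<in> uhp" for \<tau>
    using that by (auto simp: autom_factor_def complex_nonpos_Reals_iff uhp_def)
  then show ?thesis
    by (auto intro!: continuous_on_Ln' continuous_autom_factor)
qed

lemma continuous_moebius:
  assumes "M \<in> carrier SL2R"
  shows "continuous_on uhp (moebius M)"
  unfolding moebius_def using autom_factor_nonzero[OF assms]
  by (intro continuous_intros) (auto simp: autom_factor_def)

text \<open>Exponentiating shows that the two sides differ by an integer multiple of 2 pi i. That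
  integer depends continuously on tau, and the upper half plane is connected, so a single integer
  serves for all tau.\<close>

lemma Ln_cocycle:
  assumes "A \<in> carrier SL2R" "B \<in> carrier SL2R"
  obtains w :: int where "\<And>\<tau>. \<tau> \<in> uhp \<Longrightarrow>
    Ln (autom_factor A (moebius B \<tau>)) + Ln (autom_factor B \<tau>) =
    Ln (autom_factor (A ** B) \<tau>) + tpi * of_int w"
proof -
  define h where "h \<tau> = (Ln (autom_factor A (moebius B \<tau>)) + Ln (autom_factor B \<tau>) -
    Ln (autom_factor (A ** B) \<tau>)) / (tpi)" for \<tau>
  have cont: "continuous_on uhp h"
    unfolding h_def
    by (intro continuous_intros continuous_Ln_autom_factor assms SL2R_mult
      continuous_on_compose2[OF continuous_Ln_autom_factor[OF assms(1)] continuous_moebius[OF assms(2)]])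
      (use moebius_in_uhp[OF assms(2)] in auto)
  have int: "\<exists>w::int. h \<tau> = of_int w" if "\<tau> \<in> uhp" for \<tau>
  proof -
    have "exp (Ln (autom_factor A (moebius B \<tau>)) + Ln (autom_factor B \<tau>)) = exp (Ln (autom_factor (A ** B) \<tau>))"
      using autom_factor_nonzero assms that moebius_in_uhp[OF assms(2) that] SL2R_mult
      by (simp add: exp_add autom_factor_mult)
    then obtain w :: int where "Ln (autom_factor A (moebius B \<tau>)) + Ln (autom_factor B \<tau>) =
        Ln (autom_factor (A ** B) \<tau>) + of_int (2 * w) * of_real pi * \<i>"
      unfolding exp_eq by auto
    then have "h \<tau> = of_int w" by (simp add: h_def)
    then show ?thesis ..
  qed
  have "h constant_on uhp"
  proof (rule continuous_discrete_range_constant[OF connected_uhp cont])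
    fix x assume x: "x \<in> uhp"
    have "1 \<le> norm (h y - h x)" if y: "y \<in> uhp" "h y \<noteq> h x" for y
    proof -
      obtain w w' :: int where w: "h x = of_int w" "h y = of_int w'" using int x y by blast
      then have "norm (h y - h x) = \<bar>of_int (w' - w)\<bar>"
        by (metis norm_of_int of_int_diff)
      moreover have "\<bar>w' - w\<bar> \<ge> 1" using w y by auto
      ultimately show ?thesis by linarith
    qed
    then show "\<exists>r>0. \<forall>y. y \<in> uhp \<and> h y \<noteq> h x \<longrightarrow> r \<le> norm (h y - h x)"
      by (intro exI[of _ 1]) auto
  qed
  then obtain c where c: "\<And>\<tau>. \<tau> \<in> uhp \<Longrightarrow> h \<tau> = c" by (auto simp: constant_on_def)
  obtain w :: int where "h \<i> = of_int w" using int[of \<i>] by auto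
  then have w: "h \<tau> = of_int w" if "\<tau> \<in> uhp" for \<tau> using c[of \<i>] c[OF that] by simp
  show ?thesis
  proof (rule that)
    fix \<tau> assume "\<tau> \<in> uhp"
    from w[OF this] show "Ln (autom_factor A (moebius B \<tau>)) + Ln (autom_factor B \<tau>) =
      Ln (autom_factor (A ** B) \<tau>) + tpi * of_int w"
      unfolding h_def by (simp add: divide_eq_eq algebra_simps)
  qed
qed

lemma powr_autom_factor:
  assumes "M \<in> carrier SL2R" "\<tau> \<in> uhp"
  shows "autom_factor M \<tau> powr x = exp (x * Ln (autom_factor M \<tau>))"
  using autom_factor_nonzero[OF assms] by (simp add: powr_def)

lemma cover_elt_inj:
  assumes "M \<in> carrier SL2R" "cover_elt D M \<epsilon> = cover_elt D M \<delta>"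
  shows "\<epsilon> = \<delta>"
proof -
  have "restrict (\<lambda>\<tau>. \<epsilon> * autom_factor M \<tau> powr (1 / of_nat D)) uhp \<i> =
      restrict (\<lambda>\<tau>. \<delta> * autom_factor M \<tau> powr (1 / of_nat D)) uhp \<i>"
    using assms(2) by (simp add: cover_elt_def)
  then show ?thesis
    using autom_factor_nonzero[OF assms(1) ii_in_uhp] by (simp add: powr_def)
qed

lemma fst_cover_elt [simp]: "fst (cover_elt D M \<epsilon>) = M"
  by (simp add: cover_elt_def)

lemma cover_root_cover_elt [simp]:
  assumes "M \<in> carrier SL2R"
  shows "cover_root D (cover_elt D M \<epsilon>) = \<epsilon>"
  unfolding cover_root_def using cover_elt_inj[OF assms] by (intro the_equality) auto

lemma SL2R_cover_cases:
  assumes "g \<in> carrier (SL2R_cover D)"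
  obtains M \<epsilon> where "g = cover_elt D M \<epsilon>" "M \<in> carrier SL2R" "\<epsilon> ^ D = 1"
  using assms by (auto simp: SL2R_cover_def)

lemma cover_elt_in_carrier: "M \<in> carrier SL2R \<Longrightarrow> \<epsilon> ^ D = 1 \<Longrightarrow> cover_elt D M \<epsilon> \<in> carrier (SL2R_cover D)"
  by (auto simp: SL2R_cover_def)

text \<open>The integer of the logarithmic cocycle turns into a D-th root of unity, so the product
  again has the standard form.\<close>

lemma cover_elt_mult:
  assumes "A \<in> carrier SL2R" "B \<in> carrier SL2R"
    and w: "\<And>\<tau>. \<tau> \<in> uhp \<Longrightarrow> Ln (autom_factor A (moebius B \<tau>)) + Ln (autom_factor B \<tau>) =
      Ln (autom_factor (A ** B) \<tau>) + tpi * of_int w"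
  shows "cover_elt D A \<epsilon> \<otimes>\<^bsub>SL2R_cover D\<^esub> cover_elt D B \<delta> =
    cover_elt D (A ** B) (\<epsilon> * \<delta> * exp (tpi * of_int w / of_nat D))"
proof -
  have "\<epsilon> * autom_factor A (moebius B \<tau>) powr (1 / of_nat D) * (\<delta> * autom_factor B \<tau> powr (1 / of_nat D)) =
      \<epsilon> * \<delta> * exp (tpi * of_int w / of_nat D) * autom_factor (A ** B) \<tau> powr (1 / of_nat D)"
    if \<tau>: "\<tau> \<in> uhp" for \<tau>
  proof -
    have "exp (1 / of_nat D * Ln (autom_factor A (moebius B \<tau>))) * exp (1 / of_nat D * Ln (autom_factor B \<tau>)) =
        exp (1 / of_nat D * (Ln (autom_factor A (moebius B \<tau>)) + Ln (autom_factor B \<tau>)))"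
      by (simp only: exp_add distrib_left)
    also have "\<dots> = exp (tpi * of_int w / of_nat D) * exp (1 / of_nat D * Ln (autom_factor (A ** B) \<tau>))"
      unfolding w[OF \<tau>] by (simp only: exp_add[symmetric]) (simp add: add_divide_distrib add.commute)
    finally show ?thesis
      using assms \<tau> by (simp add: powr_autom_factor moebius_in_uhp SL2R_mult mult_ac)
  qed
  then show ?thesis
    using moebius_in_uhp[OF assms(2)]
    by (auto simp: SL2R_cover_def cover_elt_def restrict_def fun_eq_iff)
qed

lemma exp_root_of_unity: "D > 0 \<Longrightarrow> exp (tpi * of_int w / of_nat D) ^ D = 1"
  by (simp add: exp_of_nat_mult[symmetric] exp_eq_1 mult.commute)

lemma one_SL2R_cover: "\<one>\<^bsub>SL2R_cover D\<^esub> = cover_elt D (mat 1) 1"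
  by (auto simp: SL2R_cover_def cover_elt_def restrict_def fun_eq_iff)

lemma group_SL2R_cover:
  assumes "D > 0"
  shows "group (SL2R_cover D)"
proof (rule groupI)
  show "x \<otimes>\<^bsub>SL2R_cover D\<^esub> y \<in> carrier (SL2R_cover D)"
    if x: "x \<in> carrier (SL2R_cover D)" and y: "y \<in> carrier (SL2R_cover D)" for x y
  proof -
    obtain A \<epsilon> where A: "x = cover_elt D A \<epsilon>" "A \<in> carrier SL2R" "\<epsilon> ^ D = 1"
      using x by (rule SL2R_cover_cases)
    obtain B \<delta> where B: "y = cover_elt D B \<delta>" "B \<in> carrier SL2R" "\<delta> ^ D = 1"
      using y by (rule SL2R_cover_cases)
    obtain w where "\<And>\<tau>. \<tau> \<in> uhp \<Longrightarrow> Ln (autom_factor A (moebius B \<tau>)) + Ln (autom_factor B \<tau>) =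
      Ln (autom_factor (A ** B) \<tau>) + tpi * of_int w"
      by (rule Ln_cocycle[OF A(2) B(2)]) blast
    from cover_elt_mult[OF A(2) B(2) this, of D \<epsilon> \<delta>] show ?thesis
      using A B assms exp_root_of_unity[OF assms, of w]
      by (simp add: cover_elt_in_carrier SL2R_mult power_mult_distrib)
  qed
  show "\<one>\<^bsub>SL2R_cover D\<^esub> \<in> carrier (SL2R_cover D)"
    unfolding one_SL2R_cover by (rule cover_elt_in_carrier) (auto simp: mat_1_SL2R)
  show "x \<otimes>\<^bsub>SL2R_cover D\<^esub> y \<otimes>\<^bsub>SL2R_cover D\<^esub> z = x \<otimes>\<^bsub>SL2R_cover D\<^esub> (y \<otimes>\<^bsub>SL2R_cover D\<^esub> z)"
    if "x \<in> carrier (SL2R_cover D)" "y \<in> carrier (SL2R_cover D)" "z \<in> carrier (SL2R_cover D)" for x y z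
    using that
    by (auto simp: SL2R_cover_def cover_elt_def fun_eq_iff matrix_mul_assoc moebius_in_uhp autom_factor_mult)
  show one: "\<one>\<^bsub>SL2R_cover D\<^esub> \<otimes>\<^bsub>SL2R_cover D\<^esub> x = x" if "x \<in> carrier (SL2R_cover D)" for x
    using that by (auto simp: SL2R_cover_def cover_elt_def fun_eq_iff moebius_in_uhp)
  show "\<exists>y\<in>carrier (SL2R_cover D). y \<otimes>\<^bsub>SL2R_cover D\<^esub> x = \<one>\<^bsub>SL2R_cover D\<^esub>"
    if x: "x \<in> carrier (SL2R_cover D)" for x
  proof -
    obtain A \<epsilon> where A: "x = cover_elt D A \<epsilon>" "A \<in> carrier SL2R" "\<epsilon> ^ D = 1"
      using x by (rule SL2R_cover_cases)
    obtain w where w: "\<And>\<tau>. \<tau> \<in> uhp \<Longrightarrow> Ln (autom_factor (adj2 A) (moebius A \<tau>)) + Ln (autom_factor A \<tau>) =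
      Ln (autom_factor (adj2 A ** A) \<tau>) + tpi * of_int w"
      by (rule Ln_cocycle[OF adj2_SL2R(1)[OF A(2)] A(2)]) blast
    define u where "u = exp (tpi * of_int w / of_nat D)"
    have u: "u ^ D = 1" "u \<noteq> 0" "\<epsilon> \<noteq> 0"
      using exp_root_of_unity[OF assms] A(3) assms by (auto simp: u_def power_0_left)
    have "cover_elt D (adj2 A) (1 / (\<epsilon> * u)) \<otimes>\<^bsub>SL2R_cover D\<^esub> x = \<one>\<^bsub>SL2R_cover D\<^esub>"
      using cover_elt_mult[OF adj2_SL2R(1)[OF A(2)] A(2) w, of D "1 / (\<epsilon> * u)" \<epsilon>] u A
      unfolding one_SL2R_cover by (simp add: u_def[symmetric] adj2_SL2R(2))
    moreover have "cover_elt D (adj2 A) (1 / (\<epsilon> * u)) \<in> carrier (SL2R_cover D)"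
      using u A adj2_SL2R(1) by (intro cover_elt_in_carrier) (auto simp: power_divide power_mult_distrib)
    ultimately show ?thesis by blast
  qed
qed

lemma fst_mult_cover: "fst (x \<otimes>\<^bsub>SL2R_cover D\<^esub> y) = fst x ** fst y"
  by (simp add: SL2R_cover_def case_prod_unfold)

lemma fst_inv_cover:
  assumes "D > 0" "x \<in> carrier (SL2R_cover D)"
  shows "fst (inv\<^bsub>SL2R_cover D\<^esub> x) = inv\<^bsub>SL2R\<^esub> (fst x)"
proof -
  interpret group "SL2R_cover D" by (rule group_SL2R_cover[OF assms(1)])
  have c: "fst y \<in> carrier SL2R" if "y \<in> carrier (SL2R_cover D)" for y
    using that by (auto elim!: SL2R_cover_cases)
  have "fst (inv\<^bsub>SL2R_cover D\<^esub> x) ** fst x = mat 1"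
    using l_inv[OF assms(2)] one_SL2R_cover[of D] by (simp add: fst_mult_cover[of D, symmetric])
  then show ?thesis
    using group.inv_equality[OF group_SL2R, of "fst (inv\<^bsub>SL2R_cover D\<^esub> x)" "fst x"] c assms
    by (simp add: SL2R_def)
qed

lemma subgroup_cover_preimage:
  assumes "D > 0" "subgroup G SL2R"
  shows "subgroup (cover_preimage D G) (SL2R_cover D)"
proof (rule group.subgroupI[OF group_SL2R_cover[OF assms(1)]])
  interpret group "SL2R_cover D" by (rule group_SL2R_cover[OF assms(1)])
  show "cover_preimage D G \<subseteq> carrier (SL2R_cover D)" by (auto simp: cover_preimage_def)
  have "fst \<one>\<^bsub>SL2R_cover D\<^esub> = \<one>\<^bsub>SL2R\<^esub>"
    by (simp add: one_SL2R_cover) (simp add: SL2R_def)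
  then have "\<one>\<^bsub>SL2R_cover D\<^esub> \<in> cover_preimage D G"
    using subgroup.one_closed[OF assms(2)] by (simp add: cover_preimage_def)
  then show "cover_preimage D G \<noteq> {}" by blast
  fix x assume x: "x \<in> cover_preimage D G"
  then show "inv\<^bsub>SL2R_cover D\<^esub> x \<in> cover_preimage D G"
    using subgroup.m_inv_closed[OF assms(2)] fst_inv_cover[OF assms(1), of x]
    by (auto simp: cover_preimage_def)
  fix y assume "y \<in> cover_preimage D G"
  with x show "x \<otimes>\<^bsub>SL2R_cover D\<^esub> y \<in> cover_preimage D G"
    using subgroup.m_closed[OF assms(2), of "fst x" "fst y"]
    by (auto simp: cover_preimage_def fst_mult_cover mult_SL2R)
qed

lemma slash_cover_elt:
  assumes "M \<in> carrier SL2R" "\<tau> \<in> uhp"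
  shows "slash D k f (cover_elt D M \<epsilon>) \<tau> =
    \<epsilon> powi (- \<lfloor>real D * k\<rfloor>) * exp (- of_real k * Ln (autom_factor M \<tau>)) * f (moebius M \<tau>)"
  using assms by (simp add: slash_def powr_autom_factor)

lemma exp_powi: "exp z powi n = exp (of_int n * z)" for z :: complex
  by (simp add: power_int_def exp_of_nat_mult[symmetric] exp_minus[symmetric])

text \<open>The root of unity in the product, raised to the power -D k, is exp(-2 pi i k w), exactly
  the defect of the principal powers of weight k. The integrality of D k is used here.\<close>

lemma slash_mult:
  assumes "D > 0" "real D * k \<in> \<int>" "g \<in> carrier (SL2R_cover D)" "h \<in> carrier (SL2R_cover D)" "\<tau> \<in> uhp"
  shows "slash D k f (g \<otimes>\<^bsub>SL2R_cover D\<^esub> h) \<tau> = slash D k (slash D k f g) h \<tau>"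
proof -
  obtain A \<epsilon> where A: "g = cover_elt D A \<epsilon>" "A \<in> carrier SL2R" "\<epsilon> ^ D = 1"
    using assms(3) by (rule SL2R_cover_cases)
  obtain B \<delta> where B: "h = cover_elt D B \<delta>" "B \<in> carrier SL2R" "\<delta> ^ D = 1"
    using assms(4) by (rule SL2R_cover_cases)
  obtain w where w: "\<And>\<tau>. \<tau> \<in> uhp \<Longrightarrow> Ln (autom_factor A (moebius B \<tau>)) + Ln (autom_factor B \<tau>) =
    Ln (autom_factor (A ** B) \<tau>) + tpi * of_int w"
    by (rule Ln_cocycle[OF A(2) B(2)]) blast
  obtain n where n: "real D * k = of_int n" using assms(2) by (auto elim: Ints_cases)
  have k: "k = of_int n / real D" using n assms(1) by (simp add: field_simps)
  have *: "exp (- of_real k * Ln (autom_factor A (moebius B \<tau>))) * exp (- of_real k * Ln (autom_factor B \<tau>)) =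
      exp (tpi * of_int w / of_nat D) powi (- n) * exp (- of_real k * Ln (autom_factor (A ** B) \<tau>))"
  proof -
    have "exp (- of_real k * Ln (autom_factor A (moebius B \<tau>))) * exp (- of_real k * Ln (autom_factor B \<tau>)) =
        exp (- of_real k * (Ln (autom_factor A (moebius B \<tau>)) + Ln (autom_factor B \<tau>)))"
      by (simp only: exp_add distrib_left)
    also have "\<dots> = exp (of_int (- n) * (tpi * of_int w / of_nat D)) *
        exp (- of_real k * Ln (autom_factor (A ** B) \<tau>))"
      unfolding w[OF assms(5)] by (simp only: exp_add[symmetric]) (simp add: k algebra_simps)
    finally show ?thesis by (simp only: exp_powi)
  qed
  have "slash D k f (g \<otimes>\<^bsub>SL2R_cover D\<^esub> h) \<tau> =
      (\<epsilon> * \<delta> * exp (tpi * of_int w / of_nat D)) powi (- n) *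
      exp (- of_real k * Ln (autom_factor (A ** B) \<tau>)) * f (moebius A (moebius B \<tau>))"
    using assms A B by (simp add: cover_elt_mult[OF A(2) B(2) w] slash_cover_elt SL2R_mult n autom_factor_mult)
  also have "\<dots> = \<epsilon> powi (- n) * \<delta> powi (- n) *
      (exp (- of_real k * Ln (autom_factor A (moebius B \<tau>))) * exp (- of_real k * Ln (autom_factor B \<tau>))) *
      f (moebius A (moebius B \<tau>))"
    unfolding * by (simp add: power_int_mult_distrib mult_ac)
  also have "\<dots> = slash D k (slash D k f g) h \<tau>"
    using assms(5) A(2) B(2) unfolding A(1) B(1)
    by (simp add: slash_cover_elt moebius_in_uhp n)
  finally show ?thesis .
qed


section \<open>Series over the lattice\<close>

lemma summable_on_int_powr:
  assumes "s > 1"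
  shows "(\<lambda>n::int. max 1 \<bar>real_of_int n\<bar> powr (- s)) summable_on UNIV"
proof -
  have "summable (\<lambda>n. real (Suc n) powr (- s))"
    using assms by (subst summable_Suc_iff) (simp add: summable_real_powr_iff)
  then have nat: "(\<lambda>n. real (Suc n) powr (- s)) summable_on UNIV"
    by (rule summable_nonneg_imp_summable_on) simp
  define f where "f n = max 1 \<bar>real_of_int n\<bar> powr (- s)" for n
  have "f summable_on range (\<lambda>n. int (Suc n))"
    by (subst summable_on_reindex) (use nat in \<open>auto simp: inj_def o_def f_def max_def add.commute\<close>)
  moreover have "f summable_on range (\<lambda>n. - int (Suc n))"
    by (subst summable_on_reindex) (use nat in \<open>auto simp: inj_def o_def f_def max_def add.commute\<close>)
  ultimately have "f summable_on (range (\<lambda>n. int (Suc n)) \<union> range (\<lambda>n. - int (Suc n)) \<union> {0})"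
    by (intro summable_on_union) auto
  also have "range (\<lambda>n. int (Suc n)) \<union> range (\<lambda>n. - int (Suc n)) \<union> {0} = UNIV"
  proof (rule UNIV_eq_I[symmetric])
    fix n :: int
    consider "n = 0" | "n = int (Suc (nat (n - 1)))" | "n = - int (Suc (nat (- n - 1)))"
      by linarith
    then show "n \<in> range (\<lambda>n. int (Suc n)) \<union> range (\<lambda>n. - int (Suc n)) \<union> {0}"
    proof cases
      case 2
      then show ?thesis by (intro UnI1) (rule range_eqI)
    next
      case 3
      then show ?thesis by (intro UnI1 UnI2) (rule range_eqI)
    qed simp
  qed
  finally show ?thesis by (simp add: f_def[abs_def])
qed

abbreviation (input) max_abs :: "int \<Rightarrow> int \<Rightarrow> real" where
  "max_abs c d \<equiv> max \<bar>of_int c\<bar> \<bar>of_int d\<bar>"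

definition lat :: "(int \<times> int) set" where
  "lat = UNIV - {(0, 0)}"

text \<open>Giving half of the exponent to each coordinate bounds the term by a product of
  one-dimensional terms with exponent k/2 > 1.\<close>

lemma summable_on_lat:
  assumes "k > 2"
  shows "(\<lambda>(c, d). max_abs c d powr (- k)) summable_on lat"
proof (rule summable_on_comparison_test)
  have s: "k / 2 > 1" using assms by simp
  have "(\<lambda>(c, d). max 1 \<bar>real_of_int c\<bar> powr (- (k / 2)) * max 1 \<bar>real_of_int d\<bar> powr (- (k / 2)))
      summable_on (UNIV \<times> UNIV)"
    by (rule summable_on_Times_nonneg[OF summable_on_int_powr[OF s] summable_on_int_powr[OF s]]) auto
  then show "(\<lambda>(c, d). max 1 \<bar>real_of_int c\<bar> powr (- (k / 2)) * max 1 \<bar>real_of_int d\<bar> powr (- (k / 2)))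
      summable_on lat"
    by (rule summable_on_subset_banach) auto
  fix x assume "x \<in> lat"
  then obtain c d where x: "x = (c, d)" "c \<noteq> 0 \<or> d \<noteq> 0" by (cases x) (auto simp: lat_def)
  define M where "M = max_abs c d"
  have "\<bar>real_of_int c\<bar> \<ge> 1 \<or> \<bar>real_of_int d\<bar> \<ge> 1" using x(2) by linarith
  then have M: "M \<ge> 1" "max 1 \<bar>real_of_int c\<bar> \<le> M" "max 1 \<bar>real_of_int d\<bar> \<le> M"
    by (auto simp: M_def)
  have "M powr (- k) = M powr (- (k / 2)) * M powr (- (k / 2))"
    by (simp add: powr_add[symmetric])
  also have "\<dots> \<le> max 1 \<bar>real_of_int c\<bar> powr (- (k / 2)) * max 1 \<bar>real_of_int d\<bar> powr (- (k / 2))"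
    using M assms by (intro mult_mono powr_mono2') auto
  finally show "(case x of (c, d) \<Rightarrow> max_abs c d powr (- k)) \<le>
    (case x of (c, d) \<Rightarrow> max 1 \<bar>real_of_int c\<bar> powr (- (k / 2)) * max 1 \<bar>real_of_int d\<bar> powr (- (k / 2)))"
    by (simp add: x M_def)
qed (auto simp: case_prod_unfold)

lemma norm_linear_powr_le:
  assumes "y0 > 0" "R \<ge> 1" "k > 0" "Im \<tau> \<ge> y0" "\<bar>Re \<tau>\<bar> \<le> R" "(c, d) \<in> lat"
  shows "norm (aff c d \<tau>) powr (- k) \<le>
    min (1 / 2) (y0 / (2 * R)) powr (- k) * max_abs c d powr (- k)"
proof -
  have pos: "min (1 / 2) (y0 / (2 * R)) * max_abs c d > 0"
    using assms by (auto simp: lat_def max_def)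
  have "norm (aff c d \<tau>) powr (- k) \<le>
      (min (1 / 2) (y0 / (2 * R)) * max_abs c d) powr (- k)"
    using norm_linear_ge[OF assms(1,2,4,5), of "of_int c" "of_int d"] pos assms(3)
    by (intro powr_mono2') auto
  also have "\<dots> = min (1 / 2) (y0 / (2 * R)) powr (- k) * max_abs c d powr (- k)"
    by (rule powr_mult)
  finally show ?thesis .
qed

lemma uhp_compact_bounds:
  assumes "cball z r \<subseteq> uhp"
  obtains y0 R where "y0 > 0" "R \<ge> 1" "\<And>\<tau>. \<tau> \<in> cball z r \<Longrightarrow> Im \<tau> \<ge> y0 \<and> \<bar>Re \<tau>\<bar> \<le> R"
proof (cases "cball z r = {}")
  case True
  then show ?thesis using that[of 1 1] by simp
next
  case False
  have "continuous_on (cball z r) Im" by (intro continuous_intros)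
  from continuous_attains_inf[OF compact_cball False this]
  obtain w where w: "w \<in> cball z r" "\<forall>\<tau>\<in>cball z r. Im w \<le> Im \<tau>" by auto
  have "Im w > 0" using assms w(1) by (auto simp: uhp_def)
  moreover have "\<bar>Re \<tau>\<bar> \<le> max 1 (\<bar>Re z\<bar> + r)" if "\<tau> \<in> cball z r" for \<tau>
  proof -
    have "\<bar>Re \<tau> - Re z\<bar> \<le> r"
      using abs_Re_le_cmod[of "\<tau> - z"] that by (simp add: dist_norm norm_minus_commute)
    then show ?thesis by linarith
  qed
  ultimately show ?thesis using that[of "Im w" "max 1 (\<bar>Re z\<bar> + r)"] w by auto
qed

text \<open>Only the size of the terms enters, and the index set is any set of nonzero rows. The
  results therefore apply to the Eisenstein series and also to its translates under SL_2(Z), whose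
  rows are no longer normalised by sign.\<close>

locale lattice_series =
  fixes k :: real and I :: "(int \<times> int) set" and t :: "int \<times> int \<Rightarrow> complex \<Rightarrow> complex"
  assumes k: "k > 2" and I: "I \<subseteq> lat"
    and bound: "\<And>c d \<tau>. (c, d) \<in> I \<Longrightarrow> \<tau> \<in> uhp \<Longrightarrow>
      norm (t (c, d) \<tau>) \<le> norm (aff c d \<tau>) powr (- k)"
begin

lemma cball_bound:
  assumes "cball z r \<subseteq> uhp"
  obtains C where "\<And>c d \<tau>. (c, d) \<in> I \<Longrightarrow> \<tau> \<in> cball z r \<Longrightarrow>
    norm (t (c, d) \<tau>) \<le> C * max_abs c d powr (- k)"
proof -
  obtain y0 R where yR: "y0 > 0" "R \<ge> 1" "\<And>\<tau>. \<tau> \<in> cball z r \<Longrightarrow> Im \<tau> \<ge> y0 \<and> \<bar>Re \<tau>\<bar> \<le> R"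
    by (rule uhp_compact_bounds[OF assms]) blast
  show ?thesis
  proof (rule that)
    fix c d \<tau> assume *: "(c, d) \<in> I" "\<tau> \<in> cball z r"
    show "norm (t (c, d) \<tau>) \<le> min (1 / 2) (y0 / (2 * R)) powr (- k) * max_abs c d powr (- k)"
      using * yR I assms k by (intro order_trans[OF bound norm_linear_powr_le]) auto
  qed
qed

lemma bound_summable: "(\<lambda>(c, d). C * max_abs c d powr (- k)) summable_on I"
proof -
  have "(\<lambda>x. C * (case x of (c, d) \<Rightarrow> max_abs c d powr (- k))) summable_on I"
    using summable_on_subset_banach[OF summable_on_lat[OF k] I] by (rule summable_on_cmult_right)
  then show ?thesis by (simp add: case_prod_unfold)
qed

lemma abs_summable:
  assumes "\<tau> \<in> uhp"
  shows "(\<lambda>i. norm (t i \<tau>)) summable_on I"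
proof -
  have "cball \<tau> 0 \<subseteq> uhp" using assms by simp
  then obtain C where C: "\<And>c d \<sigma>. (c, d) \<in> I \<Longrightarrow> \<sigma> \<in> cball \<tau> 0 \<Longrightarrow>
    norm (t (c, d) \<sigma>) \<le> C * max_abs c d powr (- k)"
    by (rule cball_bound) blast
  show ?thesis
    by (rule Infinite_Sum.abs_summable_on_comparison_test'[OF bound_summable[of C]]) (use C in auto)
qed

lemma summable: "\<tau> \<in> uhp \<Longrightarrow> (\<lambda>i. t i \<tau>) summable_on I"
  using abs_summable by (rule abs_summable_summable)

lemma holomorphic:
  assumes "\<And>i. i \<in> I \<Longrightarrow> t i holomorphic_on uhp"
  shows "(\<lambda>\<tau>. infsum (\<lambda>i. t i \<tau>) I) holomorphic_on uhp"
proof -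
  have "\<exists>r>0. (\<lambda>\<tau>. infsum (\<lambda>i. t i \<tau>) I) holomorphic_on ball z r" if z: "z \<in> uhp" for z
  proof -
    obtain r where r: "r > 0" "cball z r \<subseteq> uhp"
      using open_contains_cball_eq[OF open_uhp] z by blast
    obtain C where C: "\<And>c d \<sigma>. (c, d) \<in> I \<Longrightarrow> \<sigma> \<in> cball z r \<Longrightarrow>
      norm (t (c, d) \<sigma>) \<le> C * max_abs c d powr (- k)"
      by (rule cball_bound[OF r(2)]) blast
    have lim: "uniform_limit (cball z r) (\<lambda>X \<tau>. \<Sum>i\<in>X. t i \<tau>) (\<lambda>\<tau>. infsum (\<lambda>i. t i \<tau>) I)
        (finite_subsets_at_top I)"
      by (rule Weierstrass_m_test_general[OF _ bound_summable[of C]]) (use C in auto)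
    have ev: "eventually (\<lambda>X. continuous_on (cball z r) (\<lambda>\<tau>. \<Sum>i\<in>X. t i \<tau>) \<and>
        (\<lambda>\<tau>. \<Sum>i\<in>X. t i \<tau>) holomorphic_on ball z r) (finite_subsets_at_top I)"
    proof (rule eventually_finite_subsets_at_top_weakI)
      fix X assume X: "finite X" "X \<subseteq> I"
      have "(\<lambda>\<tau>. \<Sum>i\<in>X. t i \<tau>) holomorphic_on uhp"
        using assms X by (intro holomorphic_intros) auto
      then show "continuous_on (cball z r) (\<lambda>\<tau>. \<Sum>i\<in>X. t i \<tau>) \<and>
          (\<lambda>\<tau>. \<Sum>i\<in>X. t i \<tau>) holomorphic_on ball z r"
        using r by (meson ball_subset_cball holomorphic_on_imp_continuous_on holomorphic_on_subset)
    qed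
    show ?thesis
      using holomorphic_uniform_limit[OF ev lim] r by auto
  qed
  then have "\<And>z. z \<in> uhp \<Longrightarrow> (\<lambda>\<tau>. infsum (\<lambda>i. t i \<tau>) I) field_differentiable (at z)"
    by (metis centre_in_ball holomorphic_on_imp_differentiable_at open_ball)
  then show ?thesis
    by (simp add: holomorphic_on_def field_differentiable_at_within)
qed

text \<open>The exponent k is split in two parts: one, still above 2, makes the lattice sum
  converge, and the other is spent on decay in Im tau, since |c tau + d| is at least Im tau when c
  is nonzero.\<close>

lemma infsum_norm_linear_le:
  assumes "Im \<tau> \<ge> 1" "J = {(c, d). c \<noteq> (0 :: int)}"
  shows "(\<lambda>(c, d). norm (aff c d \<tau>) powr (- k)) summable_on J"
    and "infsum (\<lambda>(c, d). norm (aff c d \<tau>) powr (- k)) J \<le>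
      infsum (\<lambda>(c, d). (1 / 4) powr (- ((k + 2) / 2)) * max_abs c d powr (- ((k + 2) / 2))) J
        * Im \<tau> powr (- ((k - 2) / 2))"
proof -
  \<comment> \<open>The midpoint of 2 and k, so that both parts of the split are admissible.\<close>
  define k0 where "k0 = (k + 2) / 2"
  have k0: "k0 > 2" "k - k0 = (k - 2) / 2" "k - k0 > 0" using k by (auto simp: k0_def field_simps)
  \<comment> \<open>An integral translation only permutes the second coordinates, so Re tau may be
    assumed bounded. This makes the estimate uniform in Re tau.\<close>
  define n where "n = \<lfloor>Re \<tau>\<rfloor>"
  define \<sigma> where "\<sigma> = \<tau> - of_int n"
  have \<sigma>: "Im \<sigma> = Im \<tau>" "\<bar>Re \<sigma>\<bar> \<le> 1" by (auto simp: \<sigma>_def n_def) linarith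
  define M where "M = (\<lambda>(c, d). (1 / 4) powr (- k0) * max_abs c d powr (- k0))"
  have J: "J \<subseteq> lat" using assms(2) by (auto simp: lat_def)
  have "(\<lambda>x. (1 / 4) powr (- k0) * (case x of (c, d) \<Rightarrow> max_abs c d powr (- k0))) summable_on J"
    using summable_on_subset_banach[OF summable_on_lat[OF k0(1)] J] by (rule summable_on_cmult_right)
  then have "M summable_on J" by (simp add: M_def case_prod_unfold)
  then have sM: "(\<lambda>x. M x * Im \<tau> powr (- (k - k0))) summable_on J"
    by (rule summable_on_cmult_left)
  have le: "norm (aff c d \<sigma>) powr (- k) \<le> M (c, d) * Im \<tau> powr (- (k - k0))"
    if cd: "(c, d) \<in> J" for c d
  proof -
    have c: "\<bar>real_of_int c\<bar> \<ge> 1" using cd assms(2) by auto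
    have "Im \<tau> \<le> \<bar>Im (aff c d \<sigma>)\<bar>"
      using c assms(1) \<sigma> mult_right_mono[of 1 "\<bar>real_of_int c\<bar>" "Im \<tau>"] by (simp add: abs_mult)
    also have "\<dots> \<le> norm (aff c d \<sigma>)" by (rule abs_Im_le_cmod)
    finally have im: "Im \<tau> \<le> norm (aff c d \<sigma>)" .
    have "norm (aff c d \<sigma>) powr (- k) =
        norm (aff c d \<sigma>) powr (- k0) * norm (aff c d \<sigma>) powr (- (k - k0))"
      by (simp add: powr_add[symmetric])
    also have "\<dots> \<le> M (c, d) * Im \<tau> powr (- (k - k0))"
    proof (rule mult_mono)
      show "norm (aff c d \<sigma>) powr (- k0) \<le> M (c, d)"
        \<comment> \<open>The choice y0 = 1/2 and R = 1 gives min (1/2) (1/4), the constant 1/4 of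
          the statement.\<close>
        using norm_linear_powr_le[of "1 / 2" 1 k0 \<sigma> c d] assms \<sigma> k0 cd J by (auto simp: M_def)
      show "norm (aff c d \<sigma>) powr (- (k - k0)) \<le> Im \<tau> powr (- (k - k0))"
        using im assms k0 by (intro powr_mono2') auto
    qed (auto simp: M_def)
    finally show ?thesis .
  qed
  define g where "g = (\<lambda>(c, d). norm (aff c d \<sigma>) powr (- k))"
  have sg: "g summable_on J"
    by (rule summable_on_comparison_test[OF sM]) (use le in \<open>auto simp: g_def\<close>)
  have bij: "bij_betw (\<lambda>(c, d). (c, d + c * n)) J J"
    by (rule bij_betwI[of _ _ _ "\<lambda>(c, d). (c, d - c * n)"]) (auto simp: assms(2))
  have g: "(\<lambda>(c, d). norm (aff c d \<tau>) powr (- k)) = (\<lambda>x. g ((\<lambda>(c, d). (c, d + c * n)) x))"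
    by (auto simp: g_def \<sigma>_def algebra_simps)
  show "(\<lambda>(c, d). norm (aff c d \<tau>) powr (- k)) summable_on J"
    unfolding g using summable_on_reindex_bij_betw[OF bij, of g] sg by simp
  have "infsum (\<lambda>(c, d). norm (aff c d \<tau>) powr (- k)) J = infsum g J"
    unfolding g by (rule infsum_reindex_bij_betw[OF bij])
  also have "\<dots> \<le> infsum (\<lambda>x. M x * Im \<tau> powr (- (k - k0))) J"
    by (rule infsum_mono[OF sg sM]) (use le in \<open>auto simp: g_def\<close>)
  also have "\<dots> = infsum M J * Im \<tau> powr (- (k - k0))"
    by (rule infsum_cmult_left')
  finally show "infsum (\<lambda>(c, d). norm (aff c d \<tau>) powr (- k)) J \<le>
      infsum (\<lambda>(c, d). (1 / 4) powr (- ((k + 2) / 2)) * max_abs c d powr (- ((k + 2) / 2))) J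
        * Im \<tau> powr (- ((k - 2) / 2))"
    unfolding M_def k0(2) by (simp only: k0_def)
qed

text \<open>The rows with c = 0 supply the limit, and the others are bounded by a negative power of
  Im tau, uniformly in Re tau as the filter demands.\<close>

lemma has_limit:
  assumes const: "\<And>d \<tau>. (0, d) \<in> I \<Longrightarrow> \<tau> \<in> uhp \<Longrightarrow> t (0, d) \<tau> = t (0, d) \<i>"
  shows "\<exists>L. ((\<lambda>\<tau>. infsum (\<lambda>i. t i \<tau>) I) \<longlongrightarrow> L) (filtercomap Im at_top)"
proof -
  define J :: "(int \<times> int) set" where "J = {(c, d). c \<noteq> 0}"
  define L where "L = infsum (\<lambda>i. t i \<i>) (I - J)"
  define s where "s = (k - 2) / 2"
  have s: "s > 0" using k by (simp add: s_def)
  obtain C where C: "\<And>\<tau>. Im \<tau> \<ge> 1 \<Longrightarrow>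
      infsum (\<lambda>(c, d). norm (aff c d \<tau>) powr (- k)) J \<le> C * Im \<tau> powr (- s)"
    using infsum_norm_linear_le(2)[OF _ J_def] unfolding s_def by blast
  have le: "norm (infsum (\<lambda>i. t i \<tau>) I - L) \<le> C * Im \<tau> powr (- s)" if \<tau>: "Im \<tau> \<ge> 1" for \<tau>
  proof -
    have u: "\<tau> \<in> uhp" using \<tau> by (simp add: uhp_def)
    note sub = summable_on_subset_banach[OF summable[OF u]]
    have split: "I = (I - J) \<union> (I \<inter> J)" by auto
    have "infsum (\<lambda>i. t i \<tau>) I = infsum (\<lambda>i. t i \<tau>) (I - J) + infsum (\<lambda>i. t i \<tau>) (I \<inter> J)"
      by (subst split, rule infsum_Un_disjoint) (auto intro: sub)
    moreover have "infsum (\<lambda>i. t i \<tau>) (I - J) = L"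
      unfolding L_def using const u by (intro infsum_cong) (auto simp: J_def)
    ultimately have "norm (infsum (\<lambda>i. t i \<tau>) I - L) = norm (infsum (\<lambda>i. t i \<tau>) (I \<inter> J))"
      by simp
    also have "\<dots> \<le> infsum (\<lambda>i. norm (t i \<tau>)) (I \<inter> J)"
      by (rule norm_infsum_bound) (rule summable_on_subset_banach[OF abs_summable[OF u]], auto)
    also have "\<dots> \<le> infsum (\<lambda>(c, d). norm (aff c d \<tau>) powr (- k)) J"
      using u bound
      by (intro infsum_mono_neutral infsum_norm_linear_le(1)[OF \<tau> J_def]
        summable_on_subset_banach[OF abs_summable[OF u]]) auto
    also have "\<dots> \<le> C * Im \<tau> powr (- s)" by (rule C[OF \<tau>])
    finally show ?thesis .
  qed
  have "((\<lambda>y. C * y powr (- s)) \<longlongrightarrow> C * 0) at_top"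
    using s by (intro tendsto_mult tendsto_const tendsto_neg_powr filterlim_ident) simp
  then have lim: "((\<lambda>\<tau>. C * Im \<tau> powr (- s)) \<longlongrightarrow> C * 0) (filtercomap Im at_top)"
    by (rule filterlim_compose[OF _ filterlim_filtercomap])
  have "eventually (\<lambda>\<tau>. Im \<tau> \<ge> 1) (filtercomap Im at_top)"
    by (rule eventually_filtercomapI[OF eventually_ge_at_top])
  then have "eventually (\<lambda>\<tau>. norm (infsum (\<lambda>i. t i \<tau>) I - L) \<le> C * Im \<tau> powr (- s)) (filtercomap Im at_top)"
    by eventually_elim (rule le)
  then have "((\<lambda>\<tau>. infsum (\<lambda>i. t i \<tau>) I - L) \<longlongrightarrow> 0) (filtercomap Im at_top)"
    by (rule Lim_null_comparison) (use lim in simp)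
  then show ?thesis by (intro exI[of _ L]) (simp add: LIM_zero_iff)
qed

end


section \<open>Poincare series\<close>

lemma moebius_imat: "moebius (imat a b c d) \<tau> = moeb a b c d \<tau>"
  by (simp add: moebius_def moeb_def)

lemma autom_factor_imat: "autom_factor (imat a b c d) \<tau> = aff c d \<tau>"
  by (simp add: autom_factor_def)

lemma linear_moeb:
  assumes "\<tau> \<in> uhp" "A * E - B * C = 1"
  shows "of_int c * moeb A B C E \<tau> + of_int d =
    (aff (c * A + d * C) (c * B + d * E) \<tau>) / (aff C E \<tau>)"
  using linear_nonzero[OF assms(1) det_1_nonzero[OF assms(2)]]
  by (simp add: moeb_def field_simps)

lemma moeb_moeb:
  assumes "\<tau> \<in> uhp" "A * E - B * C = 1"
  shows "moeb a b c d (moeb A B C E \<tau>) =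
    moeb (a * A + b * C) (a * B + b * E) (c * A + d * C) (c * B + d * E) \<tau>"
  using linear_nonzero[OF assms(1) det_1_nonzero[OF assms(2)]]
  unfolding moeb_def[of a b c d] linear_moeb[OF assms] by (simp add: moeb_def)

lemma det_mult:
  fixes a b c d A B C E :: int
  assumes "a * d - b * c = 1" "A * E - B * C = 1"
  shows "(a * A + b * C) * (c * B + d * E) - (a * B + b * E) * (c * A + d * C) = 1"
proof -
  have "(a * A + b * C) * (c * B + d * E) - (a * B + b * E) * (c * A + d * C) =
    (a * d - b * c) * (A * E - B * C)" by algebra
  then show ?thesis using assms by simp
qed

lemma det_1_coprime: "a * d - b * c = (1 :: int) \<Longrightarrow> coprime c d"
proof (rule coprimeI)
  fix x assume *: "a * d - b * c = 1" "x dvd c" "x dvd d"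
  have "x dvd a * d - b * c" by (rule dvd_diff[OF dvd_mult[OF *(3)] dvd_mult[OF *(2)]])
  then show "is_unit x" using *(1) by (simp only:)
qed

lemma coprime_complete:
  assumes "coprime c (d :: int)"
  obtains a b where "a * d - b * c = 1"
proof -
  obtain u v where "u * c + v * d = gcd c d" using bezout_int by blast
  then have "v * d - (- u) * c = 1" using assms by simp
  then show ?thesis using that by blast
qed

lemma same_lower_row:
  fixes a b c d a' b' :: int
  assumes "a * d - b * c = 1" "a' * d - b' * c = 1"
  obtains n where "a' = a + n * c" "b' = b + n * d"
proof
  \<comment> \<open>The integer a b' - a' b is the upper right entry of the quotient of the two
    matrices, which is a translation because their lower rows agree.\<close>
  show "a' = a + (a * b' - a' * b) * c" "b' = b + (a * b' - a' * b) * d" using assms by algebra+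
qed

lemma moeb_shift:
  assumes "\<tau> \<in> uhp" "a * d - b * c = 1"
  shows "moeb (a + n * c) (b + n * d) c d \<tau> = moeb a b c d \<tau> + of_int n"
  using linear_nonzero[OF assms(1) det_1_nonzero[OF assms(2)]]
  by (simp add: moeb_def field_simps)

lemma moeb_minus: "moeb (- a) (- b) (- c) (- d) \<tau> = moeb a b c d \<tau>"
proof -
  have "moeb (- a) (- b) (- c) (- d) \<tau> = - (aff a b \<tau>) / - (aff c d \<tau>)"
    by (simp add: moeb_def)
  then show ?thesis by (simp only: minus_divide_divide moeb_def)
qed

lemma exp_Ln_powi: "z \<noteq> 0 \<Longrightarrow> exp (of_int n * Ln z) = z powi n"
  using exp_powi[of "Ln z" n] by simp

text \<open>Selects one row from each pair of opposite rows, in agreement with the ranges of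
  summation: c > 0, and (0, 1) for the leading 1 at infinity.\<close>

definition pos_row :: "int \<times> int \<Rightarrow> bool" where
  "pos_row v \<longleftrightarrow> fst v > 0 \<or> fst v = 0 \<and> snd v > 0"

definition norm_row :: "int \<times> int \<Rightarrow> int \<times> int" where
  "norm_row v = (if pos_row v then v else - v)"

text \<open>\<open>X\<close> is a set of determinant-one matrices stable under right multiplication by
  \<open>\<Gamma>\<^sub>0(p)\<close>, and \<open>h\<close> a function that does not distinguish two members of \<open>X\<close> with the same lower
  row. \<open>Q\<close> is the summand of the Poincare series of even weight \<open>2 m\<close> attached to \<open>h\<close>.\<close>

locale poincare =
  fixes p :: nat and m :: int and X :: "int \<Rightarrow> int \<Rightarrow> int \<Rightarrow> int \<Rightarrow> bool" and h :: "complex \<Rightarrow> complex"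
  assumes X_det: "X a b c d \<Longrightarrow> a * d - b * c = 1"
    and X_mult: "X a b c d \<Longrightarrow> A * E - B * C = 1 \<Longrightarrow> int p dvd C \<Longrightarrow>
      X (a * A + b * C) (a * B + b * E) (c * A + d * C) (c * B + d * E)"
    and X_minus: "X a b c d \<Longrightarrow> X (- a) (- b) (- c) (- d)"
    and h_row: "X a b c d \<Longrightarrow> X a' b' c d \<Longrightarrow> \<tau> \<in> uhp \<Longrightarrow> h (moeb a' b' c d \<tau>) = h (moeb a b c d \<tau>)"
begin

definition rows :: "(int \<times> int) set" where
  "rows = {(c, d). \<exists>a b. X a b c d}"

definition Q :: "int \<times> int \<Rightarrow> complex \<Rightarrow> complex" where
  "Q v \<tau> = (aff (fst v) (snd v) \<tau>) powi (- 2 * m) *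
    h (case SOME (a, b). X a b (fst v) (snd v) of (a, b) \<Rightarrow> moeb a b (fst v) (snd v) \<tau>)"

lemma Q_eq:
  assumes "X a b c d" "\<tau> \<in> uhp"
  shows "Q (c, d) \<tau> = (aff c d \<tau>) powi (- 2 * m) * h (moeb a b c d \<tau>)"
proof -
  define ab where "ab = (SOME (a, b). X a b c d)"
  have "case ab of (a, b) \<Rightarrow> X a b c d"
    unfolding ab_def by (rule someI[of _ "(a, b)"]) (use assms in simp)
  then have "h (case ab of (a, b) \<Rightarrow> moeb a b c d \<tau>) = h (moeb a b c d \<tau>)"
    using h_row[OF assms(1) _ assms(2)] by (cases ab) auto
  then show ?thesis by (simp add: Q_def ab_def)
qed

lemma Q_minus:
  assumes "v \<in> rows" "\<tau> \<in> uhp"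
  shows "Q (- v) \<tau> = Q v \<tau>"
proof -
  obtain a b c d where v: "v = (c, d)" "X a b c d" using assms(1) by (auto simp: rows_def)
  have "aff (- c) (- d) \<tau> = - (aff c d \<tau>)" by simp
  then have "(aff (- c) (- d) \<tau>) powi (- 2 * m) = (aff c d \<tau>) powi (- 2 * m)"
    by (simp only:) (rule power_int_minus_left_even, simp)
  then show ?thesis
    using Q_eq[OF X_minus[OF v(2)] assms(2)] Q_eq[OF v(2) assms(2)] v(1) by (simp only: uminus_Pair moeb_minus)
qed

lemma rows_minus: "v \<in> rows \<Longrightarrow> - v \<in> rows"
  by (auto simp: rows_def) (blast intro: X_minus)

lemma rows_nonzero: "v \<in> rows \<Longrightarrow> v \<noteq> 0"
  by (auto simp: rows_def zero_prod_def dest!: X_det)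

lemma norm_row_rows: "v \<in> rows \<Longrightarrow> norm_row v \<in> rows"
  using rows_minus by (simp add: norm_row_def)

lemma pos_norm_row: "v \<in> rows \<Longrightarrow> pos_row (norm_row v)"
  using rows_nonzero[of v] by (cases v) (auto simp: norm_row_def pos_row_def zero_prod_def)

lemma Q_norm_row: "v \<in> rows \<Longrightarrow> \<tau> \<in> uhp \<Longrightarrow> Q (norm_row v) \<tau> = Q v \<tau>"
  by (simp add: norm_row_def Q_minus)

definition reps :: "(int \<times> int) set" where
  "reps = {v \<in> rows. pos_row v}"

definition act :: "int \<Rightarrow> int \<Rightarrow> int \<Rightarrow> int \<Rightarrow> int \<times> int \<Rightarrow> int \<times> int" where
  "act A B C E = (\<lambda>(c, d). (c * A + d * C, c * B + d * E))"

lemma act_minus: "act A B C E (- v) = - act A B C E v"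
  by (cases v) (simp add: act_def)

lemma act_rows:
  assumes "A * E - B * C = 1" "int p dvd C" "v \<in> rows"
  shows "act A B C E v \<in> rows"
  using assms(3) by (auto simp: rows_def act_def) (blast intro: X_mult[OF _ assms(1,2)])

lemma act_inverse:
  assumes "A * E - B * C = 1"
  shows "act E (- B) (- C) A (act A B C E v) = v"
proof (cases v)
  case (Pair c d)
  have "(c * A + d * C) * E + (c * B + d * E) * - C = c * (A * E - B * C)"
    "(c * A + d * C) * - B + (c * B + d * E) * A = d * (A * E - B * C)" by algebra+
  then show ?thesis using assms by (simp add: act_def Pair)
qed

text \<open>On rows modulo sign this is right multiplication by an invertible matrix. The inverse
  matrix undoes it up to sign, and the final normalisation removes that sign.\<close>

lemma bij_reps:
  assumes det: "A * E - B * C = 1" and p: "int p dvd C"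
  shows "bij_betw (\<lambda>v. norm_row (act A B C E v)) reps reps"
proof (rule bij_betwI)
  have det': "E * A - (- B) * (- C) = 1" and p': "int p dvd - C"
    using det p by (simp_all add: mult.commute)
  show "(\<lambda>v. norm_row (act A B C E v)) \<in> reps \<rightarrow> reps"
    "(\<lambda>v. norm_row (act E (- B) (- C) A v)) \<in> reps \<rightarrow> reps"
    using act_rows[OF det p] act_rows[OF det' p'] norm_row_rows pos_norm_row
    by (auto simp: reps_def)
  have *: "norm_row (act E' B' C' A' (norm_row (act A B C E v))) = v"
    if "v \<in> reps" "act E' B' C' A' (act A B C E v) = v" for E' B' C' A' A B C E v
  proof -
    have v: "norm_row v = v" using that(1) by (simp add: reps_def norm_row_def)
    have "norm_row (- v) = v"
      using that(1) by (cases v) (auto simp: reps_def norm_row_def pos_row_def)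
    then show ?thesis
      using v that(2) by (simp add: norm_row_def[of "act A B C E v"] act_minus)
  qed
  show "norm_row (act E (- B) (- C) A (norm_row (act A B C E v))) = v" if "v \<in> reps" for v
    using *[OF that act_inverse[OF det]] .
  show "norm_row (act A B C E (norm_row (act E (- B) (- C) A v))) = v" if "v \<in> reps" for v
    using *[OF that, of A B C E E "- B" "- C" A] act_inverse[OF det', of v] by simp
qed

lemma Q_moeb:
  assumes "A * E - B * C = 1" "int p dvd C" "v \<in> rows" "\<tau> \<in> uhp"
  shows "Q v (moeb A B C E \<tau>) = (aff C E \<tau>) powi (2 * m) * Q (act A B C E v) \<tau>"
proof -
  obtain a b c d where v: "v = (c, d)" "X a b c d" using assms(3) by (auto simp: rows_def)
  have j: "aff C E \<tau> \<noteq> 0"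
    using linear_nonzero[OF assms(4) det_1_nonzero[OF assms(1)]] .
  show ?thesis
    unfolding v(1) act_def prod.case Q_eq[OF v(2) moeb_in_uhp[OF assms(4,1)]]
      Q_eq[OF X_mult[OF v(2) assms(1,2)] assms(4)] moeb_moeb[OF assms(4,1)] linear_moeb[OF assms(4,1)]
    using j by (simp add: power_int_divide_distrib power_int_minus field_simps)
qed

text \<open>The automorphy factor comes out of every summand in the same way. The transformed rows
  may have the wrong sign, but the even weight makes \<open>Q\<close> blind to it, so they can be
  normalised and the sum reindexed.\<close>

lemma infsum_Q_moeb:
  assumes "A * E - B * C = 1" "int p dvd C" "\<tau> \<in> uhp"
  shows "infsum (\<lambda>v. Q v (moeb A B C E \<tau>)) reps =
    (aff C E \<tau>) powi (2 * m) * infsum (\<lambda>v. Q v \<tau>) reps"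
proof -
  have "infsum (\<lambda>v. Q v (moeb A B C E \<tau>)) reps =
      infsum (\<lambda>v. (aff C E \<tau>) powi (2 * m) * Q (norm_row (act A B C E v)) \<tau>) reps"
    using assms act_rows[OF assms(1,2)]
    by (intro infsum_cong) (auto simp: Q_moeb Q_norm_row reps_def)
  also have "\<dots> = (aff C E \<tau>) powi (2 * m) * infsum (\<lambda>v. Q (norm_row (act A B C E v)) \<tau>) reps"
    by (rule infsum_cmult_right')
  also have "infsum (\<lambda>v. Q (norm_row (act A B C E v)) \<tau>) reps = infsum (\<lambda>v. Q v \<tau>) reps"
    by (rule infsum_reindex_bij_betw[OF bij_reps[OF assms(1,2)]])
  finally show ?thesis .
qed

lemma reps_lat: "reps \<subseteq> lat"
  using rows_nonzero by (auto simp: reps_def lat_def zero_prod_def)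

lemma reps_0: "(0, d) \<in> reps \<Longrightarrow> d = 1"
proof -
  assume "(0, d) \<in> reps"
  then obtain a b where "X a b 0 d" "d > 0" by (auto simp: reps_def rows_def pos_row_def)
  then have "a * d = 1" "d > 0" using X_det by fastforce+
  then show "d = 1" by (metis dvd_triv_right zdvd1_eq abs_of_pos)
qed

lemma rows_coprime: "(c, d) \<in> rows \<Longrightarrow> coprime c d"
  by (auto simp: rows_def intro: det_1_coprime[OF X_det])

end


section \<open>The eta quotient and its multiplier system\<close>

definition log_quot :: "nat \<Rightarrow> real \<Rightarrow> real \<Rightarrow> complex \<Rightarrow> complex" where
  "log_quot p r1 rp \<tau> = of_real r1 * log_eta \<tau> + of_real rp * log_eta (of_nat p * \<tau>)"

lemma eta_quot_eq: "eta_quot p r1 rp \<tau> = exp (log_quot p r1 rp \<tau>)"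
  by (simp add: eta_quot_def eta_pow_def log_quot_def exp_add)

lemma uhp_mult_nat: "\<tau> \<in> uhp \<Longrightarrow> p > 0 \<Longrightarrow> of_nat p * \<tau> \<in> uhp"
  by (simp add: uhp_def)

lemma uhp_add_int: "\<tau> \<in> uhp \<Longrightarrow> \<tau> + of_int n \<in> uhp"
  by (simp add: uhp_def)

lemma log_eta_plus_of_int: "\<tau> \<in> uhp \<Longrightarrow> log_eta (\<tau> + of_int n) = log_eta \<tau> + of_real pi * \<i> * of_int n / 12"
  by (simp add: log_eta_eq_Leta uhp_add_int Leta_plus_of_int)

lemma log_quot_plus_of_int:
  assumes "\<tau> \<in> uhp" "p > 0"
  shows "log_quot p r1 rp (\<tau> + of_int n) = log_quot p r1 rp \<tau> + tpi * of_int n * of_real ((r1 + real p * rp) / 24)"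
proof -
  have eq: "of_nat p * (\<tau> + of_int n) = of_nat p * \<tau> + of_int (int p * n)"
    by (simp add: distrib_left)
  show ?thesis
    unfolding log_quot_def eq log_eta_plus_of_int[OF assms(1), of n]
      log_eta_plus_of_int[OF uhp_mult_nat[OF assms], of "int p * n"]
    by (simp add: field_simps)
qed

text \<open>p times gamma tau is the image of p tau under (a, p b; c/p, d), whose automorphy factor
  at p tau is again c tau + d. Hence both eta factors contribute the same logarithm.\<close>

lemma log_quot_moeb:
  assumes "p > 0" "c > 0" "int p dvd c" "a * d - b * c = 1" "\<tau> \<in> uhp"
  shows "log_quot p r1 rp (moeb a b c d \<tau>) = log_quot p r1 rp \<tau> + of_real ((r1 + rp) / 2) * Ln (aff c d \<tau>)
    + tpi * of_real (r1 * eta_phase (a + d) d c + rp * eta_phase (a + d) d (c div int p))"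
proof -
  obtain c' where c: "c = int p * c'" using assms(3) by (auto simp: dvd_def)
  have c': "c' > 0" "c div int p = c'" using assms(1,2) c by (auto simp: zero_less_mult_iff)
  have det: "a * d - (b * int p) * c' = 1" using assms(4) by (simp add: c mult_ac)
  have m: "of_nat p * moeb a b c d \<tau> = moeb a (b * int p) c' d (of_nat p * \<tau>)"
    by (simp add: moeb_def c algebra_simps)
  have l: "of_int c' * (of_nat p * \<tau>) + of_int d = aff c d \<tau>"
    by (simp add: c mult_ac)
  show ?thesis
    unfolding log_quot_def m log_eta_moeb[OF assms(2,4,5)]
      log_eta_moeb[OF c'(1) det uhp_mult_nat[OF assms(5,1)]] l c'(2)
    by (simp add: field_simps)
qed

lemma eis_factor_eq:
  "eis_factor p r1 rp a c d =
    exp (- (tpi * of_real (r1 * eta_phase (a + d) d c + rp * eta_phase (a + d) d (c div int p))))"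
  by (simp add: eis_factor_def e_def algebra_simps)

lemma norm_eis_factor: "norm (eis_factor p r1 rp a c d) = 1"
  by (simp add: eis_factor_def norm_e)

text \<open>The phase of the summand is minus the phase in the law of log f. Trading it for log
  f(tau) - log f(gamma tau) leaves the exponent k - k' in place of k, and for the weights considered
  this is an even integer.\<close>

lemma eis_factor_log_quot:
  assumes "p > 0" "c > 0" "int p dvd c" "a * d - b * c = 1" "\<tau> \<in> uhp"
  shows "eis_factor p r1 rp a c d * exp (- of_real k * Ln (aff c d \<tau>)) =
    eta_quot p r1 rp \<tau> * exp (- log_quot p r1 rp (moeb a b c d \<tau>)) *
    exp (- of_real (k - (r1 + rp) / 2) * Ln (aff c d \<tau>))"
  unfolding eis_factor_eq eta_quot_eq exp_add[symmetric] log_quot_moeb[OF assms]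
  by (rule arg_cong[where f = exp]) (simp add: algebra_simps)

lemma exp_2pi_ii_int_root:
  assumes "real N * x \<in> \<int>"
  shows "exp (tpi * of_real x) ^ N = 1"
proof -
  have "exp (tpi * of_real x) ^ N = e (of_real (real N * x))"
    by (simp add: e_def exp_of_nat_mult[symmetric] mult_ac)
  then show ?thesis using assms by (simp add: e_of_real_eq_1_iff del: of_real_mult)
qed

text \<open>The exponent \<open>96 D\<close> collects the denominators 24 of the phases, 4 of the sign change
  \<open>M \<mapsto> - M\<close> and \<open>D\<close> of the exponents \<open>r\<^sub>1, r\<^sub>p\<close>.\<close>

lemma eta_quot_transform_pos:
  assumes "p > 0" "real D * r1 \<in> \<int>" "real D * rp \<in> \<int>"
    and "a * d - b * c = 1" "int p dvd c" "c > 0 \<or> c = 0 \<and> d > 0"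
  obtains w where "w ^ (96 * D) = 1"
    "\<And>\<tau>. \<tau> \<in> uhp \<Longrightarrow> exp (- of_real ((r1 + rp) / 2) * Ln (aff c d \<tau>)) *
      eta_quot p r1 rp (moeb a b c d \<tau>) = w * eta_quot p r1 rp \<tau>"
proof (cases "c > 0")
  case True
  obtain c' where c: "c = int p * c'" using assms(5) by (auto simp: dvd_def)
  have c': "c' > 0" "c div int p = c'" using assms(1) True c by (auto simp: zero_less_mult_iff)
  have det: "a * d - (b * int p) * c' = 1" using assms(4) by (simp add: c mult_ac)
  define x where "x = r1 * eta_phase (a + d) d c + rp * eta_phase (a + d) d (c div int p)"
  have x_eq: "real (96 * D) * x = 4 * (real D * r1 * (24 * eta_phase (a + d) d c) + real D * rp * (24 * eta_phase (a + d) d c'))"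
    by (simp add: x_def c'(2) algebra_simps)
  have x: "real (96 * D) * x \<in> \<int>"
    unfolding x_eq
    by (intro Ints_mult Ints_add assms(2,3) eta_phase_24[OF True assms(4)] eta_phase_24[OF c'(1) det]) simp
  show ?thesis
  proof (rule that)
    show "exp (tpi * of_real x) ^ (96 * D) = 1" by (rule exp_2pi_ii_int_root[OF x])
    fix \<tau> assume "\<tau> \<in> uhp"
    then show "exp (- of_real ((r1 + rp) / 2) * Ln (aff c d \<tau>)) *
      eta_quot p r1 rp (moeb a b c d \<tau>) = exp (tpi * of_real x) * eta_quot p r1 rp \<tau>"
      unfolding eta_quot_eq log_quot_moeb[OF assms(1) True assms(5,4) \<open>\<tau> \<in> uhp\<close>] exp_add[symmetric]
      by (simp add: x_def add.commute)
  qed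
next
  case False
  then have c: "c = 0" "d > 0" using assms(6) by auto
  then have ad: "a * d = 1" using assms(4) by simp
  then have d: "d = 1" "a = 1" using c(2) by (auto simp: zmult_eq_1_iff)
  define x where "x = of_int b * ((r1 + real p * rp) / 24)"
  have "real (96 * D) * x = of_int (4 * b) * (real D * r1 + of_int (int p) * (real D * rp))"
    by (simp add: x_def algebra_simps)
  then have x: "real (96 * D) * x \<in> \<int>"
    using assms(2,3) by (simp only: Ints_mult Ints_add Ints_of_int)
  show ?thesis
  proof (rule that)
    show "exp (tpi * of_real x) ^ (96 * D) = 1" by (rule exp_2pi_ii_int_root[OF x])
    fix \<tau> assume \<tau>: "\<tau> \<in> uhp"
    have "moeb a b c d \<tau> = \<tau> + of_int b" by (simp add: moeb_def c d)
    then show "exp (- of_real ((r1 + rp) / 2) * Ln (aff c d \<tau>)) *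
      eta_quot p r1 rp (moeb a b c d \<tau>) = exp (tpi * of_real x) * eta_quot p r1 rp \<tau>"
      unfolding eta_quot_eq by (simp add: log_quot_plus_of_int[OF \<tau> assms(1)] c d x_def exp_add mult_ac)
  qed
qed

text \<open>The sign change moves the argument down by pi for c > 0 but up by pi for a positive
  constant, since the principal branch takes the argument pi on the negative axis. Either way the
  shift is independent of tau.\<close>

lemma Ln_minus_linear:
  assumes "c > 0 \<or> c = 0 \<and> d > 0"
  obtains s :: int where "\<And>\<tau>. \<tau> \<in> uhp \<Longrightarrow>
    Ln (- (aff c d \<tau>)) = Ln (aff c d \<tau>) + of_int s * of_real pi * \<i>"
proof (cases "c > 0")
  case True
  show ?thesis
    by (rule that[of "- 1"]) (simp add: Ln_minus_uhp[OF linear_in_uhp[OF _ True]] del: minus_add_distrib)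
next
  case False
  then have c: "c = 0" "d > 0" using assms by auto
  have "Ln (- complex_of_int d) = Ln (of_int d) + of_real pi * \<i>"
    using c by (subst Ln_minus) (auto simp: mult.commute)
  then show ?thesis by (intro that[of 1]) (simp add: c)
qed

lemma eta_quot_transform:
  assumes "p > 0" "real D * r1 \<in> \<int>" "real D * rp \<in> \<int>"
    and "a * d - b * c = 1" "int p dvd c"
  obtains w where "w ^ (96 * D) = 1"
    "\<And>\<tau>. \<tau> \<in> uhp \<Longrightarrow> exp (- of_real ((r1 + rp) / 2) * Ln (aff c d \<tau>)) *
      eta_quot p r1 rp (moeb a b c d \<tau>) = w * eta_quot p r1 rp \<tau>"
proof (cases "c > 0 \<or> c = 0 \<and> d > 0")
  case True
  then show ?thesis using eta_quot_transform_pos[OF assms True] that by blast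
next
  case False
  then have pos: "- c > 0 \<or> - c = 0 \<and> - d > 0" using det_1_nonzero[OF assms(4)] by auto
  have det: "- a * - d - - b * - c = 1" and dvd: "int p dvd - c" using assms by auto
  obtain w where w: "w ^ (96 * D) = 1"
    "\<And>\<tau>. \<tau> \<in> uhp \<Longrightarrow> exp (- of_real ((r1 + rp) / 2) * Ln (aff (- c) (- d) \<tau>)) *
      eta_quot p r1 rp (moeb (- a) (- b) (- c) (- d) \<tau>) = w * eta_quot p r1 rp \<tau>"
    using eta_quot_transform_pos[OF assms(1-3) det dvd pos] by blast
  obtain s where s: "\<And>\<tau>. \<tau> \<in> uhp \<Longrightarrow> Ln (- (aff (- c) (- d) \<tau>)) =
      Ln (aff (- c) (- d) \<tau>) + of_int s * of_real pi * \<i>"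
    using Ln_minus_linear[OF pos] by blast
  \<comment> \<open>The matrices M and -M have the same Moebius map, so only the shift s pi i of the
    logarithm counts; times -(r1 + rp)/2 it equals 2 pi i x.\<close>
  define x where "x = - of_int s * (r1 + rp) / 4"
  have "real (96 * D) * x = of_int (- 24 * s) * (real D * r1 + real D * rp)"
    by (simp add: x_def field_simps)
  then have x: "real (96 * D) * x \<in> \<int>"
    using assms(2,3) by (simp only: Ints_mult Ints_add Ints_of_int)
  show ?thesis
  proof (rule that)
    show "(exp (tpi * of_real x) * w) ^ (96 * D) = 1"
      by (simp only: power_mult_distrib exp_2pi_ii_int_root[OF x] w(1)) simp
    fix \<tau> assume \<tau>: "\<tau> \<in> uhp"
    have "aff c d \<tau> = - (aff (- c) (- d) \<tau>)" by simp
    then have Ln: "Ln (aff c d \<tau>) = Ln (aff (- c) (- d) \<tau>) + of_int s * of_real pi * \<i>"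
      using s[OF \<tau>] by (simp only:)
    have "exp (- of_real ((r1 + rp) / 2) * Ln (aff c d \<tau>)) =
        exp (tpi * of_real x) * exp (- of_real ((r1 + rp) / 2) * Ln (aff (- c) (- d) \<tau>))"
      unfolding Ln exp_add[symmetric] by (rule arg_cong[where f = exp]) (simp add: x_def field_simps)
    then show "exp (- of_real ((r1 + rp) / 2) * Ln (aff c d \<tau>)) *
      eta_quot p r1 rp (moeb a b c d \<tau>) = exp (tpi * of_real x) * w * eta_quot p r1 rp \<tau>"
      using w(2)[OF \<tau>] by (simp only: moeb_minus mult.assoc)
  qed
qed

context
  fixes p D :: nat and r1 rp :: real
  assumes p: "p > 0" and D: "D > 0" and r: "real D * r1 \<in> \<int>" "real D * rp \<in> \<int>"
begin

lemma weight_int: "real (2 * D) * ((r1 + rp) / 2) \<in> \<int>"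
proof -
  have "real (2 * D) * ((r1 + rp) / 2) = real D * r1 + real D * rp" by (simp add: algebra_simps)
  then show ?thesis using r by simp
qed

lemma eta_mult_eqI:
  assumes "\<And>\<tau>. \<tau> \<in> uhp \<Longrightarrow> slash (2 * D) ((r1 + rp) / 2) (eta_quot p r1 rp) g \<tau> = w * eta_quot p r1 rp \<tau>"
  shows "eta_mult D p r1 rp g = w"
  unfolding eta_mult_def
proof (rule the_equality)
  fix w' assume "\<forall>\<tau>\<in>uhp. slash (2 * D) ((r1 + rp) / 2) (eta_quot p r1 rp) g \<tau> = w' * eta_quot p r1 rp \<tau>"
  then have "w' * eta_quot p r1 rp \<i> = w * eta_quot p r1 rp \<i>" using assms[of \<i>] by simp
  then show "w' = w" by (simp add: eta_quot_eq)
qed (use assms in auto)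

lemma eta_mult_props:
  assumes "g \<in> cover_preimage (2 * D) (Gamma0 p)"
  shows "eta_mult D p r1 rp g ^ (96 * D) = 1"
    and "\<tau> \<in> uhp \<Longrightarrow> slash (2 * D) ((r1 + rp) / 2) (eta_quot p r1 rp) g \<tau> =
      eta_mult D p r1 rp g * eta_quot p r1 rp \<tau>"
proof -
  obtain M \<epsilon> where g: "g = cover_elt (2 * D) M \<epsilon>" "M \<in> carrier SL2R" "\<epsilon> ^ (2 * D) = 1" "M \<in> Gamma0 p"
    using assms by (auto simp: cover_preimage_def elim!: SL2R_cover_cases)
  obtain a b c d where M: "M = imat a b c d" "a * d - b * c = 1" "int p dvd c"
    using g(4) by (rule Gamma0_cases)
  obtain w where w: "w ^ (96 * D) = 1"
    "\<And>\<tau>. \<tau> \<in> uhp \<Longrightarrow> exp (- of_real ((r1 + rp) / 2) * Ln (aff c d \<tau>)) *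
      eta_quot p r1 rp (moeb a b c d \<tau>) = w * eta_quot p r1 rp \<tau>"
    using eta_quot_transform[OF p r M(2,3)] by blast
  define n where "n = - \<lfloor>real (2 * D) * ((r1 + rp) / 2)\<rfloor>"
  have eq: "slash (2 * D) ((r1 + rp) / 2) (eta_quot p r1 rp) g \<tau> = \<epsilon> powi n * w * eta_quot p r1 rp \<tau>"
    if "\<tau> \<in> uhp" for \<tau>
    unfolding g(1) slash_cover_elt[OF g(2) that] n_def[symmetric]
    using w(2)[OF that] by (simp only: M(1) moebius_imat autom_factor_imat mult.assoc)
  have "(\<epsilon> powi n * w) ^ (96 * D) = 1"
  proof -
    have "(\<epsilon> powi n) ^ (96 * D) = ((\<epsilon> ^ (2 * D)) ^ 48) powi n"
      by (simp add: power_int_power power_int_power' power_mult[symmetric] mult_ac)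
    then show ?thesis using w(1) g(3) by (simp add: power_mult_distrib)
  qed
  then show "eta_mult D p r1 rp g ^ (96 * D) = 1"
    "\<tau> \<in> uhp \<Longrightarrow> slash (2 * D) ((r1 + rp) / 2) (eta_quot p r1 rp) g \<tau> =
      eta_mult D p r1 rp g * eta_quot p r1 rp \<tau>"
    using eta_mult_eqI[OF eq] eq by simp_all
qed

lemma eta_mult_mult:
  assumes "g \<in> cover_preimage (2 * D) (Gamma0 p)" "h \<in> cover_preimage (2 * D) (Gamma0 p)"
  shows "eta_mult D p r1 rp (g \<otimes>\<^bsub>SL2R_cover (2 * D)\<^esub> h) = eta_mult D p r1 rp g * eta_mult D p r1 rp h"
proof (rule eta_mult_eqI)
  fix \<tau> assume \<tau>: "\<tau> \<in> uhp"
  have c: "g \<in> carrier (SL2R_cover (2 * D))" "h \<in> carrier (SL2R_cover (2 * D))"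
    using assms by (auto simp: cover_preimage_def)
  have hu: "moebius (fst h) \<tau> \<in> uhp"
    using c(2) moebius_in_uhp[OF _ \<tau>] by (auto elim!: SL2R_cover_cases)
  have "slash (2 * D) ((r1 + rp) / 2) (eta_quot p r1 rp) (g \<otimes>\<^bsub>SL2R_cover (2 * D)\<^esub> h) \<tau> =
      slash (2 * D) ((r1 + rp) / 2) (slash (2 * D) ((r1 + rp) / 2) (eta_quot p r1 rp) g) h \<tau>"
    using D weight_int c \<tau> by (intro slash_mult) auto
  also have "\<dots> = eta_mult D p r1 rp g * slash (2 * D) ((r1 + rp) / 2) (eta_quot p r1 rp) h \<tau>"
    unfolding slash_def[of _ _ _ h] eta_mult_props(2)[OF assms(1) hu] by (simp only: mult_ac)
  finally show "slash (2 * D) ((r1 + rp) / 2) (eta_quot p r1 rp) (g \<otimes>\<^bsub>SL2R_cover (2 * D)\<^esub> h) \<tau> =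
      eta_mult D p r1 rp g * eta_mult D p r1 rp h * eta_quot p r1 rp \<tau>"
    by (simp add: eta_mult_props(2)[OF assms(2) \<tau>])
qed

text \<open>All values are (96 D)-th roots of unity, so the values can serve as the finitely many
  labels of the cosets of the kernel.\<close>

lemma eta_mult_character: "finite_index_character (2 * D) (Gamma0 p) (eta_mult D p r1 rp)"
proof -
  define ch where "ch = eta_mult D p r1 rp"
  define P where "P = cover_preimage (2 * D) (Gamma0 p)"
  define K where "K = SL2R_cover (2 * D)\<lparr>carrier := P\<rparr>"
  have D2: "2 * D > 0" using D by simp
  have "subgroup P (SL2R_cover (2 * D))"
    unfolding P_def by (rule subgroup_cover_preimage[OF D2 subgroup_Gamma0])
  then have K: "group K"
    unfolding K_def by (rule subgroup.subgroup_is_group[OF _ group_SL2R_cover[OF D2]])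
  interpret group K by (rule K)
  have root: "ch g ^ (96 * D) = 1" if "g \<in> P" for g
    using eta_mult_props(1) that by (simp add: ch_def P_def)
  have nz: "ch g \<noteq> 0" if "g \<in> P" for g
    using root[OF that] D by (auto simp: power_0_left)
  have mult: "ch (g \<otimes>\<^bsub>K\<^esub> h) = ch g * ch h" if "g \<in> P" "h \<in> P" for g h
    using eta_mult_mult that by (simp add: ch_def P_def K_def)
  have car: "carrier K = P" by (simp add: K_def)
  have one: "ch \<one>\<^bsub>K\<^esub> = 1"
    using mult[of "\<one>\<^bsub>K\<^esub>" "\<one>\<^bsub>K\<^esub>"] nz[of "\<one>\<^bsub>K\<^esub>"] one_closed by (simp add: car)
  have inv: "ch g * ch (inv\<^bsub>K\<^esub> g) = 1" if "g \<in> P" for g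
    using mult[of g "inv\<^bsub>K\<^esub> g"] that one inv_closed[of g] r_inv[of g] by (simp add: car)
  have sub: "subgroup {g \<in> P. ch g = 1} K"
  proof (rule subgroupI)
    show "{g \<in> P. ch g = 1} \<subseteq> carrier K" by (auto simp: car)
    show "{g \<in> P. ch g = 1} \<noteq> {}" using one one_closed car by blast
    fix g assume g: "g \<in> {g \<in> P. ch g = 1}"
    then show "inv\<^bsub>K\<^esub> g \<in> {g \<in> P. ch g = 1}"
      using inv[of g] inv_closed[of g] by (simp add: car)
    fix h assume "h \<in> {g \<in> P. ch g = 1}"
    with g show "g \<otimes>\<^bsub>K\<^esub> h \<in> {g \<in> P. ch g = 1}"
      using mult[of g h] m_closed[of g h] by (simp add: car)
  qed
  have "finite_index_subgroup {g \<in> P. ch g = 1} K"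
  proof (rule finite_index_subgroupI[OF K sub])
    show "finite {z :: complex. z ^ (96 * D) = 1}" using D by (intro finite_roots_unity) auto
    show "ch ` carrier K \<subseteq> {z. z ^ (96 * D) = 1}" using root by (auto simp: car)
    fix x y assume xy: "x \<in> carrier K" "y \<in> carrier K" "ch x = ch y"
    then show "x \<otimes>\<^bsub>K\<^esub> inv\<^bsub>K\<^esub> y \<in> {g \<in> P. ch g = 1}"
      using mult[of x "inv\<^bsub>K\<^esub> y"] inv[of y] m_closed[of x "inv\<^bsub>K\<^esub> y"] inv_closed[of y]
      by (simp add: car)
  qed
  then show ?thesis
    unfolding finite_index_character_def P_def[symmetric] ch_def[symmetric]
    using nz mult by (simp add: K_def)
qed

end


section \<open>Eisenstein series as modular forms\<close>

lemma norm_exp_Ln: "z \<noteq> 0 \<Longrightarrow> norm (exp (- of_real k * Ln z)) = norm z powr (- k)"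
  by (simp add: norm_exp_eq_Re Re_Ln powr_def)

lemma modular_formsI:
  assumes "real D * k \<in> \<int>" "finite_index_subgroup G (SL2R\<lparr>carrier := SL2Z\<rparr>)"
    "finite_index_character D G chi" "f holomorphic_on uhp"
    "\<And>g \<tau>. g \<in> cover_preimage D G \<Longrightarrow> \<tau> \<in> uhp \<Longrightarrow> slash D k f g \<tau> = chi g * f \<tau>"
    "\<And>g. g \<in> cover_preimage D SL2Z \<Longrightarrow> \<exists>L. (slash D k f g \<longlongrightarrow> L) (filtercomap Im at_top)"
  shows "f \<in> modular_forms D k G chi"
  using assms by (simp add: modular_forms_def)

context poincare
begin

context
  fixes D :: nat and r1 rp k :: real and u :: "int \<times> int \<Rightarrow> complex" and E :: "complex \<Rightarrow> complex"
  assumes p: "p > 0" and D: "D > 0" and r: "real D * r1 \<in> \<int>" "real D * rp \<in> \<int>"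
    and k: "k = (r1 + rp) / 2 + 2 * of_int m" "k > 2"
    and norm_u: "\<And>v. v \<in> reps \<Longrightarrow> norm (u v) = 1"
    and u_Q: "\<And>c d \<tau>. (c, d) \<in> reps \<Longrightarrow> \<tau> \<in> uhp \<Longrightarrow>
      u (c, d) * exp (- of_real k * Ln (aff c d \<tau>)) = eta_quot p r1 rp \<tau> * Q (c, d) \<tau>"
begin

text \<open>The summand in the form that shows its size, \<open>u\<close> having modulus 1. By
  \<open>u_Q\<close> it equals f times \<open>Q\<close>, the form that shows its transformation.
  Convergence, holomorphy and limits use the first form, invariance the second.\<close>

definition tm :: "int \<times> int \<Rightarrow> complex \<Rightarrow> complex" where
  "tm v \<tau> = u v * exp (- of_real k * Ln (aff (fst v) (snd v) \<tau>))"

lemma reps_linear_nonzero: "(c, d) \<in> reps \<Longrightarrow> \<tau> \<in> uhp \<Longrightarrow> aff c d \<tau> \<noteq> (0 :: complex)"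
  using reps_lat by (intro linear_nonzero) (auto simp: lat_def)

lemma lattice_series_tm: "lattice_series k reps tm"
proof
  fix c d \<tau> assume *: "(c, d) \<in> reps" "\<tau> \<in> uhp"
  show "norm (tm (c, d) \<tau>) \<le> norm (aff c d \<tau>) powr (- k)"
    using norm_u[OF *(1)] norm_exp_Ln[OF reps_linear_nonzero[OF *], of k]
    by (simp add: tm_def norm_mult)
qed (use k reps_lat in auto)

lemma tm_summable: "\<tau> \<in> uhp \<Longrightarrow> (\<lambda>v. tm v \<tau>) summable_on reps"
  by (rule lattice_series.summable[OF lattice_series_tm])

lemma holomorphic_tm:
  assumes "v \<in> reps"
  shows "tm v holomorphic_on uhp"
proof (cases "fst v = 0")
  case True
  then show ?thesis by (simp add: tm_def[abs_def])
next
  case False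
  then have "fst v > 0" using assms by (auto simp: reps_def pos_row_def)
  then have "aff (fst v) (snd v) \<tau> \<notin> \<real>\<^sub>\<le>\<^sub>0" if "\<tau> \<in> uhp" for \<tau>
    using linear_in_uhp[OF that, of "fst v" "snd v"] by (auto simp: uhp_def complex_nonpos_Reals_iff)
  then show ?thesis
    unfolding tm_def[abs_def] by (auto intro!: holomorphic_intros)
qed

definition Es :: "complex \<Rightarrow> complex" where
  "Es \<tau> = infsum (\<lambda>v. tm v \<tau>) reps"

lemma holomorphic_Es: "Es holomorphic_on uhp"
  unfolding Es_def[abs_def]
  by (rule lattice_series.holomorphic[OF lattice_series_tm]) (rule holomorphic_tm)

lemma weight_int_k: "real (2 * D) * k \<in> \<int>"
proof -
  have "real (2 * D) * k = real (2 * D) * ((r1 + rp) / 2) + of_int (4 * int D * m)"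
    by (simp add: k algebra_simps)
  then show ?thesis using weight_int[OF p D r] by (simp only: Ints_add Ints_of_int)
qed

lemma Es_eq: "\<tau> \<in> uhp \<Longrightarrow> Es \<tau> = eta_quot p r1 rp \<tau> * infsum (\<lambda>v. Q v \<tau>) reps"
  unfolding Es_def infsum_cmult_right'[symmetric]
proof (rule infsum_cong)
  fix v assume "\<tau> \<in> uhp" "v \<in> reps"
  then show "tm v \<tau> = eta_quot p r1 rp \<tau> * Q v \<tau>"
    using u_Q[of "fst v" "snd v" \<tau>] by (simp add: tm_def)
qed

text \<open>The integers 2 D k and 2 D k' differ by 4 D m, a multiple of 2 D, so a (2 D)-th root of
  unity does not see the change of weight.\<close>

lemma root_powi_weight:
  fixes \<epsilon> :: complex
  assumes "\<epsilon> ^ (2 * D) = 1"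
  shows "\<epsilon> powi (- \<lfloor>real (2 * D) * k\<rfloor>) = \<epsilon> powi (- \<lfloor>real (2 * D) * ((r1 + rp) / 2)\<rfloor>)"
proof -
  have \<epsilon>0: "\<epsilon> \<noteq> 0" using assms D by (auto simp: power_0_left)
  have "real (2 * D) * k = real (2 * D) * ((r1 + rp) / 2) + of_int (4 * int D * m)"
    by (simp add: k algebra_simps)
  then have fl: "\<lfloor>real (2 * D) * k\<rfloor> = \<lfloor>real (2 * D) * ((r1 + rp) / 2)\<rfloor> + 4 * int D * m"
    by (simp only: floor_add_int)
  have one: "\<epsilon> powi (4 * int D * m) = 1"
  proof -
    have "\<epsilon> powi (4 * int D * m) = (\<epsilon> powi int (2 * D)) powi (2 * m)"
      by (simp add: power_int_mult[symmetric] mult_ac)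
    then show ?thesis using assms by (simp only: power_int_of_nat power_int_1_left)
  qed
  show ?thesis
    unfolding fl power_int_minus power_int_add[OF disjI1[OF \<epsilon>0]] one by (simp only: mult_1_right)
qed

lemma Es_slash:
  assumes g: "g \<in> cover_preimage (2 * D) (Gamma0 p)" and \<tau>: "\<tau> \<in> uhp"
  shows "slash (2 * D) k Es g \<tau> = eta_mult D p r1 rp g * Es \<tau>"
proof -
  obtain M \<epsilon> where g': "g = cover_elt (2 * D) M \<epsilon>" "M \<in> carrier SL2R" "\<epsilon> ^ (2 * D) = 1" "M \<in> Gamma0 p"
    using g by (auto simp: cover_preimage_def elim!: SL2R_cover_cases)
  obtain A B C F where M: "M = imat A B C F" "A * F - B * C = 1" "int p dvd C"
    using g'(4) by (rule Gamma0_cases)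
  define j where "j = aff C F \<tau>"
  have j: "j \<noteq> 0" unfolding j_def by (rule linear_nonzero[OF \<tau> det_1_nonzero[OF M(2)]])
  define \<sigma> where "\<sigma> = moeb A B C F \<tau>"
  have \<sigma>: "\<sigma> \<in> uhp" unfolding \<sigma>_def by (rule moeb_in_uhp[OF \<tau> M(2)])
  define n where "n = - \<lfloor>real (2 * D) * ((r1 + rp) / 2)\<rfloor>"
  \<comment> \<open>The weight k is separated into k', absorbed by the law of f, and the integral
    exponent 2m, absorbed by the Poincare series.\<close>
  have Ej: "exp (- of_real k * Ln j) = exp (- of_real ((r1 + rp) / 2) * Ln j) * j powi (- 2 * m)"
    unfolding exp_Ln_powi[OF j, symmetric] exp_add[symmetric]
    by (rule arg_cong[where f = exp]) (simp add: k algebra_simps)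
  have "slash (2 * D) k Es g \<tau> = \<epsilon> powi n * exp (- of_real k * Ln j) * Es \<sigma>"
    unfolding g'(1) slash_cover_elt[OF g'(2) \<tau>] root_powi_weight[OF g'(3)] n_def[symmetric]
    by (simp only: M(1) moebius_imat autom_factor_imat j_def \<sigma>_def)
  also have "Es \<sigma> = eta_quot p r1 rp \<sigma> * (j powi (2 * m) * infsum (\<lambda>v. Q v \<tau>) reps)"
    unfolding Es_eq[OF \<sigma>] unfolding \<sigma>_def j_def infsum_Q_moeb[OF M(2,3) \<tau>] ..
  also have "\<epsilon> powi n * exp (- of_real k * Ln j) * \<dots> =
      (\<epsilon> powi n * exp (- of_real ((r1 + rp) / 2) * Ln j) * eta_quot p r1 rp \<sigma>) * infsum (\<lambda>v. Q v \<tau>) reps"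
    unfolding Ej using j by (simp add: power_int_minus field_simps)
  also have "\<epsilon> powi n * exp (- of_real ((r1 + rp) / 2) * Ln j) * eta_quot p r1 rp \<sigma> =
      slash (2 * D) ((r1 + rp) / 2) (eta_quot p r1 rp) g \<tau>"
    unfolding g'(1) slash_cover_elt[OF g'(2) \<tau>] n_def[symmetric]
    by (simp only: M(1) moebius_imat autom_factor_imat j_def \<sigma>_def)
  also have "\<dots> = eta_mult D p r1 rp g * eta_quot p r1 rp \<tau>"
    by (rule eta_mult_props(2)[OF p D r g \<tau>])
  finally show ?thesis by (simp add: Es_eq[OF \<tau>])
qed

text \<open>For matrices outside Gamma_0(p) the series does not return to itself. The slashed terms,
  indexed by their transformed rows, still have size |c' tau + d'|^(-k), so they again form a
  lattice series and \<open>has_limit\<close> applies.\<close>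

lemma Es_limit:
  assumes g: "g \<in> cover_preimage (2 * D) SL2Z"
  shows "\<exists>L. (slash (2 * D) k Es g \<longlongrightarrow> L) (filtercomap Im at_top)"
proof -
  obtain M \<epsilon> where g': "g = cover_elt (2 * D) M \<epsilon>" "M \<in> carrier SL2R" "M \<in> SL2Z"
    using g by (auto simp: cover_preimage_def elim!: SL2R_cover_cases)
  obtain A B C F where M: "M = imat A B C F" "A * F - B * C = 1"
    using g'(3) by (rule SL2Z_cases)
  define j where "j \<tau> = aff C F \<tau>" for \<tau> :: complex
  have j: "j \<tau> \<noteq> 0" if "\<tau> \<in> uhp" for \<tau>
    unfolding j_def by (rule linear_nonzero[OF that det_1_nonzero[OF M(2)]])
  define I' where "I' = act A B C F ` reps"
  \<comment> \<open>The inverse action recovers the original row from the transformed one that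
    serves as index.\<close>
  define t' where "t' v \<tau> = exp (- of_real k * Ln (j \<tau>)) * tm (act F (- B) (- C) A v) (moeb A B C F \<tau>)" for v \<tau>
  have t'_act: "t' (act A B C F v) \<tau> = exp (- of_real k * Ln (j \<tau>)) * tm v (moeb A B C F \<tau>)" for v \<tau>
    by (simp add: t'_def act_inverse[OF M(2)])
  have "lattice_series k I' t'"
  proof
    show "k > 2" by (rule k)
    show "I' \<subseteq> lat"
    proof
      fix v assume "v \<in> I'"
      then obtain w where w: "w \<in> reps" "v = act A B C F w" by (auto simp: I'_def)
      have "v \<noteq> (0, 0)"
      proof
        assume "v = (0, 0)"
        then have "w = (0, 0)" using act_inverse[OF M(2), of w] w(2) by (simp add: act_def)
        then show False using w(1) reps_lat by (auto simp: lat_def)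
      qed
      then show "v \<in> lat" by (simp add: lat_def)
    qed
    fix c' d' \<tau> assume *: "(c', d') \<in> I'" "\<tau> \<in> uhp"
    then obtain c d where w: "(c, d) \<in> reps" "(c', d') = act A B C F (c, d)" by (auto simp: I'_def)
    then have cd': "c' = c * A + d * C" "d' = c * B + d * F" by (auto simp: act_def)
    note \<sigma> = moeb_in_uhp[OF *(2) M(2)]
    have "norm (t' (c', d') \<tau>) = norm (j \<tau>) powr (- k) * norm (of_int c * moeb A B C F \<tau> + of_int d) powr (- k)"
      unfolding w(2) t'_act using norm_u[OF w(1)] norm_exp_Ln[OF reps_linear_nonzero[OF w(1) \<sigma>], of k]
        norm_exp_Ln[OF j[OF *(2)], of k]
      by (simp add: tm_def norm_mult)
    also have "\<dots> = (norm (j \<tau>) * norm (of_int c * moeb A B C F \<tau> + of_int d)) powr (- k)"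
      by (rule powr_mult[symmetric])
    also have "norm (j \<tau>) * norm (of_int c * moeb A B C F \<tau> + of_int d) = norm (aff c' d' \<tau>)"
      unfolding linear_moeb[OF *(2) M(2)] cd' j_def[symmetric] using j[OF *(2)] by (simp add: norm_divide)
    finally show "norm (t' (c', d') \<tau>) \<le> norm (aff c' d' \<tau>) powr (- k)" by simp
  qed
  moreover have "t' (0, d') \<tau> = t' (0, d') \<i>" if *: "(0, d') \<in> I'" "\<tau> \<in> uhp" for d' \<tau>
  proof -
    obtain c d where w: "(c, d) \<in> reps" "(0, d') = act A B C F (c, d)" using * by (auto simp: I'_def)
    then have cd': "c * A + d * C = 0" "c * B + d * F = d'" by (auto simp: act_def)
    have "coprime c d" using w(1) rows_coprime by (auto simp: reps_def)
    \<comment> \<open>Completing the row to a matrix makes \<open>Ln_cocycle\<close> available. The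
      product with (A, B; C, F) has lower row (0, d'), so the two logarithms combine to the constant
      log d' + 2 pi i w'.\<close>
    then obtain a b where ab: "a * d - b * c = 1" by (rule coprime_complete)
    obtain w' where w': "\<And>\<tau>. \<tau> \<in> uhp \<Longrightarrow>
        Ln (autom_factor (imat a b c d) (moebius (imat A B C F) \<tau>)) + Ln (autom_factor (imat A B C F) \<tau>) =
        Ln (autom_factor (imat a b c d ** imat A B C F) \<tau>) + tpi * of_int w'"
      by (rule Ln_cocycle[OF imat_SL2R[OF ab] imat_SL2R[OF M(2)]]) blast
    have "t' (0, d') \<tau> = u (c, d) * exp (- of_real k * (Ln (of_int d') + tpi * of_int w'))"
      if "\<tau> \<in> uhp" for \<tau>
    proof -
      have "Ln (of_int c * moeb A B C F \<tau> + of_int d) + Ln (j \<tau>) = Ln (of_int d') + tpi * of_int w'"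
        using w'[OF that] unfolding imat_mult autom_factor_imat moebius_imat cd' j_def by simp
      then have "exp (- of_real k * Ln (j \<tau>)) * exp (- of_real k * Ln (of_int c * moeb A B C F \<tau> + of_int d)) =
          exp (- of_real k * (Ln (of_int d') + tpi * of_int w'))"
        unfolding exp_add[symmetric] distrib_left[symmetric] by (simp only: add.commute)
      then show ?thesis unfolding w(2) t'_act by (simp add: tm_def mult_ac)
    qed
    then show ?thesis using *(2) by simp
  qed
  ultimately obtain L where L: "((\<lambda>\<tau>. infsum (\<lambda>v. t' v \<tau>) I') \<longlongrightarrow> L) (filtercomap Im at_top)"
    using lattice_series.has_limit by blast
  define c where "c = \<epsilon> powi (- \<lfloor>real (2 * D) * k\<rfloor>)"
  have inj: "inj_on (act A B C F) reps"
    using act_inverse[OF M(2)] by (metis inj_onI)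
  have "slash (2 * D) k Es g \<tau> = c * infsum (\<lambda>v. t' v \<tau>) I'" if \<tau>: "\<tau> \<in> uhp" for \<tau>
  proof -
    have "slash (2 * D) k Es g \<tau> = c * (exp (- of_real k * Ln (j \<tau>)) * Es (moeb A B C F \<tau>))"
      unfolding g'(1) slash_cover_elt[OF g'(2) \<tau>] c_def[symmetric]
      by (simp only: M(1) moebius_imat autom_factor_imat j_def mult.assoc)
    also have "exp (- of_real k * Ln (j \<tau>)) * Es (moeb A B C F \<tau>) = infsum (\<lambda>v. t' (act A B C F v) \<tau>) reps"
      unfolding t'_act Es_def by (rule infsum_cmult_right'[symmetric])
    also have "\<dots> = infsum (\<lambda>v. t' v \<tau>) I'"
      unfolding I'_def by (subst infsum_reindex[OF inj]) (simp add: o_def)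
    finally show ?thesis .
  qed
  moreover have "eventually (\<lambda>\<tau>. \<tau> \<in> uhp) (filtercomap Im at_top)"
    unfolding uhp_def mem_Collect_eq by (rule eventually_filtercomapI[OF eventually_gt_at_top])
  ultimately have "eventually (\<lambda>\<tau>. slash (2 * D) k Es g \<tau> = c * infsum (\<lambda>v. t' v \<tau>) I') (filtercomap Im at_top)"
    by (auto elim: eventually_mono)
  then have "(slash (2 * D) k Es g \<longlongrightarrow> c * L) (filtercomap Im at_top)"
    using tendsto_mult[OF tendsto_const L, of c] by (simp add: tendsto_cong)
  then show ?thesis ..
qed

lemma slash_cong:
  assumes "\<And>\<tau>. \<tau> \<in> uhp \<Longrightarrow> f \<tau> = f' \<tau>" "g \<in> carrier (SL2R_cover N)" "\<tau> \<in> uhp"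
  shows "slash N k f g \<tau> = slash N k f' g \<tau>"
  using assms moebius_in_uhp[OF _ assms(3)] by (auto simp: slash_def elim!: SL2R_cover_cases)

theorem eisenstein_summable:
  assumes "\<tau> \<in> uhp"
  shows "(\<lambda>(c, d). u (c, d) * exp (- of_real k * Ln (aff c d \<tau>))) summable_on reps"
  using tm_summable[OF assms] by (simp add: tm_def case_prod_unfold)

theorem eisenstein_modular_form:
  assumes E: "\<And>\<tau>. \<tau> \<in> uhp \<Longrightarrow> E \<tau> = infsum (\<lambda>(c, d). u (c, d) * exp (- of_real k * Ln (aff c d \<tau>))) reps"
  shows "E \<in> modular_forms (2 * D) k (Gamma0 p) (eta_mult D p r1 rp)"
proof (rule modular_formsI)
  have E_Es: "E \<tau> = Es \<tau>" if "\<tau> \<in> uhp" for \<tau>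
    using E[OF that] by (simp add: Es_def tm_def case_prod_unfold)
  show "real (2 * D) * k \<in> \<int>" by (rule weight_int_k)
  show "finite_index_subgroup (Gamma0 p) (SL2R\<lparr>carrier := SL2Z\<rparr>)" by (rule finite_index_Gamma0[OF p])
  show "finite_index_character (2 * D) (Gamma0 p) (eta_mult D p r1 rp)" by (rule eta_mult_character[OF p D r])
  show "E holomorphic_on uhp" using holomorphic_Es E_Es by (metis holomorphic_transform)
  show "slash (2 * D) k E g \<tau> = eta_mult D p r1 rp g * E \<tau>"
    if "g \<in> cover_preimage (2 * D) (Gamma0 p)" "\<tau> \<in> uhp" for g \<tau>
    using Es_slash[OF that] slash_cong[OF E_Es, where g = g and N = "2 * D" and \<tau> = \<tau>] E_Es[OF that(2)] that
    by (simp add: cover_preimage_def)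
  fix g assume g: "g \<in> cover_preimage (2 * D) SL2Z"
  then obtain L where L: "(slash (2 * D) k Es g \<longlongrightarrow> L) (filtercomap Im at_top)"
    using Es_limit by blast
  have "eventually (\<lambda>\<tau>. \<tau> \<in> uhp) (filtercomap Im at_top)"
    unfolding uhp_def mem_Collect_eq by (rule eventually_filtercomapI[OF eventually_gt_at_top])
  then have "eventually (\<lambda>\<tau>. slash (2 * D) k E g \<tau> = slash (2 * D) k Es g \<tau>) (filtercomap Im at_top)"
    by eventually_elim (rule slash_cong[OF E_Es], use g in \<open>auto simp: cover_preimage_def\<close>)
  then show "\<exists>L. (slash (2 * D) k E g \<longlongrightarrow> L) (filtercomap Im at_top)"
    using L by (auto simp: tendsto_cong)
qed

end

text \<open>The values of a summand for the admissible auxiliary integers form the set \<open>V c d\<close>. They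
  are forced to coincide because the right-hand side of \<open>V_val\<close> does not depend on the choice.\<close>

theorem eisenstein_series:
  fixes V :: "int \<Rightarrow> int \<Rightarrow> complex set" and r1 rp k :: real
  assumes p: "p > 0" and D: "D > 0" and r: "real D * r1 \<in> \<int>" "real D * rp \<in> \<int>"
    and k: "k = (r1 + rp) / 2 + 2 * of_int m" "k > 2"
    and J: "J = {v \<in> reps. fst v \<noteq> 0}"
    and V_ne: "\<And>c d. (c, d) \<in> J \<Longrightarrow> V c d \<noteq> {}"
    and V_norm: "\<And>c d x. x \<in> V c d \<Longrightarrow> norm x = 1"
    and V_val: "\<And>c d x \<tau>. (c, d) \<in> J \<Longrightarrow> x \<in> V c d \<Longrightarrow> \<tau> \<in> uhp \<Longrightarrow>
      x * exp (- of_real k * Ln (aff c d \<tau>)) = eta_quot p r1 rp \<tau> * Q (c, d) \<tau>"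
    and Q0: "\<And>\<tau>. (0, 1) \<in> reps \<Longrightarrow> \<tau> \<in> uhp \<Longrightarrow> eta_quot p r1 rp \<tau> * Q (0, 1) \<tau> = 1"
  defines "S \<equiv> \<lambda>\<tau>. \<lambda>(c, d). (aff c d \<tau>) powr (- of_real k) * the_elem (V c d)"
  shows "\<forall>(c, d)\<in>J. is_singleton (V c d)" "\<forall>\<tau>\<in>uhp. S \<tau> summable_on J"
    "(\<lambda>\<tau>. (if (0, 1) \<in> reps then 1 else 0) + infsum (S \<tau>) J)
      \<in> modular_forms (2 * D) k (Gamma0 p) (eta_mult D p r1 rp)"
proof -
  have V_eq: "V c d = {eta_quot p r1 rp \<i> * Q (c, d) \<i> / exp (- of_real k * Ln (aff c d \<i>))}"
    (is "_ = {?U}") if cd: "(c, d) \<in> J" for c d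
  proof -
    have "x = ?U" if "x \<in> V c d" for x
      using V_val[OF cd that ii_in_uhp] by (simp add: eq_divide_eq)
    then show ?thesis using V_ne[OF cd] by blast
  qed
  then show "\<forall>(c, d)\<in>J. is_singleton (V c d)" by (simp add: case_prod_unfold)
  \<comment> \<open>The value 1 at c = 0 encodes the leading 1 of the series at infinity as the
    summand of the row (0, 1).\<close>
  define u where "u v = (if fst v = 0 then 1 else the_elem (V (fst v) (snd v)))" for v
  have u: "u (c, d) \<in> V c d" if "(c, d) \<in> J" for c d
    using V_eq[OF that] that by (simp add: u_def J)
  have dichotomy: "(c, d) = (0, 1) \<or> (c, d) \<in> J" if "(c, d) \<in> reps" for c d
    using that reps_0[of d] unfolding J by (cases "c = 0") auto
  have norm_u: "norm (u v) = 1" if "v \<in> reps" for v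
  proof -
    obtain c d where v: "v = (c, d)" by (cases v)
    from dichotomy that consider "v = (0, 1)" | "(c, d) \<in> J" unfolding v by blast
    then show ?thesis
    proof cases
      case 2
      then show ?thesis unfolding v by (rule V_norm[OF u])
    qed (simp add: u_def)
  qed
  have u_Q: "u (c, d) * exp (- of_real k * Ln (aff c d \<tau>)) = eta_quot p r1 rp \<tau> * Q (c, d) \<tau>"
    if cd: "(c, d) \<in> reps" and \<tau>: "\<tau> \<in> uhp" for c d \<tau>
    using dichotomy[OF cd]
  proof
    assume "(c, d) = (0, 1)"
    then show ?thesis using Q0[OF _ \<tau>] cd by (simp add: u_def)
  next
    assume "(c, d) \<in> J"
    from V_val[OF this u[OF this] \<tau>] show ?thesis .
  qed
  define t where "t \<tau> = (\<lambda>(c, d). u (c, d) * exp (- of_real k * Ln (aff c d \<tau>)))" for \<tau> :: complex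
  have S_t: "S \<tau> v = t \<tau> v" if v: "v \<in> J" and \<tau>: "\<tau> \<in> uhp" for v \<tau>
  proof -
    obtain c d where cd: "v = (c, d)" by (cases v)
    have "c \<noteq> 0" using v by (auto simp: J cd)
    then have "aff c d \<tau> \<noteq> 0" by (intro linear_nonzero[OF \<tau>]) auto
    then show ?thesis using \<open>c \<noteq> 0\<close> unfolding cd S_def t_def by (simp add: u_def powr_def)
  qed
  have t_sum: "t \<tau> summable_on J" if "\<tau> \<in> uhp" for \<tau>
  proof (rule summable_on_subset_banach)
    show "t \<tau> summable_on reps"
      unfolding t_def using eisenstein_summable[OF p D r k norm_u u_Q that] .
  qed (auto simp: J)
  then show "\<forall>\<tau>\<in>uhp. S \<tau> summable_on J"
    by (auto simp: S_t cong: summable_on_cong)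
  have "(if (0, 1) \<in> reps then 1 else 0) + infsum (S \<tau>) J = infsum (t \<tau>) reps" if \<tau>: "\<tau> \<in> uhp" for \<tau>
  proof -
    have SJ: "infsum (S \<tau>) J = infsum (t \<tau>) J" using S_t[OF _ \<tau>] by (intro infsum_cong) simp
    show ?thesis
    proof (cases "(0, 1) \<in> reps")
      case True
      have "v \<in> reps \<longleftrightarrow> v \<in> insert (0, 1) J" for v
        using True dichotomy[of "fst v" "snd v"] unfolding J by auto
      then have "reps = insert (0, 1) J" by blast
      moreover have "infsum (t \<tau>) (insert (0, 1) J) = t \<tau> (0, 1) + infsum (t \<tau>) J"
        by (rule infsum_insert[OF t_sum[OF \<tau>]]) (simp add: J)
      moreover have "t \<tau> (0, 1) = 1" by (simp add: t_def u_def)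
      ultimately show ?thesis using True SJ by simp
    next
      case False
      have "v \<in> reps \<longleftrightarrow> v \<in> J" for v
        using False dichotomy[of "fst v" "snd v"] unfolding J by auto
      then have "reps = J" by blast
      then show ?thesis using False SJ by simp
    qed
  qed
  then show "(\<lambda>\<tau>. (if (0, 1) \<in> reps then 1 else 0) + infsum (S \<tau>) J)
      \<in> modular_forms (2 * D) k (Gamma0 p) (eta_mult D p r1 rp)"
    unfolding t_def by (intro eisenstein_modular_form[OF p D r k norm_u u_Q])
qed

end


section \<open>The two cusps\<close>

lemma exp_minus_weight:
  assumes "k = k' + 2 * of_int m" "z \<noteq> 0"
  shows "exp (- of_real (k - k') * Ln z) = z powi (- 2 * m)"
  unfolding exp_Ln_powi[OF assms(2), symmetric] using assms(1) by simp

lemma exp_minus_int_shift: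
  assumes "x \<in> \<int>"
  shows "exp (- (z + tpi * of_int n * of_real x)) = exp (- z)"
proof -
  obtain y where y: "x = of_int y" using assms by (auto elim: Ints_cases)
  have "exp (- (z + tpi * of_int n * of_real x)) = exp (- z) * e (of_int (- n * y))"
    by (simp add: e_def exp_add[symmetric] y algebra_simps)
  then show ?thesis by (simp only: e_of_int mult_1_right)
qed

text \<open>Two matrices with the same lower row differ by a translation on the left, under which
  1/f is invariant because n_inf is an integer.\<close>

lemma poincare_inf:
  assumes "p > 0" "(r1 + real p * rp) / 24 \<in> \<int>"
  shows "poincare p (\<lambda>a b c d. a * d - b * c = 1 \<and> int p dvd c) (\<lambda>\<tau>. exp (- log_quot p r1 rp \<tau>))"
proof
  fix a b c d A B C E :: int
  assume "a * d - b * c = 1 \<and> int p dvd c" "A * E - B * C = 1" "int p dvd C"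
  then show "(a * A + b * C) * (c * B + d * E) - (a * B + b * E) * (c * A + d * C) = 1 \<and>
    int p dvd c * A + d * C"
    using det_mult by simp
next
  fix a b c d a' b' :: int and \<tau> :: complex
  assume *: "a * d - b * c = 1 \<and> int p dvd c" "a' * d - b' * c = 1 \<and> int p dvd c" "\<tau> \<in> uhp"
  obtain n where n: "a' = a + n * c" "b' = b + n * d"
    using same_lower_row * by blast
  have det: "a * d - b * c = 1" using * by blast
  show "exp (- log_quot p r1 rp (moeb a' b' c d \<tau>)) = exp (- log_quot p r1 rp (moeb a b c d \<tau>))"
    unfolding n moeb_shift[OF *(3) det] log_quot_plus_of_int[OF moeb_in_uhp[OF *(3) det] assms(1)]
    by (rule exp_minus_int_shift[OF assms(2)])
qed auto

text \<open>A logarithm of \<open>f|\<gamma>\<^sub>1\<close>.\<close>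

definition log_quot1 :: "nat \<Rightarrow> real \<Rightarrow> real \<Rightarrow> complex \<Rightarrow> complex" where
  "log_quot1 p r1 rp \<tau> = log_quot p r1 rp (moeb 1 0 1 1 \<tau>) - of_real ((r1 + rp) / 2) * Ln (\<tau> + 1)"

text \<open>The matrix (p, 0; 1, 1) equals (p, -1; 1, 0) (1, 1; 0, p). The left factor lies in
  SL_2(Z), so the law of log eta removes it at the cost of a logarithm, which cancels, and a
  constant.\<close>

lemma log_quot1_eq:
  assumes "p > 0"
  obtains K where "\<And>\<tau>. \<tau> \<in> uhp \<Longrightarrow>
    log_quot1 p r1 rp \<tau> = of_real r1 * log_eta \<tau> + of_real rp * log_eta ((\<tau> + 1) / of_nat p) + K"
proof -
  define K1 K2 where "K1 = tpi * of_real (eta_phase (1 + 1) 1 1)"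
    and "K2 = tpi * complex_of_real (eta_phase (int p + 0) 0 1)"
  show ?thesis
  proof (rule that)
    fix \<tau> assume \<tau>: "\<tau> \<in> uhp"
    have \<tau>1: "\<tau> + 1 \<noteq> 0" using \<tau> by (auto simp: uhp_def complex_eq_iff)
    have \<sigma>: "(\<tau> + 1) / of_nat p \<in> uhp" using \<tau> assms by (simp add: uhp_def Im_divide_of_nat)
    have e1: "of_nat p * moeb 1 0 1 1 \<tau> = moeb (int p) (- 1) 1 0 ((\<tau> + 1) / of_nat p)"
      using \<tau>1 assms by (simp add: moeb_def field_simps)
    have e2: "log_eta (moeb (int p) (- 1) 1 0 ((\<tau> + 1) / of_nat p)) =
        log_eta ((\<tau> + 1) / of_nat p) + Ln ((\<tau> + 1) / of_nat p) / 2 + K2"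
      using log_eta_moeb[of 1 "int p" 0 "- 1", OF _ _ \<sigma>] by (simp add: K2_def)
    \<comment> \<open>Division by a positive real number never crosses the cut.\<close>
    have e3: "Ln ((\<tau> + 1) / of_nat p) = Ln (\<tau> + 1) - of_real (ln (real p))"
      using Ln_divide_of_real[of "real p" "\<tau> + 1"] \<tau>1 assms by simp
    have e4: "log_eta (moeb 1 0 1 1 \<tau>) = log_eta \<tau> + Ln (\<tau> + 1) / 2 + K1"
      using log_eta_moeb[of 1 1 1 0, OF _ _ \<tau>] by (simp add: K1_def)
    show "log_quot1 p r1 rp \<tau> = of_real r1 * log_eta \<tau> + of_real rp * log_eta ((\<tau> + 1) / of_nat p)
        + (of_real r1 * K1 + of_real rp * (K2 - of_real (ln (real p)) / 2))"
      unfolding log_quot1_def log_quot_def e1 e2 e3 e4 by (simp add: field_simps)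
  qed
qed

lemma log_quot1_shift:
  assumes "p > 0" "\<tau> \<in> uhp"
  shows "log_quot1 p r1 rp (\<tau> + of_int (int p * n)) =
    log_quot1 p r1 rp \<tau> + tpi * of_int n * of_real ((real p * r1 + rp) / 24)"
proof -
  obtain K where K: "\<And>\<tau>. \<tau> \<in> uhp \<Longrightarrow>
    log_quot1 p r1 rp \<tau> = of_real r1 * log_eta \<tau> + of_real rp * log_eta ((\<tau> + 1) / of_nat p) + K"
    by (rule log_quot1_eq[OF assms(1)]) blast
  have \<sigma>: "(\<tau> + 1) / of_nat p \<in> uhp" using assms by (simp add: uhp_def Im_divide_of_nat)
  have eq: "(\<tau> + of_int (int p * n) + 1) / of_nat p = (\<tau> + 1) / of_nat p + of_int n"
    using assms(1) by (simp add: field_simps)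
  show ?thesis
    unfolding K[OF assms(2)] K[OF uhp_add_int[OF assms(2)]] eq
      log_eta_plus_of_int[OF \<sigma>] log_eta_plus_of_int[OF assms(2)]
    by (simp add: field_simps)
qed

lemma prime_not_dvd_lower:
  assumes "prime p" "a * d - b * c = (1 :: int)" "int p dvd a + c"
  shows "\<not> int p dvd c"
proof
  assume "int p dvd c"
  moreover have "int p dvd a" using assms(3) calculation by (metis dvd_add_left_iff)
  ultimately have "int p dvd a * d - b * c" by simp
  then show False using assms(1,2) by (auto dest: prime_gt_1_nat)
qed

text \<open>If a' = a + n c and p divides both a + c and a' + c, then p divides n c. It does not
  divide c, since otherwise it would divide a and hence the determinant. As p is prime, n is a
  multiple of p, and f|gamma_1 only has to be invariant under translation by p.\<close>

lemma poincare_one: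
  assumes "prime p" "(real p * r1 + rp) / 24 \<in> \<int>"
  shows "poincare p (\<lambda>a b c d. a * d - b * c = 1 \<and> int p dvd a + c) (\<lambda>\<tau>. exp (- log_quot1 p r1 rp \<tau>))"
proof
  fix a b c d A B C E :: int
  assume *: "a * d - b * c = 1 \<and> int p dvd a + c" "A * E - B * C = 1" "int p dvd C"
  have "a * A + b * C + (c * A + d * C) = (a + c) * A + (b + d) * C" by (simp add: algebra_simps)
  then show "(a * A + b * C) * (c * B + d * E) - (a * B + b * E) * (c * A + d * C) = 1 \<and>
    int p dvd a * A + b * C + (c * A + d * C)"
    using * det_mult by simp
next
  fix a b c d a' b' :: int and \<tau> :: complex
  assume *: "a * d - b * c = 1 \<and> int p dvd a + c" "a' * d - b' * c = 1 \<and> int p dvd a' + c" "\<tau> \<in> uhp"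
  have p: "p > 0" using assms(1) by (simp add: prime_gt_0_nat)
  obtain n where n: "a' = a + n * c" "b' = b + n * d"
    using same_lower_row * by blast
  have det: "a * d - b * c = 1" using * by blast
  have "int p dvd (a + n * c + c) - (a + c)" using * unfolding n by (intro dvd_diff) auto
  then have "int p dvd n * c" by simp
  moreover have "\<not> int p dvd c" using prime_not_dvd_lower[OF assms(1)] * by blast
  ultimately have "int p dvd n" using assms(1) by (simp add: prime_dvd_mult_iff)
  then obtain n' where n': "n = int p * n'" by (auto simp: dvd_def)
  show "exp (- log_quot1 p r1 rp (moeb a' b' c d \<tau>)) = exp (- log_quot1 p r1 rp (moeb a b c d \<tau>))"
    unfolding n moeb_shift[OF *(3) det] unfolding n' log_quot1_shift[OF p moeb_in_uhp[OF *(3) det]]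
    by (rule exp_minus_int_shift[OF assms(2)])
next
  fix a b c d :: int assume "a * d - b * c = 1 \<and> int p dvd a + c"
  then show "- a * - d - - b * - c = 1 \<and> int p dvd - a + - c"
    by (metis add.commute dvd_minus_iff minus_add_distrib minus_mult_minus)
qed auto

context
  fixes p D :: nat and r1 rp k :: real and m :: int
  assumes prime: "prime p" and D: "D > 0" and r: "real D * r1 \<in> \<int>" "real D * rp \<in> \<int>"
    and k: "k = (r1 + rp) / 2 + 2 * of_int m" "k > 2"
begin

lemma p_pos: "p > 0"
  using prime by (rule prime_gt_0_nat)

lemma eis_inf_modular:
  assumes n_inf: "(r1 + real p * rp) / 24 \<in> \<int>"
  shows "eis_inf_well_defined k p r1 rp"
    and "eis_inf k p r1 rp \<in> modular_forms (2 * D) k (Gamma0 p) (eta_mult D p r1 rp)"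
proof -
  interpret poincare p m "\<lambda>a b c d. a * d - b * c = 1 \<and> int p dvd c" "\<lambda>\<tau>. exp (- log_quot p r1 rp \<tau>)"
    by (rule poincare_inf[OF p_pos n_inf])
  have reps_iff: "(c, d) \<in> reps \<longleftrightarrow> coprime c d \<and> int p dvd c \<and> pos_row (c, d)" for c d
    using det_1_coprime coprime_complete[of c d] unfolding reps_def rows_def by (auto; metis)
  have J: "eis_inf_index p = {v \<in> reps. fst v \<noteq> 0}"
  proof (rule Set.set_eqI)
    fix v :: "int \<times> int"
    obtain c d where v: "v = (c, d)" by (cases v)
    show "v \<in> eis_inf_index p \<longleftrightarrow> v \<in> {v \<in> reps. fst v \<noteq> 0}"
      unfolding v mem_Collect_eq reps_iff eis_inf_index_def coprime_iff_gcd_eq_1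
      by (auto simp: pos_row_def)
  qed
  have rep0: "(0, 1) \<in> reps" unfolding reps_iff by (simp add: pos_row_def)
  \<comment> \<open>For the identity matrix the summand is f times 1/f, which is the leading
    1.\<close>
  have Q0: "eta_quot p r1 rp \<tau> * Q (0, 1) \<tau> = 1" if "\<tau> \<in> uhp" for \<tau>
    using Q_eq[where a = 1 and b = 0 and c = 0 and d = 1, OF _ that]
    by (simp add: eta_quot_eq exp_add[symmetric] moeb_def)
  have val: "x * exp (- of_real k * Ln (aff c d \<tau>)) = eta_quot p r1 rp \<tau> * Q (c, d) \<tau>"
    if cd: "(c, d) \<in> eis_inf_index p" and x: "x \<in> eis_inf_values p r1 rp c d" and \<tau>: "\<tau> \<in> uhp" for c d x \<tau>
  proof -
    have c: "c > 0" "int p dvd c" using cd by (auto simp: eis_inf_index_def)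
    obtain a where a: "x = eis_factor p r1 rp a c d" "[a * d = 1] (mod c)"
      using x by (auto simp: eis_inf_values_def)
    then have "c dvd a * d - 1" by (simp add: cong_iff_dvd_diff)
    then obtain b where "a * d - 1 = c * b" by (auto simp: dvd_def)
    then have b: "a * d - b * c = 1" by (simp add: mult.commute)
    have nz: "aff c d \<tau> \<noteq> (0 :: complex)" by (rule linear_nonzero[OF \<tau> det_1_nonzero[OF b]])
    show ?thesis
      unfolding a(1) eis_factor_log_quot[OF p_pos c b \<tau>] exp_minus_weight[OF k(1) nz]
      using Q_eq[where a = a and b = b and c = c and d = d, OF _ \<tau>] b c by (simp add: mult_ac)
  qed
  have ne: "eis_inf_values p r1 rp c d \<noteq> {}" if "(c, d) \<in> eis_inf_index p" for c d
    using that cong_solve_coprime_int[of d c]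
    by (auto simp: eis_inf_values_def eis_inf_index_def coprime_iff_gcd_eq_1 gcd.commute mult.commute)
  have norm: "norm x = 1" if "x \<in> eis_inf_values p r1 rp c d" for c d x
    using that norm_eis_factor by (auto simp: eis_inf_values_def)
  note E = eisenstein_series[where V = "eis_inf_values p r1 rp", OF p_pos D r k J]
  show "eis_inf_well_defined k p r1 rp"
    unfolding eis_inf_well_defined_def eis_inf_term_def
    by (intro conjI E(1,2); rule ne norm val Q0; assumption)
  have "eis_inf k p r1 rp = (\<lambda>\<tau>. 1 + infsum (eis_inf_term k p r1 rp \<tau>) (eis_inf_index p))"
    by (simp add: eis_inf_def fun_eq_iff)
  moreover have "\<dots> \<in> modular_forms (2 * D) k (Gamma0 p) (eta_mult D p r1 rp)"
    unfolding eis_inf_term_def by (rule E(3)[unfolded if_P[OF rep0]]; rule ne norm val Q0; assumption)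
  ultimately show "eis_inf k p r1 rp \<in> modular_forms (2 * D) k (Gamma0 p) (eta_mult D p r1 rp)"
    by (simp only:)
qed

lemma int_p_coprime_iff: "gcd (int p) c = 1 \<longleftrightarrow> \<not> int p dvd c"
proof
  assume "gcd (int p) c = 1"
  moreover have "\<not> is_unit (int p)" using prime prime_gt_1_nat[of p] by simp
  ultimately show "\<not> int p dvd c" by (metis gcd_greatest dvd_refl)
next
  assume "\<not> int p dvd c"
  then show "gcd (int p) c = 1"
    using prime prime_imp_coprime[of "int p" c] by (simp add: coprime_iff_gcd_eq_1)
qed

text \<open>Any completion (a0, b0) may be changed by t times the lower row. With x an inverse of c
  modulo p, t congruent to -(a0 + c) x makes p divide a + c, and adding a large multiple of p to t
  makes a + c positive.\<close>

lemma eis_one_matrix_exists: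
  assumes "c > 0" "coprime c d" "\<not> int p dvd c"
  obtains a b where "a * d - b * c = 1" "int p dvd a + c" "a + c > 0"
proof -
  obtain a0 b0 where ab: "a0 * d - b0 * c = 1" by (rule coprime_complete[OF assms(2)])
  have "gcd (int p) c = 1" unfolding int_p_coprime_iff by (rule assms(3))
  then have "coprime c (int p)" by (metis coprime_iff_gcd_eq_1 coprime_commute)
  then obtain x where x: "[c * x = 1] (mod int p)" using cong_solve_coprime_int by blast
  \<comment> \<open>As p c is at least 1, this \<open>N\<close> outweighs both a0 and the
    contribution of -(a0 + c) x.\<close>
  define N where "N = \<bar>a0 + c\<bar> * \<bar>x\<bar> * c + \<bar>a0\<bar> + 1"
  define t where "t = - (a0 + c) * x + int p * N"
  have "[a0 + t * c + c = (a0 + c) * (1 - c * x)] (mod int p)"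
    unfolding t_def cong_iff_dvd_diff by (simp add: algebra_simps)
  moreover have "int p dvd 1 - c * x" using x by (metis cong_iff_dvd_diff cong_sym)
  ultimately have dvd: "int p dvd (a0 + t * c) + c"
    by (metis cong_dvd_iff dvd_mult)
  have "(a0 + t * c) + c > 0"
  proof -
    have Np: "N > 0" using assms(1) by (simp add: N_def add_nonneg_pos)
    have 1: "N * 1 \<le> N * (int p * c)"
      using Np p_pos assms(1) mult_pos_pos[of "int p" c] by (intro mult_left_mono) linarith+
    have "(a0 + c) * x \<le> \<bar>a0 + c\<bar> * \<bar>x\<bar>" by (metis abs_ge_self abs_mult)
    then have 2: "(a0 + c) * x * c \<le> \<bar>a0 + c\<bar> * \<bar>x\<bar> * c"
      using assms(1) by (intro mult_right_mono) auto
    have 3: "t * c = - ((a0 + c) * x * c) + N * (int p * c)"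
      by (simp add: t_def algebra_simps)
    have "a0 + s + c > 0" if "N * 1 \<le> P" "Y \<le> W" "s = - Y + P" "N = W + \<bar>a0\<bar> + 1" for P Y W s
      using that assms(1) by linarith
    from this[OF 1 2 3 N_def] show ?thesis .
  qed
  moreover have "(a0 + t * c) * d - (b0 + t * d) * c = 1" using ab by (simp add: algebra_simps)
  ultimately show ?thesis using that dvd by blast
qed

text \<open>The phase belongs to gamma_1 gamma, with lower row (a + c, b + d). Since c and a + c are
  positive, the three factors in J = (sigma + 1) j lie in the upper half plane and their logarithms
  add exactly, so the Ln(sigma + 1) built into \<open>log_quot1\<close> cancels without a branch
  correction.\<close>

lemma eis_factor_log_quot1:
  assumes "c > 0" "a + c > 0" "int p dvd a + c" "a * d - b * c = 1" "\<tau> \<in> uhp"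
  shows "eis_factor p r1 rp a (a + c) (b + d) * exp (- of_real k * Ln (aff c d \<tau>)) =
    eta_quot p r1 rp \<tau> * exp (- log_quot1 p r1 rp (moeb a b c d \<tau>)) *
    exp (- of_real (k - (r1 + rp) / 2) * Ln (aff c d \<tau>))"
proof -
  have det: "a * (b + d) - b * (a + c) = 1" using assms(4) by (simp add: algebra_simps)
  define \<sigma> j J where "\<sigma> = moeb a b c d \<tau>" and "j = aff c d \<tau>"
    and "J = aff (a + c) (b + d) \<tau>"
  have \<sigma>: "\<sigma> + 1 \<in> uhp" using moeb_in_uhp[OF assms(5,4)] uhp_add_int[of \<sigma> 1] by (simp add: \<sigma>_def)
  have j: "j \<in> uhp" unfolding j_def by (rule linear_in_uhp[OF assms(5,1)])
  have J: "J \<in> uhp" unfolding J_def by (rule linear_in_uhp[OF assms(5,2)])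
  have "(\<sigma> + 1) * j = J"
    using uhp_nonzero[OF j] by (simp add: \<sigma>_def j_def J_def moeb_def field_simps)
  then have LnJ: "Ln J = Ln (\<sigma> + 1) + Ln j"
    using Ln_mult_uhp[OF \<sigma> j] J by simp
  have "moeb 1 0 1 1 \<sigma> = moeb a b (a + c) (b + d) \<tau>"
    using moeb_moeb[OF assms(5,4), of 1 0 1 1] by (simp add: \<sigma>_def)
  then have G: "log_quot1 p r1 rp \<sigma> = log_quot p r1 rp \<tau> + of_real ((r1 + rp) / 2) * (Ln (\<sigma> + 1) + Ln j)
      + tpi * of_real (r1 * eta_phase (a + (b + d)) (b + d) (a + c)
        + rp * eta_phase (a + (b + d)) (b + d) ((a + c) div int p)) - of_real ((r1 + rp) / 2) * Ln (\<sigma> + 1)"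
    unfolding log_quot1_def using log_quot_moeb[OF p_pos assms(2,3) det assms(5), of r1 rp] LnJ by (simp only: J_def)
  show ?thesis
    unfolding eis_factor_eq eta_quot_eq exp_add[symmetric] \<sigma>_def[symmetric] j_def[symmetric] G
    by (rule arg_cong[where f = exp]) (simp add: field_simps)
qed

lemma eis_one_modular:
  assumes n_one: "(real p * r1 + rp) / 24 \<in> \<int>"
  shows "eis_one_well_defined k p r1 rp"
    and "eis_one k p r1 rp \<in> modular_forms (2 * D) k (Gamma0 p) (eta_mult D p r1 rp)"
proof -
  interpret poincare p m "\<lambda>a b c d. a * d - b * c = 1 \<and> int p dvd a + c" "\<lambda>\<tau>. exp (- log_quot1 p r1 rp \<tau>)"
    by (rule poincare_one[OF prime n_one])
  have reps_iff: "(c, d) \<in> reps \<longleftrightarrow> c > 0 \<and> coprime c d \<and> \<not> int p dvd c" for c d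
  proof
    assume *: "(c, d) \<in> reps"
    then obtain a b where ab: "a * d - b * c = 1" "int p dvd a + c" by (auto simp: reps_def rows_def)
    have "\<not> int p dvd c" by (rule prime_not_dvd_lower[OF prime ab])
    moreover have "c > 0" using * calculation by (auto simp: reps_def pos_row_def)
    ultimately show "c > 0 \<and> coprime c d \<and> \<not> int p dvd c" using det_1_coprime[OF ab(1)] by simp
  next
    assume "c > 0 \<and> coprime c d \<and> \<not> int p dvd c"
    then obtain a b where "a * d - b * c = 1" "int p dvd a + c" "c > 0"
      using eis_one_matrix_exists by blast
    then show "(c, d) \<in> reps" by (auto simp: reps_def rows_def pos_row_def)
  qed
  have idx: "(c, d) \<in> eis_one_index p \<longleftrightarrow> c > 0 \<and> coprime c d \<and> \<not> int p dvd c" for c d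
    by (simp add: eis_one_index_def int_p_coprime_iff coprime_iff_gcd_eq_1)
  have J: "eis_one_index p = {v \<in> reps. fst v \<noteq> 0}"
  proof (rule Set.set_eqI)
    fix v :: "int \<times> int"
    obtain c d where v: "v = (c, d)" by (cases v)
    show "v \<in> eis_one_index p \<longleftrightarrow> v \<in> {v \<in> reps. fst v \<noteq> 0}"
      unfolding v mem_Collect_eq reps_iff idx by auto
  qed
  \<comment> \<open>A lower row at this cusp is never divisible by p in its first entry, in
    particular not 0, so the series has no leading constant.\<close>
  have rep0: "(0, 1) \<notin> reps" unfolding reps_iff by simp
  have val: "x * exp (- of_real k * Ln (aff c d \<tau>)) = eta_quot p r1 rp \<tau> * Q (c, d) \<tau>"
    if cd: "(c, d) \<in> eis_one_index p" and x: "x \<in> eis_one_values p r1 rp c d" and \<tau>: "\<tau> \<in> uhp" for c d x \<tau>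
  proof -
    obtain a b where a: "x = eis_factor p r1 rp a (a + c) (b + d)" "a * d - b * c = 1" "int p dvd a + c" "a + c > 0"
      using x by (auto simp: eis_one_values_def)
    have c: "c > 0" using cd idx by simp
    have nz: "aff c d \<tau> \<noteq> (0 :: complex)" by (rule linear_nonzero[OF \<tau> det_1_nonzero[OF a(2)]])
    show ?thesis
      unfolding a(1) eis_factor_log_quot1[OF c a(4,3,2) \<tau>] exp_minus_weight[OF k(1) nz]
      using Q_eq[where a = a and b = b and c = c and d = d, OF _ \<tau>] a by (simp add: mult_ac)
  qed
  have ne: "eis_one_values p r1 rp c d \<noteq> {}" if "(c, d) \<in> eis_one_index p" for c d
  proof -
    have c: "c > 0" "coprime c d" "\<not> int p dvd c" using that unfolding idx by simp_all
    obtain a b where "a * d - b * c = 1" "int p dvd a + c" "a + c > 0"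
      by (rule eis_one_matrix_exists[OF c])
    then show ?thesis unfolding eis_one_values_def by (simp only: Collect_empty_eq) blast
  qed
  have norm: "norm x = 1" if "x \<in> eis_one_values p r1 rp c d" for c d x
    using that norm_eis_factor by (auto simp: eis_one_values_def)
  have Q0: "eta_quot p r1 rp \<tau> * Q (0, 1) \<tau> = 1" if "(0, 1) \<in> reps" for \<tau>
    using that rep0 by contradiction
  note E = eisenstein_series[where V = "eis_one_values p r1 rp", OF p_pos D r k J]
  show "eis_one_well_defined k p r1 rp"
    unfolding eis_one_well_defined_def eis_one_term_def
    by (intro conjI E(1,2); rule ne norm val Q0; assumption)
  have "eis_one k p r1 rp = (\<lambda>\<tau>. 0 + infsum (eis_one_term k p r1 rp \<tau>) (eis_one_index p))"
    by (simp add: eis_one_def fun_eq_iff)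
  moreover have "\<dots> \<in> modular_forms (2 * D) k (Gamma0 p) (eta_mult D p r1 rp)"
    unfolding eis_one_term_def by (rule E(3)[unfolded if_not_P[OF rep0]]; rule ne norm val Q0; assumption)
  ultimately show "eis_one k p r1 rp \<in> modular_forms (2 * D) k (Gamma0 p) (eta_mult D p r1 rp)"
    by (simp only:)
qed

section \<open>Values of the multiplier on the stabilisers of the two cusps\<close>

lemma eta_mult_T:
  "eta_mult D p r1 rp (cover_lift (2 * D) (imat 1 1 0 1)) = e (of_real ((r1 + real p * rp) / 24))"
proof (rule eta_mult_eqI[OF p_pos D r])
  fix \<tau> assume \<tau>: "\<tau> \<in> uhp"
  have M: "imat 1 1 0 1 \<in> carrier SL2R" by (rule imat_SL2R) simp
  have "slash (2 * D) ((r1 + rp) / 2) (eta_quot p r1 rp) (cover_lift (2 * D) (imat 1 1 0 1)) \<tau> =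
      eta_quot p r1 rp (\<tau> + of_int 1)"
    unfolding cover_lift_def slash_cover_elt[OF M \<tau>] moebius_imat autom_factor_imat
    by (simp add: moeb_def)
  also have "\<dots> = e (of_real ((r1 + real p * rp) / 24)) * eta_quot p r1 rp \<tau>"
    unfolding eta_quot_eq log_quot_plus_of_int[OF \<tau> p_pos] exp_add by (simp add: e_def)
  finally show "slash (2 * D) ((r1 + rp) / 2) (eta_quot p r1 rp) (cover_lift (2 * D) (imat 1 1 0 1)) \<tau> =
      e (of_real ((r1 + real p * rp) / 24)) * eta_quot p r1 rp \<tau>" .
qed

text \<open>Translations have automorphy factor 1, so the cocycle integer is 0 and no root of unity
  accumulates.\<close>

lemma cover_lift_T_power:
  "cover_lift N (imat 1 1 0 1) [^]\<^bsub>SL2R_cover N\<^esub> n = cover_elt N (imat 1 (int n) 0 1) 1"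
proof (induction n)
  case 0
  have "imat 1 0 0 1 = mat 1" by (rule mat2_eqI) simp_all
  then show ?case by (simp add: one_SL2R_cover)
next
  case (Suc n)
  have A: "imat 1 x 0 1 \<in> carrier SL2R" for x by (rule imat_SL2R) simp
  have "cover_elt N (imat 1 (int n) 0 1) 1 \<otimes>\<^bsub>SL2R_cover N\<^esub> cover_elt N (imat 1 1 0 1) 1 =
      cover_elt N (imat 1 (int n) 0 1 ** imat 1 1 0 1) (1 * 1 * exp (tpi * of_int 0 / of_nat N))"
    by (rule cover_elt_mult[OF A A]) (simp add: imat_mult autom_factor_def matrix_mult_nth_2)
  then show ?case
    using Suc by (simp only: nat_pow_Suc cover_lift_def imat_mult) (simp add: add.commute)
qed

text \<open>Computing the root of unity in the inverse lift is avoided by moving it to the other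
  side: for the conjugate g, the relation g gamma_1 = gamma_1 T^p says that f|gamma_1 is multiplied
  by chi(g) under translation by p, a factor already known from
  \<open>log_quot1_shift\<close>.\<close>

lemma eta_mult_conj_T:
  "eta_mult D p r1 rp (cover_lift (2 * D) (imat 1 0 1 1)
      \<otimes>\<^bsub>SL2R_cover (2 * D)\<^esub> (cover_lift (2 * D) (imat 1 1 0 1) [^]\<^bsub>SL2R_cover (2 * D)\<^esub> p)
      \<otimes>\<^bsub>SL2R_cover (2 * D)\<^esub> inv\<^bsub>SL2R_cover (2 * D)\<^esub> (cover_lift (2 * D) (imat 1 0 1 1))) =
    e (of_real ((real p * r1 + rp) / 24))"
proof -
  have D2: "2 * D > 0" using D by simp
  interpret S: group "SL2R_cover (2 * D)" by (rule group_SL2R_cover[OF D2])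
  define g1 where "g1 = cover_elt (2 * D) (imat 1 0 1 1) 1"
  define gT where "gT = cover_elt (2 * D) (imat 1 (int p) 0 1) 1"
  define g where "g = g1 \<otimes>\<^bsub>SL2R_cover (2 * D)\<^esub> gT \<otimes>\<^bsub>SL2R_cover (2 * D)\<^esub> inv\<^bsub>SL2R_cover (2 * D)\<^esub> g1"
  have M1: "imat 1 0 1 1 \<in> carrier SL2R" and MT: "imat 1 (int p) 0 1 \<in> carrier SL2R"
    by (rule imat_SL2R; simp)+
  have g1: "g1 \<in> carrier (SL2R_cover (2 * D))" unfolding g1_def by (rule cover_elt_in_carrier[OF M1]) simp
  have gT: "gT \<in> carrier (SL2R_cover (2 * D))" unfolding gT_def by (rule cover_elt_in_carrier[OF MT]) simp
  have gc: "g \<in> carrier (SL2R_cover (2 * D))" using g1 gT by (simp add: g_def)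
  have "fst g = imat (1 - int p) (int p) (- int p) (int p + 1)"
    unfolding g_def fst_mult_cover fst_inv_cover[OF D2 g1]
    by (simp only: g1_def gT_def fst_cover_elt inv_SL2R[OF M1] adj2_imat imat_mult) simp
  moreover have "imat (1 - int p) (int p) (- int p) (int p + 1) \<in> Gamma0 p"
    by (rule imat_Gamma0) (simp_all add: algebra_simps)
  ultimately have g: "g \<in> cover_preimage (2 * D) (Gamma0 p)"
    using gc by (simp only: cover_preimage_def mem_Collect_eq simp_thms)
  let ?s = "slash (2 * D) ((r1 + rp) / 2)"
  have f1: "?s (eta_quot p r1 rp) g1 \<tau> = exp (log_quot1 p r1 rp \<tau>)" if "\<tau> \<in> uhp" for \<tau>
    unfolding g1_def slash_cover_elt[OF M1 that] moebius_imat autom_factor_imat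
    unfolding eta_quot_eq power_int_1_left of_int_1 mult_1_left log_quot1_def exp_add[symmetric]
    by (rule arg_cong[where f = exp]) simp
  have "g \<otimes>\<^bsub>SL2R_cover (2 * D)\<^esub> g1 = g1 \<otimes>\<^bsub>SL2R_cover (2 * D)\<^esub> gT"
    using g1 gT by (simp add: g_def S.m_assoc)
  \<comment> \<open>One point suffices for the comparison, because f|gamma_1 is an exponential and
    has no zero.\<close>
  then have "?s (?s (eta_quot p r1 rp) g) g1 \<i> = ?s (?s (eta_quot p r1 rp) g1) gT \<i>"
    using slash_mult[OF D2 weight_int[OF p_pos D r] gc g1 ii_in_uhp] slash_mult[OF D2 weight_int[OF p_pos D r] g1 gT ii_in_uhp]
    by metis
  moreover have "?s (?s (eta_quot p r1 rp) g) g1 \<i> = eta_mult D p r1 rp g * ?s (eta_quot p r1 rp) g1 \<i>"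
    unfolding g1_def slash_cover_elt[OF M1 ii_in_uhp] eta_mult_props(2)[OF p_pos D r g moebius_in_uhp[OF M1 ii_in_uhp]]
    by (simp only: mult_ac)
  moreover have "?s (?s (eta_quot p r1 rp) g1) gT \<i> = ?s (eta_quot p r1 rp) g1 (\<i> + of_int (int p * 1))"
    unfolding gT_def slash_cover_elt[OF MT ii_in_uhp] moebius_imat autom_factor_imat
    by (simp add: moeb_def)
  ultimately have "eta_mult D p r1 rp g * exp (log_quot1 p r1 rp \<i>) = exp (log_quot1 p r1 rp (\<i> + of_int (int p * 1)))"
    using f1[OF ii_in_uhp] f1[OF uhp_add_int[OF ii_in_uhp]] by metis
  also have "\<dots> = e (of_real ((real p * r1 + rp) / 24)) * exp (log_quot1 p r1 rp \<i>)"
    unfolding log_quot1_shift[OF p_pos ii_in_uhp] exp_add by (simp add: e_def)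
  finally have "eta_mult D p r1 rp g = e (of_real ((real p * r1 + rp) / 24))" by simp
  then show ?thesis
    unfolding g_def g1_def gT_def cover_lift_T_power unfolding cover_lift_def .
qed

end

theorem theorem6p1:
  fixes p D :: nat and r1 rp k k' n_inf n_one :: real and T \<gamma>1 :: "real ^ 2 ^ 2"
  assumes "prime p"
    and "r1 \<in> \<rat>" and "rp \<in> \<rat>"
    and "n_inf = (r1 + real p * rp) / 24"
    and "n_one = (real p * r1 + rp) / 24"
    and "k' = (r1 + rp) / 2"
    and "D > 0" and "real D * r1 \<in> \<int>" and "real D * rp \<in> \<int>"
    and "k \<in> \<rat>" and "\<exists>m::int. k = k' + 2 * of_int m" and "k > 2"
    and "T = mat2 1 1 0 1" and "\<gamma>1 = mat2 1 0 1 1"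
  shows "((eta_mult D p r1 rp (cover_lift (2 * D) T) = 1 \<longleftrightarrow> n_inf \<in> \<int>) \<and>
      (n_inf \<in> \<int> \<longrightarrow>
        eis_inf_well_defined k p r1 rp \<and>
        eis_inf k p r1 rp \<in> modular_forms (2 * D) k (Gamma0 p) (eta_mult D p r1 rp))) \<and>
      ((eta_mult D p r1 rp
            (cover_lift (2 * D) \<gamma>1
              \<otimes>\<^bsub>SL2R_cover (2 * D)\<^esub> (cover_lift (2 * D) T [^]\<^bsub>SL2R_cover (2 * D)\<^esub> p)
              \<otimes>\<^bsub>SL2R_cover (2 * D)\<^esub> inv\<^bsub>SL2R_cover (2 * D)\<^esub> (cover_lift (2 * D) \<gamma>1)) = 1
          \<longleftrightarrow> n_one \<in> \<int>) \<and>
      (n_one \<in> \<int> \<longrightarrow>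
        eis_one_well_defined k p r1 rp \<and>
        eis_one k p r1 rp \<in> modular_forms (2 * D) k (Gamma0 p) (eta_mult D p r1 rp)))"
proof -
  obtain m where "k = k' + 2 * of_int m" using assms(11) by blast
  then have k: "k = (r1 + rp) / 2 + 2 * of_int m" by (simp only: assms(6))
  have T: "T = imat 1 1 0 1" and \<gamma>1: "\<gamma>1 = imat 1 0 1 1" using assms(13,14) by simp_all
  note h = assms(1,7,8,9) k assms(12)
  show ?thesis
    unfolding T \<gamma>1 eta_mult_T[OF h] eta_mult_conj_T[OF h] e_of_real_eq_1_iff
    using eis_inf_modular[OF h] eis_one_modular[OF h] by (auto simp: assms(4,5))
qed

end
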